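(* Let $T>0$, let $\omega\subset(1,\pi)$ be a nonempty open set and let $0<\alpha_1<\alpha_2<1$. Let $\xi_1,\xi_2$ and $f_1,f_2$ be the functions defined in the context. Then $\xi_1$ and $\xi_2$ are bounded and smooth on $(0,T)\times(1,\pi)$. In particular, $f_1$ and $f_2$ are bounded and smooth on $(0,T)\times(0,\pi)$. Moreover, $\xi_1$ and $\xi_2$ are linearly independent in $L^2((0,T)\times\omega)$.
   Context: Let $c=\sqrt{p'(1)}>0$, where $p$ is a pressure function, smooth around $1$ with $p'(1)>0$. For $i=1,2$, $(\zeta_i,\xi_i)$ denotes the solution (in the usual weak/Duhamel sense) of the linearized adjoint system $$-\partial_t\zeta_i-\partial_x\xi_i=0,\qquad -\partial_t\xi_i-c^2\partial_x\zeta_i=\partial_{xx}\xi_i+\delta_{\alpha_i}\quad\text{in }(0,T)\times(0,\pi),$$ $$\xi_i(t,0)=\xi_i(t,\pi)=0\ \ (t\in(0,T)),\qquad (\zeta_i,\xi_i)(T,x)=(0,0)\ \ (x\in(0,\pi)),$$ where $\delta_{\alpha_i}$ is the Dirac delta centered at $x=\alpha_i$. For $\eta>0$, $\chi_\eta$ is a non-negative smooth function supported in $\omega$ such that $\chi_\eta(x)=1$ whenever $\operatorname{dist}(x,\omega^c)\ge\eta$, and $f_i(t,x)=\chi_\eta(x)\,\xi_i(t,x)$ for $i=1,2$. *)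

theory Defs
  imports "HOL-Analysis.Analysis"
begin

text \<open>
  \<open>Ck_on k S f\<close> means that \<open>f\<close> is of class \<open>C\<^sup>k\<close> on the open set \<open>S\<close>: every iterated
  directional derivative of order less than \<open>k\<close> is totally differentiable on \<open>S\<close>, and those
  of order \<open>k\<close> are continuous.
\<close>

primrec Ck_on :: "nat \<Rightarrow> 'a::real_normed_vector set \<Rightarrow> ('a \<Rightarrow> real) \<Rightarrow> bool" where
  "Ck_on 0 S f \<longleftrightarrow> continuous_on S f"
| "Ck_on (Suc k) S f \<longleftrightarrow>
     (\<forall>x\<in>S. f differentiable (at x)) \<and>
     (\<forall>v. Ck_on k S (\<lambda>x. frechet_derivative f (at x) v))"

definition smooth_on :: "'a::real_normed_vector set \<Rightarrow> ('a \<Rightarrow> real) \<Rightarrow> bool" where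
  "smooth_on S f \<longleftrightarrow> (\<forall>k. Ck_on k S f)"

text \<open>
  Elements of \<open>L\<^sup>2(A)\<close> are represented by Borel functions; two of them are identified if they
  agree almost everywhere on \<open>A\<close>.
\<close>

definition L2_on :: "'a::euclidean_space set \<Rightarrow> ('a \<Rightarrow> real) \<Rightarrow> bool" where
  "L2_on A u \<longleftrightarrow>
     set_borel_measurable lborel A u \<and> set_integrable lborel A (\<lambda>x. (u x)\<^sup>2)"

definition L2_linearly_independent ::
  "'a::euclidean_space set \<Rightarrow> ('a \<Rightarrow> real) \<Rightarrow> ('a \<Rightarrow> real) \<Rightarrow> bool" where
  "L2_linearly_independent A u v \<longleftrightarrow>
     L2_on A u \<and> L2_on A v \<and>
     (\<forall>a b. (AE x in lborel. x \<in> A \<longrightarrow> a * u x + b * v x = 0) \<longrightarrow> a = 0 \<and> b = 0)"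

text \<open>
  Boundedness and smoothness of a function that is only determined almost everywhere,
  that is, of a suitable representative.
\<close>

definition bounded_smooth_ae_on :: "'a::euclidean_space set \<Rightarrow> ('a \<Rightarrow> real) \<Rightarrow> bool" where
  "bounded_smooth_ae_on A u \<longleftrightarrow>
     (\<exists>g. smooth_on A g \<and> bounded (g ` A) \<and> (AE x in lborel. x \<in> A \<longrightarrow> u x = g x))"

text \<open>
  \<open>u\<close> is the continuous representative of an element of \<open>H\<^sup>1\<^sub>0(0,\<pi>)\<close> with weak derivative \<open>w\<close>:
  in one dimension, an absolutely continuous function with square integrable derivative
  that vanishes at both end points.
\<close>

definition H10_with_deriv :: "(real \<Rightarrow> real) \<Rightarrow> (real \<Rightarrow> real) \<Rightarrow> bool" where
  "H10_with_deriv u w \<longleftrightarrow>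
     L2_on {0<..<pi} w \<and> u 0 = 0 \<and> u pi = 0 \<and>
     (\<forall>x\<in>{0..pi}. u x = (LINT y:{0..x}|lborel. w y))"

text \<open>The class \<open>C([0,T]; L\<^sup>2(0,\<pi>))\<close>.\<close>

definition C_L2 :: "real \<Rightarrow> (real \<Rightarrow> real \<Rightarrow> real) \<Rightarrow> bool" where
  "C_L2 T u \<longleftrightarrow>
     (\<forall>t\<in>{0..T}. L2_on {0<..<pi} (u t) \<and>
        ((\<lambda>s. LINT x:{0<..<pi}|lborel. (u s x - u t x)\<^sup>2) \<longlongrightarrow> 0) (at t within {0..T}))"

text \<open>
  Weak solutions of
  \<open>- \<partial>\<^sub>t\<zeta> - \<partial>\<^sub>x\<xi> = 0\<close> and \<open>- \<partial>\<^sub>t\<xi> - c\<^sup>2\<partial>\<^sub>x\<zeta> = \<partial>\<^sub>x\<partial>\<^sub>x\<xi> + \<delta>\<^sub>\<alpha>\<close> in \<open>(0,T) \<times> (0,\<pi>)\<close>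
  with \<open>\<xi>(t,0) = \<xi>(t,\<pi>) = 0\<close> and \<open>(\<zeta>,\<xi>)(T,x) = (0,0)\<close>, in the energy class
  \<open>\<zeta>, \<xi> \<in> C([0,T]; L\<^sup>2)\<close>, \<open>\<xi> \<in> L\<^sup>2(0,T; H\<^sup>1\<^sub>0)\<close> (\<open>w\<close> is \<open>\<partial>\<^sub>x\<xi>\<close>).
  The equations are tested with smooth functions of \<open>x\<close> and integrated over \<open>[t,T]\<close>; the test
  functions of the second equation vanish at \<open>0\<close> and \<open>\<pi>\<close>, those of the first one are
  unrestricted because \<open>\<zeta>\<close> satisfies no boundary condition.  Testing \<open>\<delta>\<^sub>\<alpha>\<close> with \<open>\<psi>\<close> gives
  \<open>\<psi> \<alpha>\<close>.
\<close>

definition weak_adjoint_solution ::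
  "real \<Rightarrow> real \<Rightarrow> real \<Rightarrow> (real \<Rightarrow> real \<Rightarrow> real) \<Rightarrow> (real \<Rightarrow> real \<Rightarrow> real) \<Rightarrow> bool" where
  "weak_adjoint_solution c T \<alpha> \<zeta> \<xi> \<longleftrightarrow>
     C_L2 T \<zeta> \<and> C_L2 T \<xi> \<and>
     L2_on ({0<..<T} \<times> {0<..<pi}) (\<lambda>(t, x). \<zeta> t x) \<and>
     L2_on ({0<..<T} \<times> {0<..<pi}) (\<lambda>(t, x). \<xi> t x) \<and>
     (AE x in lborel. x \<in> {0<..<pi} \<longrightarrow> \<zeta> T x = 0 \<and> \<xi> T x = 0) \<and>
     (\<exists>w. L2_on ({0<..<T} \<times> {0<..<pi}) (\<lambda>(t, x). w t x) \<and>
        (AE t in lborel. t \<in> {0<..<T} \<longrightarrow> H10_with_deriv (\<xi> t) (w t)) \<and>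
        (\<forall>\<phi>. smooth_on UNIV \<phi> \<longrightarrow>
           (\<forall>t\<in>{0..T}.
              (LINT x:{0<..<pi}|lborel. \<zeta> t x * \<phi> x) - (LINT x:{0<..<pi}|lborel. \<zeta> T x * \<phi> x) =
              (LINT s:{t..T}|lborel. LINT x:{0<..<pi}|lborel. w s x * \<phi> x))) \<and>
        (\<forall>\<psi>. smooth_on UNIV \<psi> \<and> \<psi> 0 = 0 \<and> \<psi> pi = 0 \<longrightarrow>
           (\<forall>t\<in>{0..T}.
              (LINT x:{0<..<pi}|lborel. \<xi> t x * \<psi> x) - (LINT x:{0<..<pi}|lborel. \<xi> T x * \<psi> x) =
              (LINT s:{t..T}|lborel.
                 - (LINT x:{0<..<pi}|lborel. (c\<^sup>2 * \<zeta> s x + w s x) * deriv \<psi> x) + \<psi> \<alpha>))))"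

text \<open>
  The cut-off functions \<open>\<chi>\<^sub>\<eta>\<close> (the letter \<open>\<chi>\<close> is reserved for vectors); the complement of
  \<open>\<omega>\<close> is taken in the real line, and the support is the closed support.
\<close>

definition cutoff :: "real set \<Rightarrow> real \<Rightarrow> (real \<Rightarrow> real) \<Rightarrow> bool" where
  "cutoff \<omega> \<eta> \<rho> \<longleftrightarrow>
     smooth_on UNIV \<rho> \<and> (\<forall>x. 0 \<le> \<rho> x) \<and> closure {x. \<rho> x \<noteq> 0} \<subseteq> \<omega> \<and>
     (\<forall>x. \<eta> \<le> infdist x (- \<omega>) \<longrightarrow> \<rho> x = 1)"

end

theory Submission
  imports Defs "HOL-Complex_Analysis.Complex_Analysis" "HOL-Real_Asymp.Real_Asymp"
begin

text \<open>
  Testing with \<open>cos (n * x)\<close> and \<open>sin (n * x)\<close> turns the weak formulation into one ODE per mode, so that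
  \<open>\<xi> t x = 2 / \<pi> * (\<Sum>n. h\<^sub>n (T - t) * sin (n * \<alpha>) * sin (n * x))\<close> with
  \<open>h\<^sub>n'' + n\<^sup>2 h\<^sub>n' + c\<^sup>2 n\<^sup>2 h\<^sub>n = 0\<close>, \<open>h\<^sub>n 0 = 0\<close>, \<open>h\<^sub>n' 0 = 1\<close>.  An energy estimate gives
  \<open>\<bar>h\<^sub>n\<bar> \<le> 1 / n\<^sup>2\<close>, hence boundedness.  For large \<open>n\<close>, one characteristic root is close to \<open>- n\<^sup>2\<close>
  and its contribution is smooth for \<open>T - t > 0\<close>; the other one is analytic in \<open>1 / n\<^sup>2\<close>, and expanding
  in powers of \<open>1 / n\<^sup>2\<close> leaves the functions \<open>\<Sum>n. sin (n * \<alpha>) * sin (n * x) / n ^ (2 * k + 2)\<close>, which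
  are polynomials in \<open>x\<close> on either side of \<open>\<alpha>\<close>.

  If \<open>a \<xi>\<^sub>1 + b \<xi>\<^sub>2\<close> vanishes on \<open>(0, T) \<times> \<omega>\<close>, its Laplace transform in \<open>T - t\<close> at a point
  \<open>x > \<alpha>\<^sub>2\<close> is, up to \<open>O(exp (- p * T))\<close>, a combination of Green functions proportional to
  \<open>a * sinh (k * \<alpha>\<^sub>1) + b * sinh (k * \<alpha>\<^sub>2)\<close> with \<open>k\<^sup>2 = p\<^sup>2 / (p + c\<^sup>2)\<close>.  As \<open>k\<close> is of order \<open>sqrt p\<close>,
  letting \<open>p \<rightarrow> \<infinity>\<close> forces \<open>b = 0\<close> and then \<open>a = 0\<close>.
\<close>

section \<open>Iterated differentiability\<close>

text \<open>The obstacle is that the coefficients decay like \<open>1 / n ^ 2\<close> and no faster.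
  The Dirac source leaves a kink in \<open>x\<close> at \<alpha>, and the root tending to
  \<open>- c\<^sup>2\<close> damps all high frequencies at nearly the same rate, so time does not
  smooth that part. Smoothness for \<open>x > \<alpha>\<close> is thus a matter of cancellation, not
  of decay, and is read off from closed forms. Two uniformities justify the expansion in
  \<open>1 / n ^ 2\<close>. It is applied only for \<open>n \<ge> N\<close> with
  \<open>N > 2 * c\<close>, which puts \<open>1 / N ^ 2\<close> inside the disc of radius
  \<open>1 / (4 * c\<^sup>2)\<close> on which the slow root is analytic; and each \<open>x\<close>
  derivative of the tail of level \<open>k\<close> is bounded by a multiple of
  \<open>N ^ (- 2 * k)\<close> that does not depend on \<open>k\<close>. The finitely many other
  modes, with possibly complex or double roots, are smooth one by one. For independence a single
  point \<open>x\<close> is enough. Inverting the Green function costs about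
  \<open>exp (pi * sqrt p)\<close>, which \<open>exp (- p * T)\<close> beats for every
  \<open>T > 0\<close>, so no minimal time appears. As weak solutions are known only almost
  everywhere, everything is proved for one representative, the sine series itself.\<close>

lemma Ck_on_cong:
  assumes "open S" "\<And>x. x \<in> S \<Longrightarrow> f x = g x"
  shows "Ck_on k S f \<longleftrightarrow> Ck_on k S g"
  using assms(2)
proof (induction k arbitrary: f g)
  case 0
  then show ?case by (simp cong: continuous_on_cong)
next
  case (Suc k)
  have d: "(f has_derivative D) (at x) \<longleftrightarrow> (g has_derivative D) (at x)" if "x \<in> S" for x D
    using has_derivative_transform_within_open[OF _ assms(1) that, of f D UNIV g]
      has_derivative_transform_within_open[OF _ assms(1) that, of g D UNIV f] Suc.prems by auto
  have fd: "frechet_derivative f (at x) = frechet_derivative g (at x)" if "x \<in> S" for x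
    unfolding frechet_derivative_def using d[OF that] by simp
  have "Ck_on k S (\<lambda>x. frechet_derivative f (at x) v) \<longleftrightarrow> Ck_on k S (\<lambda>x. frechet_derivative g (at x) v)" for v
    by (rule Suc.IH) (simp add: fd)
  then show ?case using d by (auto simp: differentiable_def)
qed

text \<open>\<open>Ck_on\<close> speaks of \<open>frechet_derivative\<close>, a chosen derivative
  that is awkward to compute with. Uniqueness of derivatives lets any candidate \<open>D\<close>
  replace it on the open set \<open>S\<close>.\<close>

lemma Ck_on_SucI:
  assumes "open S" "\<And>x. x \<in> S \<Longrightarrow> (f has_derivative D x) (at x)" "\<And>v. Ck_on k S (\<lambda>x. D x v)"
  shows "Ck_on (Suc k) S f"
proof -
  have "frechet_derivative f (at x) = D x" if "x \<in> S" for x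
    using assms(2)[OF that] by (metis frechet_derivative_at)
  then have "Ck_on k S (\<lambda>x. frechet_derivative f (at x) v) \<longleftrightarrow> Ck_on k S (\<lambda>x. D x v)" for v
    by (intro Ck_on_cong assms) auto
  then show ?thesis using assms(2,3) by (auto simp: differentiable_def)
qed

lemma Ck_on_SucD:
  "Ck_on (Suc k) S f \<Longrightarrow> x \<in> S \<Longrightarrow> (f has_derivative frechet_derivative f (at x)) (at x)"
  by (simp add: frechet_derivative_works)

lemma Ck_on_Suc_imp: "Ck_on (Suc k) S f \<Longrightarrow> Ck_on k S f"
proof (induction k arbitrary: f)
  case 0
  then show ?case
    by (auto intro!: continuous_at_imp_continuous_on differentiable_imp_continuous_within)
next
  case (Suc k)
  then show ?case by (metis Ck_on.simps(2))
qed

lemma Ck_on_const: "open S \<Longrightarrow> Ck_on k S (\<lambda>x. a)"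
proof (induction k arbitrary: a)
  case (Suc k)
  then show ?case by (intro Ck_on_SucI[where D = "\<lambda>x v. 0"]) auto
qed simp

lemma Ck_on_add:
  assumes "open S" shows "Ck_on k S f \<Longrightarrow> Ck_on k S g \<Longrightarrow> Ck_on k S (\<lambda>x. f x + g x)"
proof (induction k arbitrary: f g)
  case (Suc k)
  show ?case
    by (rule Ck_on_SucI[where D = "\<lambda>x v. frechet_derivative f (at x) v + frechet_derivative g (at x) v"])
      (use Suc assms in \<open>auto intro!: has_derivative_add Ck_on_SucD simp del: Ck_on.simps, auto\<close>)
qed (auto intro: continuous_intros)

lemma Ck_on_mult:
  assumes "open S" shows "Ck_on k S f \<Longrightarrow> Ck_on k S g \<Longrightarrow> Ck_on k S (\<lambda>x. f x * g x)"
proof (induction k arbitrary: f g)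
  case (Suc k)
  show ?case
  proof (rule Ck_on_SucI[OF assms, where D = "\<lambda>x v. f x * frechet_derivative g (at x) v + frechet_derivative f (at x) v * g x"])
    show "((\<lambda>x. f x * g x) has_derivative (\<lambda>v. f x * frechet_derivative g (at x) v + frechet_derivative f (at x) v * g x)) (at x)"
      if "x \<in> S" for x
      using that Suc.prems by (intro has_derivative_mult Ck_on_SucD)
    show "Ck_on k S (\<lambda>x. f x * frechet_derivative g (at x) v + frechet_derivative f (at x) v * g x)" for v
      using Suc.prems by (intro Ck_on_add assms Suc.IH) (auto intro: Ck_on_Suc_imp simp del: Ck_on.simps, auto)
  qed
qed (auto intro: continuous_intros)

text \<open>Differentiability is demanded in the full space and not within \<open>S\<close>, so
  every clause of \<open>Ck_on\<close> is a condition near each point. This allows pasting where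
  estimates are only locally uniform.\<close>

lemma Ck_on_locally:
  assumes "\<And>x. x \<in> S \<Longrightarrow> \<exists>U. open U \<and> x \<in> U \<and> Ck_on k U f"
  shows "Ck_on k S f"
  using assms
proof (induction k arbitrary: f)
  case 0
  have "continuous (at x) f" if "x \<in> S" for x
    using 0[OF that] by (auto simp: continuous_on_eq_continuous_at)
  then show ?case by (simp add: continuous_at_imp_continuous_on)
next
  case (Suc k)
  have "Ck_on k S (\<lambda>x. frechet_derivative f (at x) v)" for v
    by (rule Suc.IH) (use Suc.prems in \<open>fastforce\<close>)
  moreover have "f differentiable at x" if "x \<in> S" for x
    using Suc.prems[OF that] by auto
  ultimately show ?case by simp
qed

lemma Ck_on_subset: "Ck_on k S f \<Longrightarrow> A \<subseteq> S \<Longrightarrow> Ck_on k A f"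
  by (induction k arbitrary: f) (auto intro: continuous_on_subset)

text \<open>The derivative of \<open>f (b + L x)\<close> in direction \<open>v\<close> is the
  derivative of \<open>f\<close> in direction \<open>L v\<close>, composed with the same affine map,
  so the induction closes without a product rule. Affine maps suffice for the coordinate
  projections, the time reversal \<open>s = T - t\<close>, and \<open>cos\<close> as a shifted
  \<open>sin\<close>.\<close>

lemma Ck_on_affine:
  fixes L :: "'a::real_normed_vector \<Rightarrow> 'b::real_normed_vector"
  assumes "open S" "open U" "bounded_linear L" "\<And>x. x \<in> U \<Longrightarrow> b + L x \<in> S"
  shows "Ck_on k S f \<Longrightarrow> Ck_on k U (\<lambda>x. f (b + L x))"
proof (induction k arbitrary: f)
  case 0
  have "continuous_on U (\<lambda>x. b + L x)"
    by (intro continuous_intros linear_continuous_on assms)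
  then show ?case using 0 assms(4)
    by (auto intro: continuous_on_compose2)
next
  case (Suc k)
  interpret L: bounded_linear L by fact
  show ?case
  proof (rule Ck_on_SucI[OF assms(2), where D = "\<lambda>x v. frechet_derivative f (at (b + L x)) (L v)"])
    show "((\<lambda>x. f (b + L x)) has_derivative (\<lambda>v. frechet_derivative f (at (b + L x)) (L v))) (at x)" if "x \<in> U" for x
    proof -
      have "((\<lambda>x. b + L x) has_derivative L) (at x)"
        by (auto intro!: derivative_eq_intros L.has_derivative)
      moreover have "(f has_derivative frechet_derivative f (at (b + L x))) (at (b + L x))"
        using Suc.prems assms(4)[OF that] by (rule Ck_on_SucD)
      ultimately show ?thesis using has_derivative_compose by blast
    qed
    show "Ck_on k U (\<lambda>x. frechet_derivative f (at (b + L x)) (L v))" for v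
      using Suc.prems by (intro Suc.IH) simp
  qed
qed

lemma smooth_on_cong: "open S \<Longrightarrow> (\<And>x. x \<in> S \<Longrightarrow> f x = g x) \<Longrightarrow> smooth_on S f \<longleftrightarrow> smooth_on S g"
  unfolding smooth_on_def using Ck_on_cong by metis

lemma smooth_on_add: "open S \<Longrightarrow> smooth_on S f \<Longrightarrow> smooth_on S g \<Longrightarrow> smooth_on S (\<lambda>x. f x + g x)"
  by (simp add: smooth_on_def Ck_on_add)

lemma smooth_on_mult: "open S \<Longrightarrow> smooth_on S f \<Longrightarrow> smooth_on S g \<Longrightarrow> smooth_on S (\<lambda>x. f x * g x)"
  by (simp add: smooth_on_def Ck_on_mult)

lemma smooth_on_const: "open S \<Longrightarrow> smooth_on S (\<lambda>x. a)"
  by (simp add: smooth_on_def Ck_on_const)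

lemma smooth_on_sum:
  "open S \<Longrightarrow> (\<And>i. i \<in> I \<Longrightarrow> smooth_on S (f i)) \<Longrightarrow> smooth_on S (\<lambda>x. \<Sum>i\<in>I. f i x)"
  by (induction I rule: infinite_finite_induct) (auto intro: smooth_on_add smooth_on_const)

lemma smooth_on_locally:
  assumes "\<And>x. x \<in> S \<Longrightarrow> \<exists>U. open U \<and> x \<in> U \<and> smooth_on U f"
  shows "smooth_on S f"
  using assms unfolding smooth_on_def by (meson Ck_on_locally)

lemma smooth_on_subset: "smooth_on S f \<Longrightarrow> A \<subseteq> S \<Longrightarrow> smooth_on A f"
  unfolding smooth_on_def using Ck_on_subset by blast

lemma smooth_on_affine:
  fixes L :: "'a::real_normed_vector \<Rightarrow> 'b::real_normed_vector"
  assumes "open S" "open U" "bounded_linear L" "\<And>x. x \<in> U \<Longrightarrow> b + L x \<in> S" "smooth_on S f"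
  shows "smooth_on U (\<lambda>x. f (b + L x))"
  using assms Ck_on_affine[of S U L b] by (auto simp: smooth_on_def)

lemma smooth_on_continuous: "smooth_on S f \<Longrightarrow> continuous_on S f"
  unfolding smooth_on_def by (metis Ck_on.simps(1))

section \<open>Smoothness from explicit families of derivatives\<close>

lemma smooth_on_real_family:
  fixes u :: "nat \<Rightarrow> real \<Rightarrow> real"
  assumes "open S" "\<And>i x. x \<in> S \<Longrightarrow> (u i has_real_derivative u (Suc i) x) (at x)"
  shows "smooth_on S (u i)"
proof -
  have "Ck_on k S (u i)" for k i
  proof (induction k arbitrary: i)
    case 0
    then show ?case using assms(2) by (auto intro!: continuous_at_imp_continuous_on DERIV_isCont)
  next
    case (Suc k)
    show ?case
      by (rule Ck_on_SucI[OF assms(1), where D = "\<lambda>x v. u (Suc i) x * v"])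
        (use assms Suc in \<open>auto simp: has_field_derivative_def intro!: Ck_on_mult Ck_on_const\<close>)
  qed
  then show ?thesis by (simp add: smooth_on_def)
qed

text \<open>\<open>D i j\<close> plays the role of the derivative of order \<open>i\<close> in the
  first and \<open>j\<close> in the second variable. Directional derivatives combine members of the
  family with constant coefficients, so one induction on the order serves all of them.\<close>

lemma smooth_on_prod_family:
  fixes D :: "nat \<Rightarrow> nat \<Rightarrow> real \<times> real \<Rightarrow> real"
  assumes "open S" "\<And>i j p. p \<in> S \<Longrightarrow>
    (D i j has_derivative (\<lambda>v. fst v * D (Suc i) j p + snd v * D i (Suc j) p)) (at p)"
  shows "smooth_on S (D i j)"
proof -
  have "Ck_on k S (D i j)" for k i j
  proof (induction k arbitrary: i j)
    case 0
    then show ?case using assms(2) by (auto intro!: continuous_at_imp_continuous_on has_derivative_continuous)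
  next
    case (Suc k)
    show ?case
      by (rule Ck_on_SucI[OF assms(1), where D = "\<lambda>p v. fst v * D (Suc i) j p + snd v * D i (Suc j) p"])
        (use assms Suc in \<open>auto intro!: Ck_on_mult Ck_on_const Ck_on_add\<close>)
  qed
  then show ?thesis by (simp add: smooth_on_def)
qed

text \<open>The Weierstrass test, applied to every mixed derivative. Convexity enters through
  termwise differentiation, which rests on a mean value inequality.\<close>

lemma smooth_on_product_series:
  fixes u v :: "nat \<Rightarrow> nat \<Rightarrow> real \<Rightarrow> real"
  assumes I: "open I" "convex I" and J: "open J" "convex J"
    and u: "\<And>k i s. s \<in> I \<Longrightarrow> (u k i has_real_derivative u k (Suc i) s) (at s)"
    and v: "\<And>k j x. x \<in> J \<Longrightarrow> (v k j has_real_derivative v k (Suc j) x) (at x)"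
    and M: "\<And>i j. \<exists>M. summable M \<and> (\<forall>k. \<forall>s\<in>I. \<forall>x\<in>J. \<bar>u k i s * v k j x\<bar> \<le> M k)"
  shows "smooth_on (I \<times> J) (\<lambda>(s, x). \<Sum>k. u k 0 s * v k 0 x)"
proof -
  define D where "D i j = (\<lambda>p. \<Sum>k. u k i (fst p) * v k j (snd p))" for i j
  have op: "open (I \<times> J)" "convex (I \<times> J)" using I J by (auto intro: open_Times convex_Times)
  obtain M where M: "summable (M i j)" "\<And>k s x. s \<in> I \<Longrightarrow> x \<in> J \<Longrightarrow> \<bar>u k i s * v k j x\<bar> \<le> M i j k" for i j
    using M by metis
  have sm: "summable (\<lambda>k. u k i (fst p) * v k j (snd p))" if "p \<in> I \<times> J" for i j p
    by (rule summable_comparison_test'[OF M(1)[of i j], where N = 0]) (use M(2) that in auto)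
  have ul: "uniform_limit (I \<times> J) (\<lambda>n p. \<Sum>k<n. u k i (fst p) * v k j (snd p)) (D i j) sequentially" for i j
    unfolding D_def by (rule Weierstrass_m_test[OF _ M(1)[of i j]]) (use M(2) in auto)
  have "(D i j has_derivative (\<lambda>w. fst w * D (Suc i) j p + snd w * D i (Suc j) p)) (at p)"
    if p: "p \<in> I \<times> J" for i j p
  proof -
    let ?f = "\<lambda>k p. u k i (fst p) * v k j (snd p)"
    let ?f' = "\<lambda>k p w. fst w * (u k (Suc i) (fst p) * v k j (snd p)) + snd w * (u k i (fst p) * v k (Suc j) (snd p))"
    have "\<exists>g. \<forall>x\<in>I \<times> J. (\<lambda>n. ?f n x) sums g x \<and>
       (g has_derivative (\<lambda>w. fst w * D (Suc i) j x + snd w * D i (Suc j) x)) (at x within I \<times> J)"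
    proof (rule has_derivative_series[where f' = ?f'])
      show "(?f k has_derivative ?f' k q) (at q within I \<times> J)" if "q \<in> I \<times> J" for k q
      proof -
        have a: "((\<lambda>q. u k i (fst q)) has_derivative (\<lambda>w. u k (Suc i) (fst q) * fst w)) (at q within I \<times> J)"
          using u[of "fst q" k i] that
          by (auto simp: has_field_derivative_def intro!: has_derivative_compose[OF has_derivative_fst[OF has_derivative_ident]])
        have b: "((\<lambda>q. v k j (snd q)) has_derivative (\<lambda>w. v k (Suc j) (snd q) * snd w)) (at q within I \<times> J)"
          using v[of "snd q" k j] that
          by (auto simp: has_field_derivative_def intro!: has_derivative_compose[OF has_derivative_snd[OF has_derivative_ident]])
        show ?thesis
          by (rule has_derivative_eq_rhs[OF has_derivative_mult[OF a b]]) (auto simp: algebra_simps)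
      qed
      show "\<forall>\<^sub>F n in sequentially. \<forall>q\<in>I \<times> J. \<forall>w. norm ((\<Sum>k<n. ?f' k q w) - (fst w * D (Suc i) j q + snd w * D i (Suc j) q)) \<le> e * norm w"
        if "e > 0" for e
      proof -
        have "\<forall>\<^sub>F n in sequentially. \<forall>q\<in>I \<times> J. dist (\<Sum>k<n. u k (Suc i) (fst q) * v k j (snd q)) (D (Suc i) j q) < e/2"
          "\<forall>\<^sub>F n in sequentially. \<forall>q\<in>I \<times> J. dist (\<Sum>k<n. u k i (fst q) * v k (Suc j) (snd q)) (D i (Suc j) q) < e/2"
          using ul[of "Suc i" j] ul[of i "Suc j"] that unfolding uniform_limit_iff by (meson half_gt_zero)+
        then show ?thesis
        proof eventually_elim
          case (elim n)
          show ?case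
          proof (intro ballI allI)
            fix q w assume q: "q \<in> I \<times> J"
            let ?a = "(\<Sum>k<n. u k (Suc i) (fst q) * v k j (snd q)) - D (Suc i) j q"
            let ?b = "(\<Sum>k<n. u k i (fst q) * v k (Suc j) (snd q)) - D i (Suc j) q"
            have "(\<Sum>k<n. ?f' k q w) - (fst w * D (Suc i) j q + snd w * D i (Suc j) q) = fst w * ?a + snd w * ?b"
              by (simp add: sum.distrib sum_distrib_left algebra_simps)
            also have "\<bar>\<dots>\<bar> \<le> \<bar>fst w\<bar> * \<bar>?a\<bar> + \<bar>snd w\<bar> * \<bar>?b\<bar>"
              by (rule order_trans[OF abs_triangle_ineq]) (simp add: abs_mult)
            also have "\<dots> \<le> norm w * (e/2) + norm w * (e/2)"
              using elim q norm_fst_le[of "fst w" "snd w"] norm_snd_le[of "snd w" "fst w"]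
              by (intro add_mono mult_mono) (auto simp: dist_real_def less_imp_le)
            finally show "norm ((\<Sum>k<n. ?f' k q w) - (fst w * D (Suc i) j q + snd w * D i (Suc j) q)) \<le> e * norm w"
              by (simp add: algebra_simps)
          qed
        qed
      qed
      show "(\<lambda>n. ?f n p) sums D i j p" unfolding D_def using sm[OF p] by (rule summable_sums)
    qed (use op p in auto)
    then obtain g where g: "\<And>x. x \<in> I \<times> J \<Longrightarrow> (\<lambda>n. ?f n x) sums g x"
      "\<And>x. x \<in> I \<times> J \<Longrightarrow> (g has_derivative (\<lambda>w. fst w * D (Suc i) j x + snd w * D i (Suc j) x)) (at x within I \<times> J)"
      by blast
    have "(g has_derivative (\<lambda>w. fst w * D (Suc i) j p + snd w * D i (Suc j) p)) (at p)"
      using g(2)[OF p] by (simp only: at_within_open[OF p op(1)])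
    then show ?thesis
      by (rule has_derivative_transform_within_open[OF _ op(1) p]) (use g(1) in \<open>auto simp: D_def sums_iff\<close>)
  qed
  then have "smooth_on (I \<times> J) (D 0 0)"
    by (rule smooth_on_prod_family[OF op(1)])
  then show ?thesis by (simp add: D_def case_prod_unfold)
qed

lemma smooth_on_sin: "smooth_on UNIV (\<lambda>x. sin (a * x))"
proof -
  have "smooth_on UNIV ((\<lambda>i x. a ^ i * (if even i then (-1)^(i div 2) * sin (a * x) else (-1)^(i div 2) * cos (a * x))) 0)"
    by (rule smooth_on_real_family) (auto intro!: derivative_eq_intros simp: field_simps)
  then show ?thesis by simp
qed

lemma smooth_on_cos: "smooth_on UNIV (\<lambda>x. cos (a * x))"
proof -
  have "smooth_on UNIV (\<lambda>x. (\<lambda>y. sin (1 * y)) (pi / 2 + (- a) * x))"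
    by (rule smooth_on_affine[where S = UNIV, OF _ _ bounded_linear_mult_right _ smooth_on_sin]) auto
  then show ?thesis by (simp add: cos_sin_eq)
qed

section \<open>Sine series\<close>

lemma integrable_mult_bounded:
  fixes g b :: "'a \<Rightarrow> real"
  assumes "integrable M g" "b \<in> borel_measurable M" "\<And>x. \<bar>b x\<bar> \<le> B"
  shows "integrable M (\<lambda>x. g x * b x)"
proof (rule Bochner_Integration.integrable_bound)
  show "integrable M (\<lambda>x. B * g x)" using assms(1) by simp
  show "(\<lambda>x. g x * b x) \<in> borel_measurable M" using assms(1,2) by simp
  have "norm (g x * b x) \<le> norm (B * g x)" for x
  proof -
    have "\<bar>g x\<bar> * \<bar>b x\<bar> \<le> \<bar>g x\<bar> * \<bar>B\<bar>"
      using assms(3)[of x] by (intro mult_left_mono) auto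
    then show ?thesis by (simp add: abs_mult mult.commute)
  qed
  then show "AE x in M. norm (g x * b x) \<le> norm (B * g x)" by simp
qed

text \<open>Half-lines are stable under intersection and generate the Borel sets, so a Dynkin class
  argument spreads the vanishing to all Borel sets. The total integral is a separate hypothesis
  because complements are taken and the whole line is not one of the half-lines.\<close>

lemma integral_halflines_zero_imp_AE_zero:
  fixes g :: "real \<Rightarrow> real"
  assumes g: "integrable lborel g" and z: "\<And>b. (LINT x:{..<b}|lborel. g x) = 0"
    and tot: "(LINT x|lborel. g x) = 0"
  shows "AE x in lborel. g x = 0"
proof (rule sigma_finite_measure.density_zero[OF lborel.sigma_finite_measure_axioms g])
  have si: "set_integrable lborel A g" if "A \<in> sets lborel" for A
    using g that unfolding set_integrable_def by (rule integrable_mult_indicator[rotated])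
  fix A :: "real set" assume "A \<in> sets lborel"
  then have A: "A \<in> sigma_sets UNIV (range lessThan)" by (simp add: borel_Iio)
  have sub: "sigma_sets UNIV (range lessThan) \<subseteq> sets (borel :: real measure)" by (simp add: borel_Iio)
  have "Int_stable (range (lessThan :: real \<Rightarrow> _))"
  proof -
    have "{..<a} \<inter> {..<b} = {..<min a b}" for a b :: real by auto
    then show ?thesis by (simp add: Int_stable_def)
  qed
  from this _ A show "set_lebesgue_integral lborel A g = 0"
  proof (rule sigma_sets_induct_disjoint)
    show "set_lebesgue_integral lborel A g = 0" if "A \<in> range lessThan" for A
      using z that by auto
    show "set_lebesgue_integral lborel {} g = 0" by (simp add: set_lebesgue_integral_def)
    show "set_lebesgue_integral lborel (UNIV - A) g = 0"
      if "A \<in> sigma_sets UNIV (range lessThan)" "set_lebesgue_integral lborel A g = 0" for A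
    proof -
      have "A \<in> sets lborel" using that sub by auto
      then have "set_lebesgue_integral lborel (A \<union> (UNIV - A)) g
          = set_lebesgue_integral lborel A g + set_lebesgue_integral lborel (UNIV - A) g"
        by (intro set_integral_Un si) auto
      then show ?thesis using that tot by (simp add: set_lebesgue_integral_def)
    qed
    show "set_lebesgue_integral lborel (\<Union>i. A i) g = 0"
      if "disjoint_family A" "range A \<subseteq> sigma_sets UNIV (range lessThan)"
        "\<And>i. set_lebesgue_integral lborel (A i) g = 0" for A :: "nat \<Rightarrow> _"
    proof -
      have m: "A i \<in> sets lborel" for i using that(2) sub by auto
      have "set_lebesgue_integral lborel (\<Union>i. A i) g = (\<Sum>i. set_lebesgue_integral lborel (A i) g)"
        using that(1) m by (intro lebesgue_integral_countable_add si) (auto simp: disjoint_family_on_def)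
      then show ?thesis using that(3) by simp
    qed
  qed simp
qed

text \<open>
  As \<open>sin x * p (cos x)\<close> lies in the span of the functions \<open>sin (real n * x)\<close> for every polynomial \<open>p\<close>,
  completeness of the sine system reduces to the Weierstrass theorem in the variable \<open>cos x\<close>.
\<close>

lemma sine_coeffs_zero_imp_AE_zero:
  fixes f :: "real \<Rightarrow> real"
  assumes f: "set_integrable lborel {0<..<pi} f"
    and z: "\<And>n::nat. (LINT x:{0<..<pi}|lborel. f x * sin (real n * x)) = 0"
  shows "AE x in lborel. x \<in> {0<..<pi} \<longrightarrow> f x = 0"
proof -
  define g where "g x = indicator {0<..<pi} x * f x" for x
  have g: "integrable lborel g" using f by (simp add: set_integrable_def g_def[abs_def])
  note gb = integrable_mult_bounded[OF g]
  have g0: "(LINT x|lborel. g x * sin (real n * x)) = 0" for n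
    using z[of n] by (simp add: g_def set_lebesgue_integral_def mult.assoc)
  have sc: "(\<lambda>x. sin (real k * x) * cos x ^ m) \<in> borel_measurable lborel"
    "\<bar>sin (real k * x) * cos x ^ m\<bar> \<le> 1" for k m x
    by (simp_all add: abs_mult power_abs mult_le_one power_le_one)
  \<comment> \<open>Induction on the power of \<open>cos x\<close>: the product
    \<open>sin (k * x) * cos x\<close> is half the sum of \<open>sin ((k + 1) * x)\<close> and
    \<open>sin ((k - 1) * x)\<close>, so each factor shifts the frequency by one. For
    \<open>k = 0\<close> the integrand is zero.\<close>
  have gm: "(LINT x|lborel. g x * (sin (real k * x) * cos x ^ m)) = 0" for k m
  proof (induction m arbitrary: k)
    case 0
    then show ?case using g0 by simp
  next
    case (Suc m)
    show ?case
    proof (cases k)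
      case (Suc l)
      have tr: "sin (real k * x) * cos x = (1/2) * (sin (real (Suc k) * x) + sin (real l * x))" for x :: real
      proof -
        have "sin (real (Suc k) * x) = sin (real k * x + x)" "sin (real l * x) = sin (real k * x - x)"
          using Suc by (simp_all add: algebra_simps)
        then show ?thesis by (simp add: sin_add sin_diff)
      qed
      have "g x * (sin (real k * x) * cos x ^ Suc m)
         = (1/2) * (g x * (sin (real (Suc k) * x) * cos x ^ m)) + (1/2) * (g x * (sin (real l * x) * cos x ^ m))" for x
      proof -
        have "g x * (sin (real k * x) * cos x ^ Suc m) = g x * ((sin (real k * x) * cos x) * cos x ^ m)"
          by simp
        then show ?thesis unfolding tr by (simp add: algebra_simps del: of_nat_Suc)
      qed
      then have "(LINT x|lborel. g x * (sin (real k * x) * cos x ^ Suc m))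
         = (1/2) * (LINT x|lborel. g x * (sin (real (Suc k) * x) * cos x ^ m))
         + (1/2) * (LINT x|lborel. g x * (sin (real l * x) * cos x ^ m))"
        by (simp add: gb[OF sc] del: of_nat_Suc power_Suc)
      then show ?thesis by (simp only: Suc.IH)
    qed simp
  qed
  have gp: "(LINT x|lborel. g x * (sin x * p (cos x))) = 0" if p: "real_polynomial_function p" for p
  proof -
    obtain a and N :: nat where p: "p = (\<lambda>x. \<Sum>i\<le>N. a i * x ^ i)"
      using p real_polynomial_function_iff_sum by metis
    have "(LINT x|lborel. g x * (sin x * p (cos x))) = (LINT x|lborel. (\<Sum>i\<le>N. a i * (g x * (sin (real 1 * x) * cos x ^ i))))"
      by (simp add: p sum_distrib_left algebra_simps)
    also have "\<dots> = (\<Sum>i\<le>N. (LINT x|lborel. a i * (g x * (sin (real 1 * x) * cos x ^ i))))"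
      by (rule Bochner_Integration.integral_sum) (intro integrable_mult_right gb[OF sc])
    also have "\<dots> = 0"
      using gm[of 1] by simp
    finally show ?thesis .
  qed
  have gc: "(LINT x|lborel. g x * (sin x * \<phi> (cos x))) = 0" if c: "continuous_on UNIV \<phi>" for \<phi> :: "real \<Rightarrow> real"
  proof -
    have bs: "bounded (\<phi> ` {-1..1})"
      using c by (intro compact_imp_bounded compact_continuous_image) (auto intro: continuous_on_subset)
    then obtain B where "\<And>y. y \<in> {-1..1} \<Longrightarrow> \<bar>\<phi> y\<bar> \<le> B"
      unfolding bounded_iff by (metis image_eqI real_norm_def)
    then have B: "\<bar>\<phi> (cos x)\<bar> \<le> B" for x by auto
    have m\<phi>: "\<phi> \<in> borel_measurable borel" by (intro borel_measurable_continuous_onI c)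
    have i\<phi>: "integrable lborel (\<lambda>x. g x * (sin x * \<phi> (cos x)))"
    proof (rule gb)
      show "\<bar>sin x * \<phi> (cos x)\<bar> \<le> 1 * B" for x
        unfolding abs_mult using B by (intro mult_mono) auto
    qed (use m\<phi> in measurable)
    have "\<bar>LINT x|lborel. g x * (sin x * \<phi> (cos x))\<bar> \<le> e * (LINT x|lborel. \<bar>g x\<bar>)" if e0: "e > 0" for e
    proof -
      obtain p where p: "real_polynomial_function p" "\<And>y. y \<in> {-1..1} \<Longrightarrow> \<bar>\<phi> y - p y\<bar> < e"
        using Stone_Weierstrass_real_polynomial_function[OF compact_Icc continuous_on_subset[OF c subset_UNIV] e0]
        by blast
      have cp: "continuous_on UNIV p"
        using p(1) by (simp add: continuous_on_polymonial_function real_polynomial_function_eq)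
      have mp: "p \<in> borel_measurable borel" by (intro borel_measurable_continuous_onI cp)
      have bd: "\<bar>sin x * (\<phi> (cos x) - p (cos x))\<bar> \<le> e" for x
      proof -
        have "\<bar>sin x * (\<phi> (cos x) - p (cos x))\<bar> \<le> 1 * e"
          unfolding abs_mult using p(2)[of "cos x"] by (intro mult_mono) (auto intro: less_imp_le)
        then show ?thesis by simp
      qed
      have id: "integrable lborel (\<lambda>x. g x * (sin x * (\<phi> (cos x) - p (cos x))))"
        by (rule gb[OF _ bd]) (use m\<phi> mp in measurable)
      have ip: "integrable lborel (\<lambda>x. g x * (sin x * p (cos x)))"
        using Bochner_Integration.integrable_diff[OF i\<phi> id] by (simp add: algebra_simps)
      have "(LINT x|lborel. g x * (sin x * \<phi> (cos x))) = (LINT x|lborel. g x * (sin x * (\<phi> (cos x) - p (cos x))))"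
        using gp[OF p(1)] Bochner_Integration.integral_add[OF id ip] by (simp add: algebra_simps)
      also have "\<bar>\<dots>\<bar> \<le> (LINT x|lborel. \<bar>g x * (sin x * (\<phi> (cos x) - p (cos x)))\<bar>)"
        by (rule integral_abs_bound)
      also have "\<dots> \<le> (LINT x|lborel. e * \<bar>g x\<bar>)"
      proof (rule integral_mono)
        show "\<bar>g x * (sin x * (\<phi> (cos x) - p (cos x)))\<bar> \<le> e * \<bar>g x\<bar>" for x
          unfolding abs_mult[of "g x"] using mult_left_mono[OF bd[of x], of "\<bar>g x\<bar>"] by (simp add: mult.commute)
      qed (use id g in auto)
      finally show ?thesis by simp
    qed
    note le = this
    show ?thesis
    proof (rule ccontr)
      let ?i = "LINT x|lborel. g x * (sin x * \<phi> (cos x))" and ?G = "LINT x|lborel. \<bar>g x\<bar>"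
      assume n: "?i \<noteq> 0"
      have G: "?G \<ge> 0" by simp
      \<comment> \<open>The tolerance is chosen so that multiplication by \<open>?G\<close> leaves
        less than \<open>\<bar>?i\<bar>\<close>; the summand 1 keeps it meaningful when
        \<open>?G\<close> is zero.\<close>
      have "\<bar>?i\<bar> \<le> (\<bar>?i\<bar> / (2 * (?G + 1))) * ?G"
        by (rule le) (use n G in \<open>auto simp: add_nonneg_pos\<close>)
      also have "\<dots> < \<bar>?i\<bar>"
      proof -
        have "I / (2 * (G + 1)) * G < I" if "I > 0" "G \<ge> 0" for I G :: real
        proof -
          have "I * G \<ge> 0" using that by simp
          then have "I * G < I * (2 * (G + 1))" using that by (simp add: algebra_simps add_nonneg_pos)
          then show ?thesis using that by (simp add: pos_divide_less_eq)
        qed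
        then show ?thesis using n G by simp
      qed
      finally show False by simp
    qed
  qed
  have "(LINT x:{..<b}|lborel. g x * sin x) = 0" for b
  proof -
    consider "b \<le> 0" | "b \<ge> pi" | "0 < b" "b < pi" by linarith
    then show ?thesis
    proof cases
      case 1
      then have e: "indicator {..<b} x *\<^sub>R (g x * sin x) = 0" for x :: real
        by (auto simp: g_def indicator_def)
      show ?thesis unfolding set_lebesgue_integral_def e by simp
    next
      case 2
      then have e: "indicator {..<b} x *\<^sub>R (g x * sin x) = g x * sin x" for x :: real
        by (auto simp: g_def indicator_def)
      show ?thesis unfolding set_lebesgue_integral_def e using gc[of "\<lambda>x. 1"] by simp
    next
      case 3
      \<comment> \<open>A ramp in \<open>y\<close> that leaves 0 at \<open>y = cos b\<close> and
        saturates at 1. As \<open>cos\<close> decreases strictly on \<open>[0, \<pi>]\<close>, the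
        functions \<open>\<phi> m (cos x)\<close> tend to the indicator of \<open>x < b\<close>
        inside the interval.\<close>
      define \<phi> where "\<phi> m y = max 0 (min 1 (real m * (y - cos b)))" for m y
      have c\<phi>: "continuous_on UNIV (\<phi> m)" for m
        unfolding \<phi>_def by (intro continuous_intros)
      have m\<phi>: "\<phi> m \<in> borel_measurable borel" for m by (intro borel_measurable_continuous_onI c\<phi>)
      have "(\<lambda>m. LINT x|lborel. g x * (sin x * \<phi> m (cos x))) \<longlonglongrightarrow> (LINT x|lborel. indicator {..<b} x *\<^sub>R (g x * sin x))"
      proof (rule integral_dominated_convergence)
        show "(\<lambda>x. indicator {..<b} x *\<^sub>R (g x * sin x)) \<in> borel_measurable lborel" using g by simp
        show "(\<lambda>x. g x * (sin x * \<phi> m (cos x))) \<in> borel_measurable lborel" for m using g m\<phi>[of m] by simp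
        show "integrable lborel (\<lambda>x. \<bar>g x\<bar>)" using g by simp
        have "\<bar>g x * (sin x * \<phi> m (cos x))\<bar> \<le> \<bar>g x\<bar>" for m x
        proof -
          have "\<bar>sin x\<bar> * \<bar>\<phi> m (cos x)\<bar> \<le> 1 * 1"
            by (intro mult_mono) (auto simp: \<phi>_def)
          then have "\<bar>g x\<bar> * (\<bar>sin x\<bar> * \<bar>\<phi> m (cos x)\<bar>) \<le> \<bar>g x\<bar> * 1"
            by (intro mult_left_mono) auto
          then show ?thesis by (simp add: abs_mult)
        qed
        then show "AE x in lborel. norm (g x * (sin x * \<phi> m (cos x))) \<le> \<bar>g x\<bar>" for m by simp
        have "(\<lambda>m. g x * (sin x * \<phi> m (cos x))) \<longlonglongrightarrow> indicator {..<b} x *\<^sub>R (g x * sin x)" for x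
        proof (cases "x \<in> {0<..<pi}")
          case True
          have "(\<lambda>m. \<phi> m (cos x)) \<longlonglongrightarrow> indicator {..<b} x"
          proof (cases "x < b")
            case True
            then have p: "cos x - cos b > 0" using \<open>x \<in> _\<close> 3 by (simp add: cos_monotone_0_pi)
            have "eventually (\<lambda>m. \<phi> m (cos x) = 1) sequentially"
              using eventually_ge_at_top[of "nat \<lceil>1 / (cos x - cos b)\<rceil>"]
            proof eventually_elim
              case (elim m)
              then have "real m \<ge> 1 / (cos x - cos b)" by linarith
              then have "real m * (cos x - cos b) \<ge> 1" using p by (simp add: divide_simps)
              then show ?case by (simp add: \<phi>_def)
            qed
            then show ?thesis using True by (simp add: tendsto_eventually)
          next
            case False
            then have "cos x \<le> cos b" using \<open>x \<in> _\<close> 3 by (intro cos_monotone_0_pi_le) auto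
            then have nn: "real m * (cos x - cos b) \<le> 0" for m by (intro mult_nonneg_nonpos) auto
            have "\<phi> m (cos x) = 0" for m
              unfolding \<phi>_def using nn[of m] by linarith
            then show ?thesis using False by simp
          qed
          then have "(\<lambda>m. g x * (sin x * \<phi> m (cos x))) \<longlonglongrightarrow> g x * (sin x * indicator {..<b} x)"
            by (intro tendsto_intros)
          then show ?thesis by (simp add: algebra_simps)
        qed (simp add: g_def)
        then show "AE x in lborel. (\<lambda>m. g x * (sin x * \<phi> m (cos x))) \<longlonglongrightarrow> indicator {..<b} x *\<^sub>R (g x * sin x)" by simp
      qed
      then have "(\<lambda>m. 0::real) \<longlonglongrightarrow> (LINT x|lborel. indicator {..<b} x *\<^sub>R (g x * sin x))"
        by (simp only: gc[OF c\<phi>])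
      then show ?thesis by (simp add: set_lebesgue_integral_def LIMSEQ_const_iff)
    qed
  qed
  moreover have "integrable lborel (\<lambda>x. g x * sin x)" by (rule gb[where B = 1]) auto
  moreover have "(LINT x|lborel. g x * sin x) = 0" using gc[of "\<lambda>x. 1"] by simp
  ultimately have "AE x in lborel. g x * sin x = 0" by (intro integral_halflines_zero_imp_AE_zero)
  \<comment> \<open>The weight \<open>sin x\<close> is positive inside the interval and can be
    divided out.\<close>
  then show ?thesis
  proof eventually_elim
    case (elim x)
    then show ?case using sin_gt_zero[of x] by (auto simp: g_def)
  qed
qed

section \<open>Expansions with absolutely summable sine coefficients\<close>

lemma set_integral_FTC_open:
  fixes F f :: "real \<Rightarrow> real"
  assumes "a \<le> b" "\<And>x. x \<in> {a..b} \<Longrightarrow> (F has_real_derivative f x) (at x within {a..b})" "continuous_on {a..b} f"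
  shows "(LINT x:{a<..<b}|lborel. f x) = F b - F a"
proof -
  have "(LBINT x=a..b. f x) = F b - F a"
    using assms by (intro interval_integral_FTC_finite) (auto simp: has_real_derivative_iff_has_vector_derivative)
  then show ?thesis using assms(1) interval_integral_Ioo[of "ereal a" "ereal b" f] by simp
qed

lemma set_integral_sin_mult_sin:
  fixes m n :: nat
  assumes "m \<noteq> 0"
  shows "(LINT x:{0<..<pi}|lborel. sin (real n * x) * sin (real m * x)) = (if n = m then pi / 2 else 0)"
proof (cases "n = m")
  case True
  have "(LINT x:{0<..<pi}|lborel. sin (real m * x) * sin (real m * x)) = (pi / 2 - sin (real (2 * m) * pi) / (4 * m)) - (0 / 2 - sin (real (2 * m) * 0) / (4 * m))"
  proof (rule set_integral_FTC_open)
    have "sin (real m * x) * sin (real m * x) = 1 / 2 - cos (real (2 * m) * x) / 2" for x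
      using cos_double_sin[of "m * x"] by (simp add: algebra_simps power2_eq_square)
    then show "((\<lambda>x. x / 2 - sin (real (2 * m) * x) / (4 * m)) has_real_derivative sin (real m * x) * sin (real m * x)) (at x within {0..pi})" for x
      using assms by (auto intro!: derivative_eq_intros)
  qed (auto intro!: continuous_intros)
  then show ?thesis using True by (simp add: sin_npi del: of_nat_mult)
next
  case False
  have nz: "real n - real m \<noteq> 0" "real n + real m \<noteq> 0" using False assms by auto
  have d: "((\<lambda>x. sin (d * x) / (2 * d)) has_real_derivative cos (d * x) / 2) (at x within S)"
    if "d \<noteq> 0" for d x :: real and S
    using that by (auto intro!: derivative_eq_intros)
  let ?F = "\<lambda>x. sin ((real n - real m) * x) / (2 * (real n - real m)) - sin ((real n + real m) * x) / (2 * (real n + real m))"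
  have "(LINT x:{0<..<pi}|lborel. sin (real n * x) * sin (real m * x)) = ?F pi - ?F 0"
  proof (rule set_integral_FTC_open)
    have "sin (real n * x) * sin (real m * x) = cos ((real n - real m) * x) / 2 - cos ((real n + real m) * x) / 2" for x
      by (simp add: left_diff_distrib distrib_right cos_add cos_diff field_simps)
    then show "(?F has_real_derivative sin (real n * x) * sin (real m * x)) (at x within {0..pi})" for x
      by (simp only:) (intro DERIV_diff d nz)
  qed (auto intro!: continuous_intros)
  moreover have "sin ((real n + real m) * pi) = 0" "sin ((real n - real m) * pi) = 0"
    by (simp_all add: distrib_right left_diff_distrib sin_add sin_diff)
  ultimately show ?thesis using False by simp
qed

text \<open>Absolute summability permits integrating the sine series term by term, so orthogonality
  yields its coefficients. The difference of \<open>f\<close> and the series then has no sine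
  coefficients, and completeness applies.\<close>

lemma sine_series_AE:
  fixes f :: "real \<Rightarrow> real"
  assumes f: "set_integrable lborel {0<..<pi} f"
    and b: "summable (\<lambda>n. \<bar>b n\<bar>)"
    and c: "\<And>n::nat. (LINT x:{0<..<pi}|lborel. f x * sin (real n * x)) = b n"
  shows "AE x in lborel. x \<in> {0<..<pi} \<longrightarrow> f x = 2 / pi * (\<Sum>n. b n * sin (real n * x))"
proof -
  define S where "S x = (\<Sum>n. b n * sin (real n * x))" for x
  have sm: "summable (\<lambda>n. \<bar>b n * sin (real n * x)\<bar>)" for x
    by (rule summable_comparison_test'[OF b, of 0]) (auto simp: abs_mult mult_left_le)
  have ul: "uniform_limit UNIV (\<lambda>n x. \<Sum>k<n. b k * sin (real k * x)) S sequentially"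
    unfolding S_def by (rule Weierstrass_m_test[OF _ b]) (auto simp: abs_mult mult_left_le)
  have cS: "continuous_on UNIV S"
    by (rule uniform_limit_theorem[OF _ ul]) (auto intro!: always_eventually continuous_intros)
  have bS: "\<bar>S x\<bar> \<le> (\<Sum>n. \<bar>b n\<bar>)" for x
  proof -
    have "\<bar>S x\<bar> \<le> (\<Sum>n. \<bar>b n * sin (real n * x)\<bar>)" unfolding S_def by (rule summable_rabs[OF sm])
    also have "\<dots> \<le> (\<Sum>n. \<bar>b n\<bar>)" by (intro suminf_le sm b) (auto simp: abs_mult mult_left_le)
    finally show ?thesis .
  qed
  have mS: "S \<in> borel_measurable borel" by (intro borel_measurable_continuous_onI cS)
  have pi_int: "set_integrable lborel {0<..<pi} (\<lambda>x. g x)" if "continuous_on UNIV g" for g :: "real \<Rightarrow> real"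
    by (rule set_integrable_subset[OF borel_integrable_atLeastAtMost'[of 0 pi]]) (auto intro: continuous_on_subset[OF that])
  have cf: "(LINT x:{0<..<pi}|lborel. S x * sin (real m * x)) = pi / 2 * b m" for m :: nat
  proof (cases "m = 0")
    \<comment> \<open>At frequency 0 the hypothesis on the coefficients says
      \<open>b 0 = 0\<close>.\<close>
    case True
    then show ?thesis using c[of 0] by simp
  next
    case False
    let ?h = "\<lambda>n x. indicator {0<..<pi} x * (b n * sin (real n * x) * sin (real m * x))"
    have cc: "continuous_on UNIV (\<lambda>x. b n * sin (real n * x) * sin (real m * x))" for n
      by (intro continuous_intros)
    have ih: "integrable lborel (?h n)" for n
      using pi_int[OF cc[of n]] by (simp add: set_integrable_def)
    have le: "\<bar>b n * sin (real n * x) * sin (real m * x)\<bar> \<le> \<bar>b n\<bar>" for n x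
    proof -
      have "\<bar>sin (real n * x)\<bar> * \<bar>sin (real m * x)\<bar> \<le> 1 * 1" by (intro mult_mono) auto
      then have "\<bar>b n\<bar> * (\<bar>sin (real n * x)\<bar> * \<bar>sin (real m * x)\<bar>) \<le> \<bar>b n\<bar> * 1" by (intro mult_left_mono) auto
      then show ?thesis by (simp add: abs_mult mult.assoc)
    qed
    have "(\<lambda>n. LINT x|lborel. ?h n x) sums (LINT x|lborel. (\<Sum>n. ?h n x))"
    proof (rule sums_integral[OF ih])
      have "summable (\<lambda>n. norm (?h n x))" for x
        by (rule summable_comparison_test'[OF b, of 0]) (use le in \<open>auto simp: indicator_def\<close>)
      then show "AE x in lborel. summable (\<lambda>n. norm (?h n x))" by simp
      show "summable (\<lambda>n. LINT x|lborel. norm (?h n x))"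
      proof (rule summable_comparison_test'[OF summable_mult[OF b, of pi], of 0])
        fix n :: nat
        have "(LINT x|lborel. norm (?h n x)) \<le> (LINT x|lborel. indicator {0<..<pi} x * \<bar>b n\<bar>)"
        proof (rule integral_mono)
          show "integrable lborel (\<lambda>x. norm (?h n x))" using ih by (rule integrable_norm)
          show "integrable lborel (\<lambda>x. indicator {0<..<pi} x * \<bar>b n\<bar>)" by simp
          show "norm (?h n x) \<le> indicator {0<..<pi} x * \<bar>b n\<bar>" for x using le[of n x] by (simp add: indicator_def)
        qed
        then show "norm (LINT x|lborel. norm (?h n x)) \<le> pi * \<bar>b n\<bar>" by simp
      qed
    qed
    moreover have "(LINT x|lborel. ?h n x) = (if n = m then pi / 2 * b m else 0)" for n
    proof -
      have "(LINT x|lborel. ?h n x) = (LINT x|lborel. b n * (indicator {0<..<pi} x * (sin (real n * x) * sin (real m * x))))"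
        by (simp add: algebra_simps)
      also have "\<dots> = b n * (LINT x:{0<..<pi}|lborel. sin (real n * x) * sin (real m * x))"
        by (simp add: set_lebesgue_integral_def)
      finally show ?thesis using set_integral_sin_mult_sin[OF False, of n] by simp
    qed
    moreover have "(\<Sum>n. ?h n x) = indicator {0<..<pi} x *\<^sub>R (S x * sin (real m * x))" for x
      using sm[of x, THEN summable_rabs_cancel] unfolding S_def
      by (simp add: suminf_mult suminf_mult2 summable_mult2 mult.commute[of _ "sin (real m * x)"] mult.assoc indicator_def)
    ultimately have "(\<lambda>n. if n = m then pi / 2 * b m else 0) sums (LINT x:{0<..<pi}|lborel. S x * sin (real m * x))"
      by (simp add: set_lebesgue_integral_def)
    then show ?thesis using sums_single[of m "\<lambda>_. pi / 2 * b m"] sums_unique2 by blast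
  qed
  have fs: "set_integrable lborel {0<..<pi} (\<lambda>x. f x * sin (real n * x))" for n :: nat
    using integrable_mult_bounded[of lborel "\<lambda>x. indicator {0<..<pi} x * f x" "\<lambda>x. sin (real n * x)" 1] f
    by (simp add: set_integrable_def mult.assoc)
  have "AE x in lborel. x \<in> {0<..<pi} \<longrightarrow> f x - 2 / pi * S x = 0"
  proof (rule sine_coeffs_zero_imp_AE_zero)
    show "set_integrable lborel {0<..<pi} (\<lambda>x. f x - 2 / pi * S x)"
      by (intro set_integral_diff f set_integrable_mult_right pi_int cS)
    fix n :: nat
    have "(LINT x:{0<..<pi}|lborel. (f x - 2 / pi * S x) * sin (real n * x))
      = (LINT x:{0<..<pi}|lborel. f x * sin (real n * x) - 2 / pi * (S x * sin (real n * x)))"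
      by (simp add: algebra_simps)
    also have "\<dots> = b n - 2 / pi * (pi / 2 * b n)"
      by (subst set_integral_diff)
        (auto intro!: fs set_integrable_mult_right pi_int continuous_intros cS simp del: times_divide_eq_left simp: c cf)
    finally show "(LINT x:{0<..<pi}|lborel. (f x - 2 / pi * S x) * sin (real n * x)) = 0" by simp
  qed
  then show ?thesis by (simp add: S_def)
qed

text \<open>The part of \<open>S\<close> where \<open>f\<close> does not vanish is open, and a
  nonempty open set is not null. This upgrades almost everywhere identities to single
  points.\<close>

lemma continuous_AE_zero_imp_zero:
  fixes f :: "'a::euclidean_space \<Rightarrow> real"
  assumes "open S" "continuous_on S f" "AE x in lborel. x \<in> S \<longrightarrow> f x = 0" "x \<in> S"
  shows "f x = 0"
proof (rule ccontr)
  assume n: "f x \<noteq> 0"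
  have "open (S \<inter> f -` (- {0}))"
    using assms(1,2) by (intro continuous_open_preimage) auto
  moreover have "S \<inter> f -` (- {0}) \<noteq> {}" using n assms(4) by auto
  moreover have "S \<inter> f -` (- {0}) \<in> null_sets lborel"
  proof -
    have "AE x in lborel. x \<notin> S \<inter> f -` (- {0})" using assms(3) by eventually_elim auto
    then show ?thesis using \<open>open (S \<inter> _)\<close> by (subst AE_iff_null_sets) auto
  qed
  ultimately show False
    using open_not_negligible by (metis null_sets_completionI negligible_iff_null_sets)
qed

lemma continuous_sine_series:
  fixes f :: "real \<Rightarrow> real"
  assumes f: "continuous_on {0..pi} f"
    and b: "summable (\<lambda>n. \<bar>b n\<bar>)"
    and c: "\<And>n::nat. (LINT x:{0<..<pi}|lborel. f x * sin (real n * x)) = b n"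
    and x: "x \<in> {0<..<pi}"
  shows "f x = 2 / pi * (\<Sum>n. b n * sin (real n * x))"
proof -
  have ul: "uniform_limit UNIV (\<lambda>n x. \<Sum>k<n. b k * sin (real k * x)) (\<lambda>x. \<Sum>n. b n * sin (real n * x)) sequentially"
    by (rule Weierstrass_m_test[OF _ b]) (auto simp: abs_mult mult_left_le)
  have cS: "continuous_on UNIV (\<lambda>x. \<Sum>n. b n * sin (real n * x))"
    by (rule uniform_limit_theorem[OF _ ul]) (auto intro!: always_eventually continuous_intros)
  have "set_integrable lborel {0<..<pi} f"
    by (rule set_integrable_subset[OF borel_integrable_atLeastAtMost'[OF f]]) auto
  from sine_series_AE[OF this b c]
  have "AE x in lborel. x \<in> {0<..<pi} \<longrightarrow> f x - 2 / pi * (\<Sum>n. b n * sin (real n * x)) = 0" by simp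
  then have "f x - 2 / pi * (\<Sum>n. b n * sin (real n * x)) = 0"
    by (rule continuous_AE_zero_imp_zero[rotated 2])
      (use x in \<open>auto intro!: continuous_intros continuous_on_subset[OF f] continuous_on_subset[OF cS]\<close>)
  then show ?thesis by simp
qed

text \<open>
  \<open>A\<close> and \<open>B\<close> are the two branches of the Green function of \<open>- u'' + K u = \<delta>\<^sub>\<alpha>\<close> with
  Dirichlet conditions.
\<close>

lemma green_function_sine_series:
  fixes A A' B B' :: "real \<Rightarrow> real"
  assumes K: "K \<ge> 0" and \<alpha>: "0 < \<alpha>" "\<alpha> < pi"
    and A: "\<And>x. (A has_real_derivative A' x) (at x)" "\<And>x. (A' has_real_derivative K * A x) (at x)"
    and B: "\<And>x. (B has_real_derivative B' x) (at x)" "\<And>x. (B' has_real_derivative K * B x) (at x)"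
    and bc: "A 0 = 0" "B pi = 0" "A \<alpha> = B \<alpha>" "A' \<alpha> - B' \<alpha> = 1"
    and x: "x \<in> {\<alpha><..<pi}"
  shows "B x = 2 / pi * (\<Sum>n. sin (real n * \<alpha>) / ((real n)\<^sup>2 + K) * sin (real n * x))"
proof -
  define u where "u x = (if x \<le> \<alpha> then A x else B x)" for x
  have cA: "continuous_on S A" "continuous_on S B" for S
    using A(1) B(1) by (auto intro!: continuous_at_imp_continuous_on DERIV_isCont)
  have cu: "continuous_on {0..pi} u"
    unfolding u_def by (rule continuous_on_cases_le) (use bc in \<open>auto intro: cA continuous_on_id\<close>)
  have "u x = 2 / pi * (\<Sum>n. sin (real n * \<alpha>) / ((real n)\<^sup>2 + K) * sin (real n * x))"
  proof (rule continuous_sine_series[OF cu])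
    show "summable (\<lambda>n. \<bar>sin (real n * \<alpha>) / ((real n)\<^sup>2 + K)\<bar>)"
    proof (rule summable_comparison_test'[of "\<lambda>n. 1 / (real n)\<^sup>2" 1])
      show "summable (\<lambda>n. 1 / (real n)\<^sup>2)" using inverse_power_summable[of 2, where 'a = real] by (simp add: divide_inverse)
      show "norm \<bar>sin (real n * \<alpha>) / ((real n)\<^sup>2 + K)\<bar> \<le> 1 / (real n)\<^sup>2" if "n \<ge> 1" for n
      proof -
        have "\<bar>sin (real n * \<alpha>)\<bar> / ((real n)\<^sup>2 + K) \<le> 1 / (real n)\<^sup>2"
          using that K by (intro frac_le) auto
        then show ?thesis using K by (simp add: abs_divide)
      qed
    qed
    show "(LINT x:{0<..<pi}|lborel. u x * sin (real n * x)) = sin (real n * \<alpha>) / ((real n)\<^sup>2 + K)" for n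
    proof (cases "n = 0")
      case False
      let ?k = "(real n)\<^sup>2 + K"
      have k: "?k > 0" using False K by (simp add: add_pos_nonneg)
      \<comment> \<open>The Wronskian of a branch with \<open>sin (n * x)\<close>, divided by
        \<open>n\<^sup>2 + K\<close>; its derivative is the integrand because the second derivative
        of the branch is \<open>K\<close> times the branch. At the two ends it vanishes, and at
        \<alpha> only the unit jump of the derivative survives.\<close>
      let ?F = "\<lambda>A A' x. (A' x * sin (real n * x) - real n * A x * cos (real n * x)) / ?k"
      have F: "(?F A A' has_real_derivative A x * sin (real n * x)) (at x within S)"
        "(?F B B' has_real_derivative B x * sin (real n * x)) (at x within S)" for x S
      proof -
        have "((\<lambda>x. C' x * sin (real n * x) - real n * C x * cos (real n * x)) has_real_derivative ?k * (C x * sin (real n * x))) (at x)"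
          if "(C has_real_derivative C' x) (at x)" "(C' has_real_derivative K * C x) (at x)" for C C'
          by (auto intro!: derivative_eq_intros that simp: algebra_simps power2_eq_square)
        from this[OF A, THEN DERIV_cdivide, of ?k] this[OF B, THEN DERIV_cdivide, of ?k]
        show "(?F A A' has_real_derivative A x * sin (real n * x)) (at x within S)"
          "(?F B B' has_real_derivative B x * sin (real n * x)) (at x within S)"
          using k by (auto intro: has_field_derivative_at_within)
      qed
      have iu: "interval_lebesgue_integrable lborel (ereal 0) (ereal pi) (\<lambda>x. u x * sin (real n * x))"
        by (intro interval_integrable_continuous_on) (auto intro!: continuous_intros cu)
      have "(LINT x:{0<..<pi}|lborel. u x * sin (real n * x)) = (LBINT x=ereal 0..ereal pi. u x * sin (real n * x))"
        by (subst interval_integral_Ioo) simp_all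
      also have "\<dots> = (LBINT x=ereal 0..ereal \<alpha>. u x * sin (real n * x)) + (LBINT x=ereal \<alpha>..ereal pi. u x * sin (real n * x))"
        using \<alpha> iu by (intro interval_integral_sum[symmetric]) (simp add: min_def max_def)
      also have "(LBINT x=ereal 0..ereal \<alpha>. u x * sin (real n * x)) = (LBINT x=ereal 0..ereal \<alpha>. A x * sin (real n * x))"
        using \<alpha> by (intro interval_lebesgue_integral_cong) (auto simp: u_def)
      also have "\<dots> = ?F A A' \<alpha> - ?F A A' 0"
        by (rule interval_integral_FTC_finite) (auto intro!: continuous_intros cA F simp: has_real_derivative_iff_has_vector_derivative[symmetric])
      also have "(LBINT x=ereal \<alpha>..ereal pi. u x * sin (real n * x)) = (LBINT x=ereal \<alpha>..ereal pi. B x * sin (real n * x))"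
        using \<alpha> by (intro interval_lebesgue_integral_cong) (auto simp: u_def)
      also have "\<dots> = ?F B B' pi - ?F B B' \<alpha>"
        by (rule interval_integral_FTC_finite) (auto intro!: continuous_intros cA F simp: has_real_derivative_iff_has_vector_derivative[symmetric])
      finally have "(LINT x:{0<..<pi}|lborel. u x * sin (real n * x)) = ?F A A' \<alpha> - ?F B B' \<alpha>"
        using bc by simp
      also have "\<dots> = (A' \<alpha> - B' \<alpha>) * sin (real n * \<alpha>) / ?k"
        using bc(3) by (simp add: diff_divide_distrib[symmetric] left_diff_distrib)
      finally show ?thesis using bc by simp
    qed simp
  qed (use x \<alpha> in auto)
  then show ?thesis using x by (simp add: u_def)
qed

section \<open>The modes\<close>

text \<open>The solution of \<open>y'' = D * y\<close> with \<open>y 0 = 0\<close>,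
  \<open>y' 0 = 1\<close>. For the modes, \<open>D\<close> is a quarter of the discriminant of the
  characteristic equation. Its sign changes with \<open>n\<close>, and the case distinction keeps
  all regimes within the reals.\<close>

definition osc :: "real \<Rightarrow> real \<Rightarrow> real" where
  "osc D s = (if D > 0 then sinh (sqrt D * s) / sqrt D else if D = 0 then s
    else sin (sqrt (- D) * s) / sqrt (- D))"

definition osc' :: "real \<Rightarrow> real \<Rightarrow> real" where
  "osc' D s = (if D > 0 then cosh (sqrt D * s) else if D = 0 then 1 else cos (sqrt (- D) * s))"

lemma osc_deriv: "(osc D has_real_derivative osc' D s) (at s)"
  "(osc' D has_real_derivative D * osc D s) (at s)"
proof -
  have "(osc D has_real_derivative osc' D s) (at s) \<and> (osc' D has_real_derivative D * osc D s) (at s)"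
  proof (cases D "0 :: real" rule: linorder_cases)
    case less
    define r where "r = sqrt (- D)"
    have r: "r \<noteq> 0" "D = - (r * r)" using less by (auto simp: r_def)
    have "osc D = (\<lambda>s. sin (r * s) / r)" "osc' D = (\<lambda>s. cos (r * s))"
      using less by (auto simp: osc_def osc'_def r_def)
    then show ?thesis using r by (auto intro!: derivative_eq_intros)
  next
    case equal
    then have "osc D = (\<lambda>s. s)" "osc' D = (\<lambda>s. 1)" by (auto simp: osc_def osc'_def)
    then show ?thesis using equal by simp
  next
    case greater
    define r where "r = sqrt D"
    have r: "r \<noteq> 0" "D = r * r" using greater by (auto simp: r_def)
    have "osc D = (\<lambda>s. sinh (r * s) / r)" "osc' D = (\<lambda>s. cosh (r * s))"
      using greater by (auto simp: osc_def osc'_def r_def)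
    then show ?thesis using r by (auto intro!: derivative_eq_intros)
  qed
  then show "(osc D has_real_derivative osc' D s) (at s)"
    "(osc' D has_real_derivative D * osc D s) (at s)" by auto
qed

lemma osc_0: "osc D 0 = 0" "osc' D 0 = 1"
  by (auto simp: osc_def osc'_def)

text \<open>
  The modes are the solutions of \<open>h'' + n\<^sup>2 h' + c\<^sup>2 n\<^sup>2 h = 0\<close>, \<open>h 0 = 0\<close>, \<open>h' 0 = 1\<close>: for a weak
  solution, \<open>\<integral> \<xi> t x * sin (n * x) dx = sin (n * \<alpha>) * mode c n (T - t)\<close>.
\<close>

definition mode :: "real \<Rightarrow> nat \<Rightarrow> real \<Rightarrow> real" where
  "mode c n s = exp (- ((real n)\<^sup>2 / 2) * s) * osc ((real n)^4 / 4 - c\<^sup>2 * (real n)\<^sup>2) s"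

definition mode' :: "real \<Rightarrow> nat \<Rightarrow> real \<Rightarrow> real" where
  "mode' c n s = exp (- ((real n)\<^sup>2 / 2) * s) * (osc' ((real n)^4 / 4 - c\<^sup>2 * (real n)\<^sup>2) s
     - (real n)\<^sup>2 / 2 * osc ((real n)^4 / 4 - c\<^sup>2 * (real n)\<^sup>2) s)"

lemma mode_0 [simp]: "mode c n 0 = 0" "mode' c n 0 = 1"
  by (auto simp: mode_def mode'_def osc_0)

lemma mode_deriv:
  "(mode c n has_real_derivative mode' c n s) (at s)"
  "(mode' c n has_real_derivative - (real n)\<^sup>2 * mode' c n s - c\<^sup>2 * (real n)\<^sup>2 * mode c n s) (at s)"
proof -
  show "(mode c n has_real_derivative mode' c n s) (at s)"
    unfolding mode_def[abs_def] mode'_def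
    by (auto intro!: derivative_eq_intros DERIV_chain2[OF osc_deriv(1)] simp: algebra_simps)
  show "(mode' c n has_real_derivative - (real n)\<^sup>2 * mode' c n s - c\<^sup>2 * (real n)\<^sup>2 * mode c n s) (at s)"
    unfolding mode_def mode'_def[abs_def]
    by (rule derivative_eq_intros refl osc_deriv)+ (simp add: algebra_simps power2_eq_square power4_eq_xxxx)
qed

text \<open>Pairs of consecutive derivatives. The equation has constant coefficients, so every
  derivative of a mode solves it again, and the second component can be differentiated by the
  equation instead of a closed formula.\<close>

primrec mode_derivs :: "real \<Rightarrow> nat \<Rightarrow> nat \<Rightarrow> (real \<Rightarrow> real) \<times> (real \<Rightarrow> real)" where
  "mode_derivs c n 0 = (mode c n, mode' c n)"
| "mode_derivs c n (Suc i) = (snd (mode_derivs c n i),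
     (\<lambda>s. - (real n)\<^sup>2 * snd (mode_derivs c n i) s - c\<^sup>2 * (real n)\<^sup>2 * fst (mode_derivs c n i) s))"

lemma mode_derivs_deriv:
  "(fst (mode_derivs c n i) has_real_derivative fst (mode_derivs c n (Suc i)) s) (at s)"
proof -
  have "(fst (mode_derivs c n i) has_real_derivative snd (mode_derivs c n i) s) (at s) \<and>
    (snd (mode_derivs c n i) has_real_derivative
      - (real n)\<^sup>2 * snd (mode_derivs c n i) s - c\<^sup>2 * (real n)\<^sup>2 * fst (mode_derivs c n i) s) (at s)"
  proof (induction i arbitrary: s)
    case 0
    then show ?case using mode_deriv by simp
  next
    case (Suc i)
    then have d: "(fst (mode_derivs c n i) has_real_derivative snd (mode_derivs c n i) s) (at s)"
      "(snd (mode_derivs c n i) has_real_derivative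
        - (real n)\<^sup>2 * snd (mode_derivs c n i) s - c\<^sup>2 * (real n)\<^sup>2 * fst (mode_derivs c n i) s) (at s)" for s by auto
    show ?case using d by (auto intro!: DERIV_diff DERIV_cmult DERIV_minus)
  qed
  then show ?thesis by simp
qed

text \<open>
  The quantity \<open>h' + n\<^sup>2 h\<close> stays in \<open>[- 1, 1]\<close> because \<open>c\<^sup>2 n\<^sup>2 h\<^sup>2 + (h' + n\<^sup>2 h)\<^sup>2\<close> decreases.
  This gives a bound for \<open>h\<close> of order \<open>1 / n\<^sup>2\<close>, uniformly in all three regimes of the roots.
\<close>

lemma mode_bounds:
  assumes "n \<noteq> 0" "0 \<le> s"
  shows "\<bar>mode c n s\<bar> \<le> 1 / (real n)\<^sup>2" "\<bar>mode' c n s\<bar> \<le> 2"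
proof -
  let ?N = "(real n)\<^sup>2"
  define F where "F s = mode' c n s + ?N * mode c n s" for s
  have N: "?N > 0" using assms by simp
  have dF: "(F has_real_derivative - c\<^sup>2 * ?N * mode c n s) (at s)" for s
    unfolding F_def by (auto intro!: derivative_eq_intros mode_deriv)
  define E where "E s = c\<^sup>2 * ?N * (mode c n s)\<^sup>2 + (F s)\<^sup>2" for s
  have dE: "(E has_real_derivative - 2 * c\<^sup>2 * ?N * ?N * (mode c n s)\<^sup>2) (at s)" for s
    unfolding E_def
    by (auto intro!: derivative_eq_intros mode_deriv dF simp: F_def power2_eq_square algebra_simps)
  have F1: "\<bar>F s\<bar> \<le> 1" if "s \<ge> 0" for s
  proof -
    have "E s \<le> E 0"
      by (rule DERIV_nonpos_imp_nonincreasing[OF that]) (use dE in \<open>force simp: mult_nonneg_nonneg\<close>)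
    also have "E 0 = 1" by (simp add: E_def F_def)
    finally have "(F s)\<^sup>2 \<le> 1" using N unfolding E_def by (smt (verit) mult_nonneg_nonneg zero_le_power2)
    then show ?thesis by (simp add: abs_le_square_iff[of _ 1, simplified])
  qed
  \<comment> \<open>The bound on \<open>F\<close> is a first order differential inequality for
    \<open>h\<close> with integrating factor \<open>exp (n\<^sup>2 * s)\<close>. The constant
    \<open>1 / n\<^sup>2\<close> is the equilibrium of \<open>h' + n\<^sup>2 h = 1\<close>, and the
    two signs of \<open>a\<close> give both bounds.\<close>
  have *: "exp (?N * s) * (a * mode c n s - 1 / ?N) \<le> exp (?N * 0) * (a * mode c n 0 - 1 / ?N)" if "\<bar>a\<bar> = 1" for a
  proof (rule DERIV_nonpos_imp_nonincreasing[OF assms(2)])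
    fix x assume x: "0 \<le> x" "x \<le> s"
    have "((\<lambda>s. exp (?N * s) * (a * mode c n s - 1 / ?N)) has_real_derivative exp (?N * x) * (a * F x - 1)) (at x)"
      using N by (auto intro!: derivative_eq_intros mode_deriv simp: F_def algebra_simps)
    moreover have "a * F x \<le> \<bar>a\<bar> * \<bar>F x\<bar>" by (metis abs_ge_self abs_mult)
    then have "exp (?N * x) * (a * F x - 1) \<le> 0" using F1[OF x(1)] that by (simp add: mult_nonneg_nonpos)
    ultimately show "\<exists>y. ((\<lambda>s. exp (?N * s) * (a * mode c n s - 1 / ?N)) has_real_derivative y) (at x) \<and> y \<le> 0" by blast
  qed
  have "a * mode c n s - 1 / ?N \<le> 0" if "\<bar>a\<bar> = 1" for a
  proof -
    have "exp (?N * s) * (a * mode c n s - 1 / ?N) \<le> 0" using *[OF that] N by (simp add: order_trans)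
    then show ?thesis by (simp add: mult_le_0_iff)
  qed
  from this[of 1] this[of "-1"] show h: "\<bar>mode c n s\<bar> \<le> 1 / ?N" by simp
  have "?N * \<bar>mode c n s\<bar> \<le> 1" using h N by (simp add: field_simps)
  then have "\<bar>?N * mode c n s\<bar> \<le> 1" by (simp add: abs_mult)
  then show "\<bar>mode' c n s\<bar> \<le> 2" using F1[OF assms(2)] unfolding F_def by linarith
qed

text \<open>By linearity the difference from the explicit solution obeys the homogeneous system, and
  its energy \<open>c\<^sup>2 * dZ\<^sup>2 + dX\<^sup>2\<close> has the nonnegative derivative
  \<open>2 * n\<^sup>2 * dX\<^sup>2\<close>. Increasing towards \<open>T\<close>, where it is zero,
  it vanishes throughout.\<close>

lemma mode_unique:
  fixes X Z :: "real \<Rightarrow> real"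
  assumes n: "n \<noteq> 0" and c: "c > 0"
    and Z: "\<And>t. t \<in> {0..T} \<Longrightarrow> (Z has_real_derivative - real n * X t) (at t within {0..T})"
    and X: "\<And>t. t \<in> {0..T} \<Longrightarrow>
      (X has_real_derivative c\<^sup>2 * real n * Z t + (real n)\<^sup>2 * X t - \<sigma>) (at t within {0..T})"
    and T: "Z T = 0" "X T = 0"
    and t: "t \<in> {0..T}"
  shows "X t = \<sigma> * mode c n (T - t)"
proof -
  define dX where "dX t = X t - \<sigma> * mode c n (T - t)" for t
  \<comment> \<open>The \<open>Z\<close> component belonging to
    \<open>\<sigma> * mode c n (T - t)\<close> is obtained by solving the equation for the
    derivative of \<open>X\<close> for \<open>Z\<close>.\<close>
  define dZ where "dZ t = Z t - \<sigma> * (1 - mode' c n (T - t) - (real n)\<^sup>2 * mode c n (T - t)) / (c\<^sup>2 * real n)" for t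
  define E where "E t = c\<^sup>2 * (dZ t)\<^sup>2 + (dX t)\<^sup>2" for t
  have mm: "((\<lambda>t. mode c n (T - t)) has_real_derivative - mode' c n (T - t)) (at t within S)"
    "((\<lambda>t. mode' c n (T - t)) has_real_derivative - (- (real n)\<^sup>2 * mode' c n (T - t) - c\<^sup>2 * (real n)\<^sup>2 * mode c n (T - t))) (at t within S)"
    for t S
  proof -
    have "((\<lambda>t. T - t) has_real_derivative - 1) (at t within S)"
      by (auto intro!: derivative_eq_intros)
    from DERIV_chain2[OF mode_deriv(1) this] DERIV_chain2[OF mode_deriv(2) this]
    show "((\<lambda>t. mode c n (T - t)) has_real_derivative - mode' c n (T - t)) (at t within S)"
      "((\<lambda>t. mode' c n (T - t)) has_real_derivative - (- (real n)\<^sup>2 * mode' c n (T - t) - c\<^sup>2 * (real n)\<^sup>2 * mode c n (T - t))) (at t within S)"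
      by auto
  qed
  have dX: "(dX has_real_derivative c\<^sup>2 * real n * dZ t + (real n)\<^sup>2 * dX t) (at t within {0..T})" if "t \<in> {0..T}" for t
    unfolding dX_def dZ_def using n c
    by (auto intro!: derivative_eq_intros mm X[OF that] simp: field_simps)
  have dZ: "(dZ has_real_derivative - real n * dX t) (at t within {0..T})" if "t \<in> {0..T}" for t
    unfolding dX_def dZ_def using n c
    by (auto intro!: derivative_eq_intros mm Z[OF that] simp: field_simps power2_eq_square)
  have dE: "(E has_real_derivative 2 * (real n)\<^sup>2 * (dX t)\<^sup>2) (at t within {0..T})" if "t \<in> {0..T}" for t
    unfolding E_def
    by (auto intro!: derivative_eq_intros dX[OF that] dZ[OF that] simp: power2_eq_square algebra_simps)
  have "E t \<le> E T"
  proof (rule DERIV_nonneg_imp_increasing_open[where f = E])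
    show "\<exists>y. (E has_real_derivative y) (at x) \<and> y \<ge> 0" if "t < x" "x < T" for x
    proof -
      have "x \<in> interior {0..T}" using that t by simp
      then have "(E has_real_derivative 2 * (real n)\<^sup>2 * (dX x)\<^sup>2) (at x)"
        using dE[of x] that t by (simp only: at_within_interior) simp
      then show ?thesis by (intro exI conjI) auto
    qed
    have "continuous_on {0..T} E"
      unfolding continuous_on_eq_continuous_within using dE DERIV_continuous by blast
    then show "continuous_on {t..T} E" using t by (auto elim: continuous_on_subset)
  qed (use t in auto)
  also have "E T = 0" by (simp add: E_def dX_def dZ_def T)
  finally have "(dX t)\<^sup>2 \<le> 0" unfolding E_def by (smt (verit) mult_nonneg_nonneg zero_le_power2)
  then show ?thesis by (simp add: dX_def)
qed

section \<open>Fourier coefficients of weak solutions\<close>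

lemma L2_on_imp_set_integrable:
  assumes "L2_on A u" "A \<in> sets lborel" "emeasure lborel A < \<infinity>"
  shows "set_integrable lborel A u"
  unfolding set_integrable_def
proof (rule Bochner_Integration.integrable_bound)
  have "set_integrable lborel A (\<lambda>x. (u x)\<^sup>2)" using assms(1) by (simp add: L2_on_def)
  moreover have "set_integrable lborel A (\<lambda>x. 1 :: real)"
    using assms(2,3) by (simp add: set_integrable_def)
  ultimately have "set_integrable lborel A (\<lambda>x. 1 + (u x)\<^sup>2)" by (rule set_integral_add(1)[rotated])
  then show "integrable lborel (\<lambda>x. indicat_real A x *\<^sub>R (1 + (u x)\<^sup>2))" by (simp add: set_integrable_def)
  show "(\<lambda>x. indicat_real A x *\<^sub>R u x) \<in> borel_measurable lborel"
    using assms(1) by (simp add: L2_on_def set_borel_measurable_def)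
  have "\<bar>y\<bar> \<le> 1 + y\<^sup>2" for y :: real
  proof -
    have "0 \<le> (\<bar>y\<bar> - 1/2)\<^sup>2" by simp
    then have "\<bar>y\<bar> \<le> y\<^sup>2 + (1/2)\<^sup>2" by (simp add: power2_diff)
    also have "(1/2)\<^sup>2 \<le> (1 :: real)" by (simp add: power2_eq_square)
    finally show ?thesis by simp
  qed
  then show "AE x in lborel. norm (indicat_real A x *\<^sub>R u x) \<le> norm (indicat_real A x *\<^sub>R (1 + (u x)\<^sup>2))"
    by (auto simp: indicator_def abs_le_iff)
qed

lemma set_integrable_mult_bounded:
  fixes g b :: "'a \<Rightarrow> real"
  assumes "set_integrable M A g" "b \<in> borel_measurable M" "\<And>x. \<bar>b x\<bar> \<le> B"
  shows "set_integrable M A (\<lambda>x. g x * b x)"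
  using integrable_mult_bounded[of M "\<lambda>x. indicator A x * g x" b B] assms
  by (simp add: set_integrable_def mult.assoc)

lemma set_integrable_integral_fst:
  fixes f :: "real \<times> real \<Rightarrow> real"
  assumes f: "set_integrable lborel (A \<times> B) f"
  shows "set_integrable lborel A (\<lambda>t. LINT x:B|lborel. f (t, x))"
proof -
  have "integrable (lborel \<Otimes>\<^sub>M lborel) (\<lambda>p. indicator (A \<times> B) p *\<^sub>R f p)"
    using f by (simp add: set_integrable_def lborel_prod)
  from lborel_pair.integrable_fst'[OF this]
  show ?thesis by (simp add: set_integrable_def set_lebesgue_integral_def indicator_times mult.assoc)
qed

text \<open>As \<open>u x = \<integral>\<^sub>0\<^sup>x w\<close> need not be differentiable everywhere, this goes through Fubini.\<close>

lemma H10_integral_by_parts: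
  assumes H: "H10_with_deriv u w"
    and \<phi>: "\<And>x. (\<phi> has_real_derivative \<phi>' x) (at x)" and c: "continuous_on UNIV \<phi>'"
    and B: "\<And>x. \<bar>\<phi> x\<bar> \<le> B" "\<And>x. \<bar>\<phi>' x\<bar> \<le> B"
  shows "(LINT x:{0<..<pi}|lborel. w x * \<phi> x) = - (LINT x:{0<..<pi}|lborel. u x * \<phi>' x)"
proof -
  let ?I = "{0<..<pi}"
  have w: "set_integrable lborel ?I w"
    using H by (intro L2_on_imp_set_integrable) (auto simp: H10_with_deriv_def)
  define W where "W y = indicator ?I y * w y" for y
  have W: "integrable lborel W" using w by (simp add: set_integrable_def W_def[abs_def])
  define Q where "Q x = indicator ?I x * \<phi>' x" for x
  have c\<phi>: "continuous_on UNIV \<phi>" using \<phi> by (auto intro!: continuous_at_imp_continuous_on DERIV_isCont)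
  have m: "\<phi> \<in> borel_measurable borel" "\<phi>' \<in> borel_measurable borel"
    by (intro borel_measurable_continuous_onI c\<phi> c)+
  have mQ: "Q \<in> borel_measurable borel" using m unfolding Q_def by measurable
  have mW: "W \<in> borel_measurable borel" using W by auto
  have iQ: "integrable lborel Q"
    using set_integrable_mult_bounded[of lborel ?I "\<lambda>x. 1" \<phi>' B] m B
    by (simp add: set_integrable_def Q_def[abs_def])
  \<comment> \<open>The triangle \<open>y < x\<close> encodes \<open>u x\<close> as an integral over
    \<open>y\<close>. Integrability of this kernel on the plane permits integrating in
    \<open>x\<close> first, which turns \<open>\<phi>'\<close> into
    \<open>\<phi> pi - \<phi> y\<close>.\<close>
  have iQW: "integrable (lborel \<Otimes>\<^sub>M lborel) (\<lambda>(x, y). Q x * (indicator {y<..} x * W y))"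
  proof (rule lborel_pair.Fubini_integrable)
    show ms: "(\<lambda>(x, y). Q x * (indicator {y<..} x * W y)) \<in> borel_measurable (lborel \<Otimes>\<^sub>M lborel)"
    proof -
      have "(\<lambda>p. Q (fst p) * ((if snd p < fst p then 1 else 0) * W (snd p))) \<in> borel_measurable (lborel \<Otimes>\<^sub>M lborel)"
        using mQ mW by measurable
      then show ?thesis by (simp add: case_prod_unfold indicator_def of_bool_def)
    qed
    have int: "integrable lborel (\<lambda>y. Q x * (indicator {y<..} x * W y))" for x
    proof -
      have "integrable lborel (\<lambda>y. W y * (if y < x then 1 else 0))"
        by (rule integrable_mult_bounded[OF W, where B = 1]) auto
      then show ?thesis by (intro integrable_mult_right) (simp add: indicator_def of_bool_def mult.commute)
    qed
    then show "AE x in lborel. integrable lborel (\<lambda>y. case (x, y) of (x, y) \<Rightarrow> Q x * (indicator {y<..} x * W y))" by simp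
    show "integrable lborel (\<lambda>x. LINT y|lborel. norm (case (x, y) of (x, y) \<Rightarrow> Q x * (indicator {y<..} x * W y)))"
    proof (rule Bochner_Integration.integrable_bound)
      show "integrable lborel (\<lambda>x. \<bar>Q x\<bar> * (LINT y|lborel. \<bar>W y\<bar>))" using iQ by simp
      show "(\<lambda>x. LINT y|lborel. norm (case (x, y) of (x, y) \<Rightarrow> Q x * (indicator {y<..} x * W y))) \<in> borel_measurable lborel"
        by (rule lborel.borel_measurable_lebesgue_integral) (use ms in \<open>simp add: case_prod_unfold\<close>)
      have "\<bar>LINT y|lborel. norm (Q x * (indicator {y<..} x * W y))\<bar> \<le> \<bar>Q x\<bar> * (LINT y|lborel. \<bar>W y\<bar>)" for x
      proof -
        have "(LINT y|lborel. norm (Q x * (indicator {y<..} x * W y))) \<le> (LINT y|lborel. \<bar>Q x\<bar> * \<bar>W y\<bar>)"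
          by (rule integral_mono) (use int[of x] W in \<open>auto simp: abs_mult indicator_def simp del: real_norm_def intro!: integrable_norm, auto simp: abs_mult indicator_def\<close>)
        then show ?thesis by simp
      qed
      then show "AE x in lborel. norm (LINT y|lborel. norm (case (x, y) of (x, y) \<Rightarrow> Q x * (indicator {y<..} x * W y)))
          \<le> norm (\<bar>Q x\<bar> * (LINT y|lborel. \<bar>W y\<bar>))" by (simp add: abs_mult)
    qed
  qed
  have ux: "u x = (LINT y|lborel. indicator {y<..} x * W y)" if "x \<in> {0<..pi}" for x
  proof -
    have "u x = (LINT y:{0..x}|lborel. w y)" using H that by (simp add: H10_with_deriv_def)
    also have "\<dots> = (LINT y:{0<..<x}|lborel. w y)"
      by (rule set_integral_discrete_difference[where X = "{0, x}"]) auto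
    also have "\<dots> = (LINT y|lborel. indicator {y<..} x * W y)"
      unfolding set_lebesgue_integral_def
      by (intro Bochner_Integration.integral_cong) (use that in \<open>auto simp: W_def indicator_def\<close>)
    finally show ?thesis .
  qed
  have "(LINT x:?I|lborel. u x * \<phi>' x) = (LINT x|lborel. Q x * u x)"
    unfolding set_lebesgue_integral_def Q_def by (simp add: algebra_simps)
  also have "\<dots> = (LINT x|lborel. (LINT y|lborel. Q x * (indicator {y<..} x * W y)))"
  proof (rule Bochner_Integration.integral_cong)
    fix x show "Q x * u x = (LINT y|lborel. Q x * (indicator {y<..} x * W y))"
      using ux[of x] by (cases "x \<in> ?I") (auto simp: Q_def)
  qed simp
  also have "\<dots> = (LINT y|lborel. (LINT x|lborel. Q x * (indicator {y<..} x * W y)))"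
    using lborel_pair.Fubini_integral[OF iQW] by simp
  also have "\<dots> = (LINT y|lborel. W y * (\<phi> pi - \<phi> y))"
  proof (rule Bochner_Integration.integral_cong)
    fix y show "(LINT x|lborel. Q x * (indicator {y<..} x * W y)) = W y * (\<phi> pi - \<phi> y)"
    proof (cases "y \<in> ?I")
      case True
      have "(LINT x|lborel. Q x * (indicator {y<..} x * W y)) = (LINT x|lborel. W y * (indicator {y<..<pi} x *\<^sub>R \<phi>' x))"
        by (intro Bochner_Integration.integral_cong) (use True in \<open>auto simp: Q_def indicator_def\<close>)
      also have "\<dots> = W y * (LINT x:{y<..<pi}|lborel. \<phi>' x)"
        by (simp add: set_lebesgue_integral_def)
      also have "(LINT x:{y<..<pi}|lborel. \<phi>' x) = \<phi> pi - \<phi> y"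
        by (rule set_integral_FTC_open)
          (use True in \<open>auto intro!: has_field_derivative_at_within[OF \<phi>] continuous_on_subset[OF c]\<close>)
      finally show ?thesis .
    qed (simp add: W_def)
  qed simp
  also have "\<dots> = (LINT y|lborel. \<phi> pi * W y - W y * \<phi> y)"
    by (simp add: algebra_simps)
  also have "\<dots> = \<phi> pi * (LINT y|lborel. W y) - (LINT y|lborel. W y * \<phi> y)"
    using W integrable_mult_bounded[OF W _ B(1)] m by simp
  \<comment> \<open>This is \<open>u pi = 0\<close>. It removes the boundary term with
    \<open>\<phi> pi\<close>, so the test function may be nonzero at the end points, as
    \<open>cos (n * x)\<close> is.\<close>
  also have "(LINT y|lborel. W y) = 0"
  proof -
    have "(LINT y|lborel. W y) = (LINT y|lborel. indicator {y<..} pi * W y)"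
      by (intro Bochner_Integration.integral_cong) (auto simp: W_def indicator_def)
    also have "\<dots> = u pi" by (subst ux) auto
    finally show ?thesis using H by (simp add: H10_with_deriv_def)
  qed
  also have "(LINT y|lborel. W y * \<phi> y) = (LINT x:?I|lborel. w x * \<phi> x)"
    by (simp add: set_lebesgue_integral_def W_def mult.assoc)
  finally show ?thesis by simp
qed

lemma AE_lborel_negligible:
  fixes P :: "'a::euclidean_space \<Rightarrow> bool"
  assumes "AE x in lborel. P x"
  shows "negligible {x. \<not> P x}"
proof -
  obtain N where N: "\<And>x. x \<in> space lborel - N \<Longrightarrow> P x" "N \<in> null_sets lborel"
    using AE_E3[OF assms] by blast
  have "negligible N" using N(2) by (simp add: negligible_iff_null_sets null_sets_completionI)
  then show ?thesis by (rule negligible_subset) (use N(1) in auto)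
qed

lemma set_integral_AE_zero:
  fixes f :: "'a \<Rightarrow> real"
  assumes "AE x in M. x \<in> A \<longrightarrow> f x = 0"
  shows "(LINT x:A|M. f x) = 0"
  unfolding set_lebesgue_integral_def
  by (rule integral_eq_zero_AE) (use assms in eventually_elim, auto simp: indicator_def)

lemma set_integrable_Ioo_imp_tail:
  fixes f :: "real \<Rightarrow> real"
  assumes "set_integrable lborel {0<..<T} f" "t \<in> {0..T}"
  shows "set_integrable lborel {t..T} f"
proof -
  have "set_integrable lborel {0..T} f"
    using assms(1) by (subst set_integrable_discrete_difference[where X = "{0, T}" and B = "{0<..<T}"]) auto
  then show ?thesis by (rule set_integrable_subset) (use assms(2) in auto)
qed

text \<open>The cosine moment of \<zeta> and the sine moment of \<xi> form a closed system because
  integration by parts turns the cosine moment of \<open>w\<close> into \<open>n\<close> times the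
  sine moment of \<xi>. Regularity in time is bootstrapped: the integral equations make both moments
  continuous, continuity makes them differentiable, and \<open>mode_unique\<close> identifies the
  result.\<close>

lemma weak_adjoint_solution_coeff:
  assumes c: "c > 0" and T: "T > 0" and sol: "weak_adjoint_solution c T \<alpha> \<zeta> \<xi>" and t: "t \<in> {0..T}"
  shows "(LINT x:{0<..<pi}|lborel. \<xi> t x * sin (real n * x)) = sin (real n * \<alpha>) * mode c n (T - t)"
proof (cases "n = 0")
  case n: False
  let ?I = "{0<..<pi}" and ?P = "{0<..<T} \<times> {0<..<pi}"
  let ?c = "\<lambda>x. cos (real n * x)" and ?s = "\<lambda>x. sin (real n * x)"
  obtain w where w: "L2_on ?P (\<lambda>(t, x). w t x)"
    and H: "AE t in lborel. t \<in> {0<..<T} \<longrightarrow> H10_with_deriv (\<xi> t) (w t)"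
    and e1: "\<forall>\<phi>. smooth_on UNIV \<phi> \<longrightarrow> (\<forall>t\<in>{0..T}.
        (LINT x:?I|lborel. \<zeta> t x * \<phi> x) - (LINT x:?I|lborel. \<zeta> T x * \<phi> x) =
        (LINT s:{t..T}|lborel. LINT x:?I|lborel. w s x * \<phi> x))"
    and e2: "\<forall>\<psi>. smooth_on UNIV \<psi> \<and> \<psi> 0 = 0 \<and> \<psi> pi = 0 \<longrightarrow> (\<forall>t\<in>{0..T}.
        (LINT x:?I|lborel. \<xi> t x * \<psi> x) - (LINT x:?I|lborel. \<xi> T x * \<psi> x) =
        (LINT s:{t..T}|lborel. - (LINT x:?I|lborel. (c\<^sup>2 * \<zeta> s x + w s x) * deriv \<psi> x) + \<psi> \<alpha>))"
    by (rule sol[unfolded weak_adjoint_solution_def, THEN conjunct2, THEN conjunct2, THEN conjunct2,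
        THEN conjunct2, THEN conjunct2, THEN exE]) (elim conjE, rule that)
  have T0: "AE x in lborel. x \<in> ?I \<longrightarrow> \<zeta> T x = 0 \<and> \<xi> T x = 0"
    and L2\<zeta>: "\<And>s. s \<in> {0..T} \<Longrightarrow> L2_on ?I (\<zeta> s)" and \<zeta>P: "L2_on ?P (\<lambda>(t, x). \<zeta> t x)"
    using sol by (simp_all add: weak_adjoint_solution_def C_L2_def)
  have P: "?P \<in> sets lborel" "emeasure lborel ?P < \<infinity>"
  proof -
    show "?P \<in> sets lborel" by (simp add: borel_open open_Times)
    have "bounded ?P" by (intro bounded_Times) auto
    then show "emeasure lborel ?P < \<infinity>" by (rule emeasure_bounded_finite)
  qed
  define Z where "Z t = (LINT x:?I|lborel. \<zeta> t x * ?c x)" for t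
  define X where "X t = (LINT x:?I|lborel. \<xi> t x * ?s x)" for t
  define W where "W t = (LINT x:?I|lborel. w t x * ?c x)" for t
  define G where "G t = (LINT x:?I|lborel. (c\<^sup>2 * \<zeta> t x + w t x) * (real n * ?c x))" for t
  have ZT: "(LINT x:?I|lborel. \<zeta> T x * ?c x) = 0" and XT: "(LINT x:?I|lborel. \<xi> T x * ?s x) = 0"
    by (rule set_integral_AE_zero, use T0 in eventually_elim, simp)+
  have dsin: "deriv ?s x = real n * ?c x" for x
    by (rule DERIV_imp_deriv) (auto intro!: derivative_eq_intros)
  have Zeq: "Z t = (LINT s:{t..T}|lborel. W s)" if "t \<in> {0..T}" for t
    using e1[rule_format, OF smooth_on_cos that, of "real n"] ZT by (simp add: Z_def W_def)
  have Xeq: "X t = (LINT s:{t..T}|lborel. - G s + sin (real n * \<alpha>))" if "t \<in> {0..T}" for t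
    using e2[rule_format, OF conjI[OF smooth_on_sin] that, of "real n"] XT by (simp add: X_def G_def dsin)
  have wP: "set_integrable lborel ?P (\<lambda>(t, x). w t x)"
    and \<zeta>P: "set_integrable lborel ?P (\<lambda>(t, x). \<zeta> t x)"
    using w \<zeta>P P by (auto intro: L2_on_imp_set_integrable)
  have iW: "set_integrable lborel {0<..<T} W"
  proof -
    have "set_integrable lborel ?P (\<lambda>p. (case p of (t, x) \<Rightarrow> w t x) * ?c (snd p))"
      by (rule set_integrable_mult_bounded[OF wP, where B = 1]) (auto simp: borel_prod[symmetric])
    from set_integrable_integral_fst[OF this] show ?thesis by (simp add: W_def[abs_def])
  qed
  have iG: "set_integrable lborel {0<..<T} G"
  proof -
    have "set_integrable lborel ?P (\<lambda>p. c\<^sup>2 * (case p of (t, x) \<Rightarrow> \<zeta> t x) + (case p of (t, x) \<Rightarrow> w t x))"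
      by (intro set_integral_add(1) set_integrable_mult_right \<zeta>P wP)
    then have "set_integrable lborel ?P (\<lambda>p. (c\<^sup>2 * (case p of (t, x) \<Rightarrow> \<zeta> t x) + (case p of (t, x) \<Rightarrow> w t x)) * (real n * ?c (snd p)))"
      by (rule set_integrable_mult_bounded[where B = "real n"]) (auto simp: borel_prod[symmetric] abs_mult mult_left_le)
    from set_integrable_integral_fst[OF this] show ?thesis by (simp add: G_def[abs_def])
  qed
  have "AE s in lborel. s \<in> {0<..<T} \<longrightarrow> W s = real n * X s \<and> G s = c\<^sup>2 * real n * Z s + (real n)\<^sup>2 * X s"
    using H
  proof eventually_elim
    case (elim s)
    show ?case
    proof
      assume s: "s \<in> {0<..<T}"
      with elim have H: "H10_with_deriv (\<xi> s) (w s)" by simp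
      have bn: "\<bar>?c x\<bar> \<le> 1 + real n" "\<bar>- (real n) * ?s x\<bar> \<le> 1 + real n" for x
      proof -
        have "\<bar>real n * ?s x\<bar> \<le> real n" by (simp add: abs_mult mult_left_le)
        then show "\<bar>- (real n) * ?s x\<bar> \<le> 1 + real n" by simp
        show "\<bar>?c x\<bar> \<le> 1 + real n" by (rule order_trans[OF abs_cos_le_one]) simp
      qed
      have "W s = - (LINT x:?I|lborel. \<xi> s x * (- (real n) * ?s x))"
        unfolding W_def
        by (rule H10_integral_by_parts[OF H _ _ bn]) (auto intro!: derivative_eq_intros continuous_intros)
      also have "\<dots> = real n * X s"
        unfolding X_def by (subst set_integral_mult_right[symmetric]) (simp add: set_lebesgue_integral_def algebra_simps)
      finally have W: "W s = real n * X s" .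
      have "set_integrable lborel ?I (\<zeta> s)" using L2\<zeta>[of s] s by (intro L2_on_imp_set_integrable) auto
      then have i1: "set_integrable lborel ?I (\<lambda>x. \<zeta> s x * ?c x)"
        by (rule set_integrable_mult_bounded[where B = 1]) auto
      have "set_integrable lborel ?I (w s)" using H by (intro L2_on_imp_set_integrable) (auto simp: H10_with_deriv_def)
      then have i2: "set_integrable lborel ?I (\<lambda>x. w s x * ?c x)"
        by (rule set_integrable_mult_bounded[where B = 1]) auto
      have "G s = (LINT x:?I|lborel. (c\<^sup>2 * real n) * (\<zeta> s x * ?c x) + real n * (w s x * ?c x))"
        unfolding G_def by (simp add: algebra_simps)
      also have "\<dots> = (c\<^sup>2 * real n) * Z s + real n * W s"
        unfolding Z_def W_def
        by (subst set_integral_add(2)) (intro set_integrable_mult_right i1 i2 | simp)+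
      finally show "W s = real n * X s \<and> G s = c\<^sup>2 * real n * Z s + (real n)\<^sup>2 * X s"
        using W by (simp add: power2_eq_square)
    qed
  qed
  then have N: "negligible {s. \<not> (s \<in> {0<..<T} \<longrightarrow> W s = real n * X s \<and> G s = c\<^sup>2 * real n * Z s + (real n)\<^sup>2 * X s)}" (is "negligible ?N0")
    by (rule AE_lborel_negligible)
  \<comment> \<open>The end points join the exceptional set because the relations are known only
    inside the interval; a negligible set does not change the integrals over
    \<open>[t, T]\<close>.\<close>
  define N where "N = ?N0 \<union> {0, T}"
  have N: "negligible N" "\<And>s. s \<in> {0..T} - N \<Longrightarrow> W s = real n * X s \<and> G s = c\<^sup>2 * real n * Z s + (real n)\<^sup>2 * X s"
    using N by (auto simp: N_def intro: negligible_Un)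
  have iGs: "set_integrable lborel {0<..<T} (\<lambda>s. - G s + sin (real n * \<alpha>))"
  proof -
    have "set_integrable lborel {0<..<T} (\<lambda>s. sin (real n * \<alpha>))"
      by (rule set_integrable_subset[OF borel_integrable_atLeastAtMost'[of 0 T]]) auto
    from set_integral_add(1)[OF set_integrable_mult_right[OF iG, of "-1"] this] show ?thesis by simp
  qed
  have Zi: "Z t = integral {t..T} W" and Xi: "X t = integral {t..T} (\<lambda>s. - G s + sin (real n * \<alpha>))"
    if "t \<in> {0..T}" for t
    using Zeq[OF that] Xeq[OF that] set_borel_integral_eq_integral(2)[OF set_integrable_Ioo_imp_tail[OF iW that]]
      set_borel_integral_eq_integral(2)[OF set_integrable_Ioo_imp_tail[OF iGs that]] by auto
  have cZ: "continuous_on {0..T} Z"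
  proof -
    have "continuous_on {0..T} (\<lambda>t. integral {t..T} W)"
      using T by (intro indefinite_integral_continuous_1' set_borel_integral_eq_integral(1) set_integrable_Ioo_imp_tail[OF iW]) auto
    then show ?thesis by (rule continuous_on_eq) (simp add: Zi)
  qed
  have cX: "continuous_on {0..T} X"
  proof -
    have "continuous_on {0..T} (\<lambda>t. integral {t..T} (\<lambda>s. - G s + sin (real n * \<alpha>)))"
      using T by (intro indefinite_integral_continuous_1' set_borel_integral_eq_integral(1) set_integrable_Ioo_imp_tail[OF iGs]) auto
    then show ?thesis by (rule continuous_on_eq) (simp add: Xi)
  qed
  have Zi': "Z t = integral {t..T} (\<lambda>s. real n * X s)" if "t \<in> {0..T}" for t
    unfolding Zi[OF that] by (rule integral_spike[OF N(1)]) (use N(2) that in auto)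
  have Xi': "X t = integral {t..T} (\<lambda>s. - (c\<^sup>2 * real n * Z s + (real n)\<^sup>2 * X s) + sin (real n * \<alpha>))" if "t \<in> {0..T}" for t
    unfolding Xi[OF that] by (rule integral_spike[OF N(1)]) (use N(2) that in auto)
  have "X t = sin (real n * \<alpha>) * mode c n (T - t)"
  proof (rule mode_unique[OF n c _ _ _ _ t])
    show "(Z has_real_derivative - real n * X t) (at t within {0..T})" if "t \<in> {0..T}" for t
    proof -
      have "((\<lambda>t. integral {t..T} (\<lambda>s. real n * X s)) has_vector_derivative - (real n * X t)) (at t within {0..T})"
        by (intro integral_has_vector_derivative' that continuous_intros cX)
      from has_vector_derivative_transform[OF that Zi' this]
      show ?thesis by (simp add: has_real_derivative_iff_has_vector_derivative)
    qed
    show "(X has_real_derivative c\<^sup>2 * real n * Z t + (real n)\<^sup>2 * X t - sin (real n * \<alpha>)) (at t within {0..T})" if "t \<in> {0..T}" for t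
    proof -
      have "((\<lambda>t. integral {t..T} (\<lambda>s. - (c\<^sup>2 * real n * Z s + (real n)\<^sup>2 * X s) + sin (real n * \<alpha>))) has_vector_derivative
          - (- (c\<^sup>2 * real n * Z t + (real n)\<^sup>2 * X t) + sin (real n * \<alpha>))) (at t within {0..T})"
        by (intro integral_has_vector_derivative' that continuous_intros cX cZ)
      from has_vector_derivative_transform[OF that Xi' this]
      show ?thesis by (simp add: has_real_derivative_iff_has_vector_derivative algebra_simps)
    qed
    show "Z T = 0" "X T = 0" using Zi[of T] Xi[of T] T by auto
  qed
  then show ?thesis by (simp add: X_def)
qed simp

section \<open>Smoothness beyond the point source\<close>

lemma has_real_derivative_quadratic_remainder:
  fixes a :: "real \<Rightarrow> real"
  assumes "\<And>h. \<bar>h\<bar> \<le> 1 \<Longrightarrow> \<bar>a (s + h) - a s - h * a'\<bar> \<le> C * h\<^sup>2"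
  shows "(a has_real_derivative a') (at s)"
  unfolding DERIV_def
proof (rule Lim_transform_bound[where g = "\<lambda>h. C * \<bar>h\<bar>", THEN LIM_zero_cancel])
  show "((\<lambda>h. C * \<bar>h\<bar>) \<longlongrightarrow> 0) (at 0)"
    by (rule tendsto_eq_intros refl)+ simp
  have "\<forall>\<^sub>F h in at 0. \<bar>h :: real\<bar> < 1 \<and> h \<noteq> 0"
    unfolding eventually_at by (rule exI[of _ 1]) (auto simp: dist_real_def)
  then show "\<forall>\<^sub>F h in at 0. norm ((a (s + h) - a s) / h - a') \<le> norm (C * \<bar>h\<bar>)"
  proof eventually_elim
    case (elim h)
    have "(a (s + h) - a s) / h - a' = (a (s + h) - a s - h * a') / h"
      using elim by (simp add: diff_divide_distrib)
    then have "\<bar>(a (s + h) - a s) / h - a'\<bar> = \<bar>a (s + h) - a s - h * a'\<bar> / \<bar>h\<bar>"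
      by (simp only: abs_divide)
    also have "\<dots> \<le> C * h\<^sup>2 / \<bar>h\<bar>"
      using assms[of h] elim by (intro divide_right_mono) auto
    also have "\<dots> = C * \<bar>h\<bar>" using elim by (simp add: power2_eq_square abs_if)
    also have "\<dots> \<le> norm (C * \<bar>h\<bar>)" by simp
    finally show ?case by simp
  qed
qed

text \<open>
  The Taylor coefficients in \<open>z\<close> of \<open>q z * exp (l z * s)\<close> are smooth in \<open>s\<close>: differentiation in \<open>s\<close>
  multiplies by \<open>l z\<close>, and the Cauchy inequality transfers estimates on the circle of radius \<open>r\<close>
  to the coefficients.
\<close>

lemma exp_holomorphic_expansion:
  fixes q l :: "complex \<Rightarrow> complex"
  assumes q: "q holomorphic_on ball 0 R" and l: "l holomorphic_on ball 0 R" and r: "0 < r" "r < R"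
  obtains A :: "nat \<Rightarrow> nat \<Rightarrow> real \<Rightarrow> real" where
    "\<And>k i s. (A k i has_real_derivative A k (Suc i) s) (at s)"
    "\<And>i S. \<exists>B. \<forall>k s. \<bar>s\<bar> \<le> S \<longrightarrow> \<bar>A k i s\<bar> \<le> B / r ^ k"
    "\<And>s y. \<bar>y\<bar> < R \<Longrightarrow> (\<lambda>k. A k 0 s * y ^ k) sums Re (q (of_real y) * exp (l (of_real y) * of_real s))"
proof -
  define F where "F i s z = q z * l z ^ i * exp (l z * of_real s)" for i :: nat and s :: real and z
  define A where "A k i s = Re ((deriv ^^ k) (F i s) 0 / fact k)" for k i s
  have hF: "F i s holomorphic_on ball 0 R" for i s
    unfolding F_def by (intro holomorphic_intros q l)
  have sub: "cball 0 r \<subseteq> ball (0 :: complex) R" using r by auto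
  have coef: "\<bar>Re ((deriv ^^ k) g 0 / fact k)\<bar> \<le> B / r ^ k"
    if "g holomorphic_on ball 0 R" "\<And>z. norm z = r \<Longrightarrow> norm (g z) \<le> B" for g k B
  proof -
    have "norm ((deriv ^^ k) g 0) \<le> fact k * B / r ^ k"
    proof (rule Cauchy_inequality)
      show "g holomorphic_on ball 0 r" by (rule holomorphic_on_subset[OF that(1)]) (use r in auto)
      show "continuous_on (cball 0 r) g"
        by (rule holomorphic_on_imp_continuous_on[OF holomorphic_on_subset[OF that(1) sub]])
      show "norm (g z) \<le> B" if "norm (0 - z) = r" for z using that \<open>\<And>z. norm z = r \<Longrightarrow> norm (g z) \<le> B\<close> by simp
    qed (use r in auto)
    then have "norm ((deriv ^^ k) g 0 / fact k) \<le> B / r ^ k"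
      using zero_less_power[OF r(1), of k] by (simp add: norm_divide field_simps)
    then show ?thesis using abs_Re_le_cmod order_trans by blast
  qed
  obtain L where L: "\<And>z. norm z = r \<Longrightarrow> norm (l z) \<le> L" "L \<ge> 0"
  proof -
    have "bounded (l ` cball 0 r)"
      by (intro compact_imp_bounded compact_continuous_image holomorphic_on_imp_continuous_on
          holomorphic_on_subset[OF l sub]) auto
    then obtain B where "\<And>z. z \<in> cball 0 r \<Longrightarrow> norm (l z) \<le> B" unfolding bounded_iff by blast
    then show ?thesis by (intro that[of "max B 0"]) (auto simp: le_max_iff_disj)
  qed
  obtain Q where Q: "\<And>z. norm z = r \<Longrightarrow> norm (q z) \<le> Q" "Q \<ge> 0"
  proof -
    have "bounded (q ` cball 0 r)"
      by (intro compact_imp_bounded compact_continuous_image holomorphic_on_imp_continuous_on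
          holomorphic_on_subset[OF q sub]) auto
    then obtain B where "\<And>z. z \<in> cball 0 r \<Longrightarrow> norm (q z) \<le> B" unfolding bounded_iff by blast
    then show ?thesis by (intro that[of "max B 0"]) (auto simp: le_max_iff_disj)
  qed
  have exp_le: "norm (exp (l z * of_real s)) \<le> exp (L * S)" if "norm z = r" "\<bar>s\<bar> \<le> S" for z s S
  proof -
    have "Re (l z * of_real s) \<le> norm (l z * of_real s)" by (rule complex_Re_le_cmod)
    also have "\<dots> \<le> L * S" unfolding norm_mult norm_of_real
      using L that by (intro mult_mono) auto
    finally show ?thesis by simp
  qed
  have Fb: "norm (F i s z) \<le> Q * L ^ i * exp (L * S)" if "norm z = r" "\<bar>s\<bar> \<le> S" for i s S z
    unfolding F_def norm_mult norm_power
    using L Q that exp_le[OF that] by (intro mult_mono power_mono) auto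
  show ?thesis
  proof (rule that[of A])
    show "\<exists>B. \<forall>k s. \<bar>s\<bar> \<le> S \<longrightarrow> \<bar>A k i s\<bar> \<le> B / r ^ k" for i S
      unfolding A_def by (intro exI[of _ "Q * L ^ i * exp (L * S)"] allI impI coef hF Fb)
    show "(\<lambda>k. A k 0 s * y ^ k) sums Re (q (of_real y) * exp (l (of_real y) * of_real s))" if "\<bar>y\<bar> < R" for s y
    proof -
      have "(\<lambda>k. (deriv ^^ k) (F 0 s) 0 / fact k * (of_real y - 0) ^ k) sums F 0 s (of_real y)"
        by (rule holomorphic_power_series[OF hF]) (use that in simp)
      from sums_Re[OF this]
      have "(\<lambda>k. Re ((deriv ^^ k) (F 0 s) 0 / fact k * of_real (y ^ k))) sums Re (F 0 s (of_real y))"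
        by simp
      moreover have "Re (w * of_real (y ^ k)) = Re w * y ^ k" for w k
        by (simp del: of_real_power)
      ultimately show ?thesis
        by (simp only: A_def) (simp add: F_def)
    qed
    show "(A k i has_real_derivative A k (Suc i) s) (at s)" for k i s
    proof (rule has_real_derivative_quadratic_remainder)
      fix h :: real assume h: "\<bar>h\<bar> \<le> 1"
      \<comment> \<open>Taylor coefficients in \<open>z\<close> are linear, so the remainder of
        \<open>A k i\<close> in \<open>s\<close> is the coefficient of \<open>?g\<close>. On the
        circle \<open>?g\<close> is \<open>F i s z\<close> times \<open>exp w - 1 - w\<close> with
        \<open>w = l z * h\<close>, of order \<open>h\<^sup>2\<close>; the restriction to
        \<open>\<bar>h\<bar> \<le> 1\<close> makes the factor \<open>exp L\<close> independent of
        \<open>h\<close>.\<close>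
      let ?g = "\<lambda>z. F i (s + h) z - F i s z - of_real h * F (Suc i) s z"
      have "(deriv ^^ k) ?g 0 = (deriv ^^ k) (F i (s + h)) 0 - (deriv ^^ k) (F i s) 0 - of_real h * (deriv ^^ k) (F (Suc i) s) 0"
      proof -
        have "(deriv ^^ k) ?g 0 = (deriv ^^ k) (\<lambda>z. F i (s + h) z - F i s z) 0 - (deriv ^^ k) (\<lambda>z. of_real h * F (Suc i) s z) 0"
          by (rule higher_deriv_diff[where S = "ball 0 R"]) (use r in \<open>auto intro!: holomorphic_intros hF\<close>)
        also have "(deriv ^^ k) (\<lambda>z. F i (s + h) z - F i s z) 0 = (deriv ^^ k) (F i (s + h)) 0 - (deriv ^^ k) (F i s) 0"
          by (rule higher_deriv_diff[where S = "ball 0 R"]) (use r in \<open>auto intro!: hF\<close>)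
        also have "(deriv ^^ k) (\<lambda>z. of_real h * F (Suc i) s z) 0 = of_real h * (deriv ^^ k) (F (Suc i) s) 0"
          by (rule higher_deriv_cmult[where A = "ball 0 R"]) (use r in \<open>auto intro!: hF\<close>)
        finally show ?thesis .
      qed
      then have "(deriv ^^ k) ?g 0 / fact k = (deriv ^^ k) (F i (s + h)) 0 / fact k - (deriv ^^ k) (F i s) 0 / fact k
          - of_real h * ((deriv ^^ k) (F (Suc i) s) 0 / fact k)"
        by (simp add: diff_divide_distrib)
      then have "A k i (s + h) - A k i s - h * A k (Suc i) s = Re ((deriv ^^ k) ?g 0 / fact k)"
        by (simp only: A_def minus_complex.sel Re_complex_of_real times_complex.sel Im_complex_of_real mult_zero_left diff_zero)
      also have "\<bar>\<dots>\<bar> \<le> (Q * L ^ i * exp (L * \<bar>s\<bar>) * (exp L * L\<^sup>2 * h\<^sup>2)) / r ^ k"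
      proof (rule coef)
        show "?g holomorphic_on ball 0 R" by (intro holomorphic_intros hF)
        fix z :: complex assume z: "norm z = r"
        let ?w = "l z * of_real h"
        have w: "norm ?w \<le> L * \<bar>h\<bar>" unfolding norm_mult norm_of_real using L z by (intro mult_right_mono) auto
        have "norm (exp ?w - 1 - ?w) \<le> exp \<bar>Re ?w\<bar> * (norm ?w)\<^sup>2"
          using Taylor_exp[of ?w 1] by (simp add: diff_diff_eq power2_eq_square)
        also have "\<dots> \<le> exp L * (L * \<bar>h\<bar>)\<^sup>2"
        proof (intro mult_mono power_mono w)
          have "\<bar>Re ?w\<bar> \<le> L * \<bar>h\<bar>" using w abs_Re_le_cmod order_trans by blast
          also have "\<dots> \<le> L" using L h by (simp add: mult_left_le)
          finally show "exp \<bar>Re ?w\<bar> \<le> exp L" by simp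
        qed auto
        finally have e: "norm (exp ?w - 1 - ?w) \<le> exp L * L\<^sup>2 * h\<^sup>2" by (simp add: power_mult_distrib)
        have "?g z = F i s z * (exp ?w - 1 - ?w)"
          by (simp add: F_def algebra_simps exp_add)
        then show "norm (?g z) \<le> Q * L ^ i * exp (L * \<bar>s\<bar>) * (exp L * L\<^sup>2 * h\<^sup>2)"
          unfolding norm_mult \<open>?g z = _\<close> using Fb[OF z, of s "\<bar>s\<bar>" i] e Q L by (intro mult_mono) auto
      qed
      finally show "\<bar>A k i (s + h) - A k i s - h * A k (Suc i) s\<bar>
        \<le> (Q * L ^ i * exp (L * \<bar>s\<bar>) * exp L * L\<^sup>2 / r ^ k) * h\<^sup>2"
        by (simp add: mult.assoc)
    qed
  qed
qed

text \<open>With \<open>y = 1 / n\<^sup>2\<close> this form of the slow root has no division by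
  \<open>y\<close> and is analytic at \<open>y = 0\<close>. The radius is the distance to the branch
  point: inside the disc the radicand has positive real part, hence avoids the cut of
  \<open>csqrt\<close>, and \<open>1 + csqrt\<close> has real part at least 1.\<close>

lemma slow_branch_expansion:
  fixes c :: real
  assumes c: "c > 0" and r: "0 < r" "r < 1 / (4 * c\<^sup>2)"
  obtains A :: "nat \<Rightarrow> nat \<Rightarrow> real \<Rightarrow> real" where
    "\<And>k i s. (A k i has_real_derivative A k (Suc i) s) (at s)"
    "\<And>i S. \<exists>B. \<forall>k s. \<bar>s\<bar> \<le> S \<longrightarrow> \<bar>A k i s\<bar> \<le> B / r ^ k"
    "\<And>s y. 0 \<le> y \<Longrightarrow> y < 1 / (4 * c\<^sup>2) \<Longrightarrow> (\<lambda>k. A k 0 s * y ^ k) sums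
       (exp (- 2 * c\<^sup>2 / (1 + sqrt (1 - 4 * c\<^sup>2 * y)) * s) / sqrt (1 - 4 * c\<^sup>2 * y))"
proof -
  let ?R = "1 / (4 * c\<^sup>2)"
  let ?\<sigma> = "\<lambda>z :: complex. csqrt (1 - of_real (4 * c\<^sup>2) * z)"
  have Re: "Re (1 - of_real (4 * c\<^sup>2) * z) > 0" if "z \<in> ball 0 ?R" for z :: complex
  proof -
    have "Re z < ?R" using that complex_Re_le_cmod[of z] by simp
    then show ?thesis using c by (simp add: field_simps)
  qed
  have nz: "?\<sigma> z \<noteq> 0" "1 + ?\<sigma> z \<noteq> 0" if "z \<in> ball 0 ?R" for z
  proof -
    show "?\<sigma> z \<noteq> 0" using Re[OF that] by (metis csqrt_eq_0 less_irrefl zero_complex.sel(1))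
    have "Re (1 + ?\<sigma> z) \<ge> 1" using Re_csqrt by (simp del: csqrt.simps)
    then show "1 + ?\<sigma> z \<noteq> 0" by (metis not_one_le_zero zero_complex.sel(1))
  qed
  have np: "1 - of_real (4 * c\<^sup>2) * z \<notin> \<real>\<^sub>\<le>\<^sub>0" if "z \<in> ball 0 ?R" for z :: complex
    using Re[OF that] by (auto simp: complex_nonpos_Reals_iff)
  have hs: "?\<sigma> holomorphic_on ball 0 ?R"
    by (intro holomorphic_on_csqrt' holomorphic_intros np)
  obtain A where A: "\<And>k i s. (A k i has_real_derivative A k (Suc i) s) (at s)"
    "\<And>i S. \<exists>B. \<forall>k s. \<bar>s\<bar> \<le> S \<longrightarrow> \<bar>A k i s\<bar> \<le> B / r ^ k"
    "\<And>s y. \<bar>y\<bar> < ?R \<Longrightarrow> (\<lambda>k. A k 0 s * y ^ k) sums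
       Re (1 / ?\<sigma> (of_real y) * exp ((- 2 * of_real (c\<^sup>2) / (1 + ?\<sigma> (of_real y))) * of_real s))"
  proof (rule exp_holomorphic_expansion[of "\<lambda>z. 1 / ?\<sigma> z" ?R "\<lambda>z. - 2 * of_real (c\<^sup>2) / (1 + ?\<sigma> z)" r])
    show "(\<lambda>z. 1 / ?\<sigma> z) holomorphic_on ball 0 ?R"
      by (intro holomorphic_on_divide hs nz holomorphic_on_const)
    show "(\<lambda>z. - 2 * of_real (c\<^sup>2) / (1 + ?\<sigma> z)) holomorphic_on ball 0 ?R"
      by (intro holomorphic_on_divide holomorphic_on_add hs nz holomorphic_on_const)
  qed (use r in auto)
  show ?thesis
  proof (rule that[of A])
    show "(\<lambda>k. A k 0 s * y ^ k) sums
       (exp (- 2 * c\<^sup>2 / (1 + sqrt (1 - 4 * c\<^sup>2 * y)) * s) / sqrt (1 - 4 * c\<^sup>2 * y))"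
      if y: "0 \<le> y" "y < ?R" for s y
    proof -
      have p: "1 - 4 * c\<^sup>2 * y \<ge> 0" using y c by (simp add: field_simps)
      have "?\<sigma> (of_real y) = csqrt (of_real (1 - 4 * c\<^sup>2 * y))" by simp
      also have "\<dots> = of_real (sqrt (1 - 4 * c\<^sup>2 * y))" using of_real_sqrt[OF p] by (rule sym)
      finally have s: "?\<sigma> (of_real y) = of_real (sqrt (1 - 4 * c\<^sup>2 * y))" .
      let ?t = "sqrt (1 - 4 * c\<^sup>2 * y)"
      have "1 / complex_of_real ?t * exp ((- 2 * of_real (c\<^sup>2) / (1 + of_real ?t)) * of_real s)
        = of_real (1 / ?t * exp ((- 2 * c\<^sup>2 / (1 + ?t)) * s))"
        by (simp add: exp_of_real[symmetric])
      then have e: "Re (1 / complex_of_real ?t * exp ((- 2 * of_real (c\<^sup>2) / (1 + of_real ?t)) * of_real s))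
        = exp (- 2 * c\<^sup>2 / (1 + ?t) * s) / ?t"
        by (simp only: Re_complex_of_real) simp
      show ?thesis using A(3)[of y s, unfolded s e] y by simp
    qed
  qed (use A in auto)
qed

section \<open>Tails of the Green function series and their derivatives\<close>

definition sin_tail :: "real \<Rightarrow> nat \<Rightarrow> nat \<Rightarrow> real \<Rightarrow> real" where
  "sin_tail \<alpha> N p x = (\<Sum>n. if n < N then 0 else sin (real n * \<alpha>) * sin (real n * x) / real n ^ p)"

definition cos_tail :: "real \<Rightarrow> nat \<Rightarrow> nat \<Rightarrow> real \<Rightarrow> real" where
  "cos_tail \<alpha> N p x = (\<Sum>n. if n < N then 0 else sin (real n * \<alpha>) * cos (real n * x) / real n ^ p)"

lemma summable_inverse_square: "summable (\<lambda>n. 1 / (real n)\<^sup>2)"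
  using inverse_power_summable[of 2, where 'a = real] by (simp add: divide_inverse)

lemma suminf_tail:
  fixes f :: "nat \<Rightarrow> real"
  assumes "summable f"
  shows "(\<Sum>n. if n < N then 0 else f n) = (\<Sum>n. f n) - (\<Sum>n<N. f n)"
    "summable (\<lambda>n. if n < N then 0 else f n)"
proof -
  have "(\<lambda>n. f n - (if n \<in> {..<N} then f n else 0)) sums ((\<Sum>n. f n) - (\<Sum>n<N. f n))"
    by (intro sums_diff summable_sums assms sums_If_finite_set) simp
  moreover have "(\<lambda>n. f n - (if n \<in> {..<N} then f n else 0)) = (\<lambda>n. if n < N then 0 else f n)" by auto
  ultimately have "(\<lambda>n. if n < N then 0 else f n) sums ((\<Sum>n. f n) - (\<Sum>n<N. f n))" by simp
  then show "(\<Sum>n. if n < N then 0 else f n) = (\<Sum>n. f n) - (\<Sum>n<N. f n)"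
    "summable (\<lambda>n. if n < N then 0 else f n)" by (auto simp: sums_iff)
qed

lemma tail_term_bound:
  assumes "1 \<le> N" "\<bar>a\<bar> \<le> 1" "\<bar>b\<bar> \<le> 1"
  shows "\<bar>if n < N then 0 else a * b / real n ^ (m + 2)\<bar> \<le> 1 / real N ^ m * (1 / (real n)\<^sup>2)"
proof (cases "n < N")
  case False
  have "\<bar>a * b\<bar> \<le> 1 * 1" unfolding abs_mult using assms by (intro mult_mono) auto
  moreover have "real N ^ m * (real n)\<^sup>2 \<le> real n ^ (m + 2)"
    unfolding power_add using False by (intro mult_right_mono power_mono) auto
  ultimately have "\<bar>a * b\<bar> / real n ^ (m + 2) \<le> 1 / (real N ^ m * (real n)\<^sup>2)"
    using False assms(1) by (intro frac_le) auto
  then show ?thesis using False by (simp add: abs_divide)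
qed simp

text \<open>Dropping \<open>n < N\<close> turns every power of \<open>1 / n\<close> beyond the
  square into a factor of at most \<open>1 / N\<close>. This geometric gain has to beat the growth
  \<open>1 / r ^ k\<close> of the Taylor coefficients.\<close>

lemma tail_bounds:
  assumes "1 \<le> N"
  shows "\<bar>sin_tail \<alpha> N (m + 2) x\<bar> \<le> 1 / real N ^ m * (\<Sum>n. 1 / (real n)\<^sup>2)"
    "\<bar>cos_tail \<alpha> N (m + 2) x\<bar> \<le> 1 / real N ^ m * (\<Sum>n. 1 / (real n)\<^sup>2)"
proof -
  have *: "\<bar>\<Sum>n. f n\<bar> \<le> 1 / real N ^ m * (\<Sum>n. 1 / (real n)\<^sup>2)"
    if "\<And>n. \<bar>f n\<bar> \<le> 1 / real N ^ m * (1 / (real n)\<^sup>2)" for f :: "nat \<Rightarrow> real"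
  proof -
    have s: "summable (\<lambda>n. 1 / real N ^ m * (1 / (real n)\<^sup>2))"
      by (intro summable_mult summable_inverse_square)
    have sf: "summable (\<lambda>n. \<bar>f n\<bar>)"
      by (rule summable_comparison_test'[OF s, of 0]) (use that in simp)
    have "\<bar>\<Sum>n. f n\<bar> \<le> (\<Sum>n. \<bar>f n\<bar>)" by (rule summable_rabs[OF sf])
    also have "\<dots> \<le> (\<Sum>n. 1 / real N ^ m * (1 / (real n)\<^sup>2))" by (intro suminf_le that sf s)
    also have "\<dots> = 1 / real N ^ m * (\<Sum>n. 1 / (real n)\<^sup>2)"
      by (rule suminf_mult[OF summable_inverse_square])
    finally show ?thesis .
  qed
  show "\<bar>sin_tail \<alpha> N (m + 2) x\<bar> \<le> 1 / real N ^ m * (\<Sum>n. 1 / (real n)\<^sup>2)"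
    "\<bar>cos_tail \<alpha> N (m + 2) x\<bar> \<le> 1 / real N ^ m * (\<Sum>n. 1 / (real n)\<^sup>2)"
    unfolding sin_tail_def cos_tail_def by (intro * tail_term_bound assms abs_sin_le_one abs_cos_le_one)+
qed

lemma termwise_derivative:
  fixes f f' :: "nat \<Rightarrow> real \<Rightarrow> real"
  assumes "\<And>n x. (f n has_real_derivative f' n x) (at x)"
    and "summable M" "\<And>n x. \<bar>f n x\<bar> \<le> M n" "\<And>n x. \<bar>f' n x\<bar> \<le> M n"
  shows "((\<lambda>x. \<Sum>n. f n x) has_real_derivative (\<Sum>n. f' n x)) (at x)"
proof (rule has_field_derivative_series'(2)[of UNIV])
  show "uniformly_convergent_on UNIV (\<lambda>n x. \<Sum>i<n. f' i x)"
    by (rule Weierstrass_m_test'[OF _ assms(2)]) (use assms in auto)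
  show "summable (\<lambda>n. f n 0)"
    by (rule summable_comparison_test'[OF assms(2), of 0]) (use assms in auto)
qed (use assms in auto)

text \<open>Each differentiation costs one power of \<open>n\<close>, and the differentiated series
  must still converge absolutely, so termwise differentiation ends once exponent 2 is reached. There
  a closed form has to take over.\<close>

lemma tail_deriv:
  assumes "1 \<le> N"
  shows "(sin_tail \<alpha> N (p + 3) has_real_derivative cos_tail \<alpha> N (p + 2) x) (at x)"
    "(cos_tail \<alpha> N (p + 3) has_real_derivative - sin_tail \<alpha> N (p + 2) x) (at x)"
proof -
  let ?M = "\<lambda>n. 1 / (real n)\<^sup>2"
  have b: "\<bar>if n < N then 0 else a * b / real n ^ (m + 2)\<bar> \<le> ?M n" if "\<bar>a\<bar> \<le> 1" "\<bar>b\<bar> \<le> 1" for n m a b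
  proof -
    have "1 / real N ^ m * (1 / (real n)\<^sup>2) \<le> 1 * (1 / (real n)\<^sup>2)"
      using assms by (intro mult_right_mono) (auto simp: divide_le_eq_1 one_le_power)
    then show ?thesis using tail_term_bound[OF assms that, of n m] by simp
  qed
  have b3: "\<bar>if n < N then 0 else a * b / real n ^ (m + 3)\<bar> \<le> ?M n" if "\<bar>a\<bar> \<le> 1" "\<bar>b\<bar> \<le> 1" for n m a b
  proof -
    have "m + 3 = Suc m + 2" by simp
    then show ?thesis using b[OF that, of n "Suc m"] by metis
  qed
  have "((\<lambda>x. \<Sum>n. if n < N then 0 else sin (real n * \<alpha>) * sin (real n * x) / real n ^ (p + 3)) has_real_derivative
      (\<Sum>n. if n < N then 0 else sin (real n * \<alpha>) * cos (real n * x) / real n ^ (p + 2))) (at x)"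
  proof (rule termwise_derivative[OF _ summable_inverse_square])
    show "((\<lambda>x. if n < N then 0 else sin (real n * \<alpha>) * sin (real n * x) / real n ^ (p + 3)) has_real_derivative
      (if n < N then 0 else sin (real n * \<alpha>) * cos (real n * x) / real n ^ (p + 2))) (at x)" for n x
      using assms by (cases "n < N") (auto intro!: derivative_eq_intros simp: field_simps numeral_3_eq_3 power2_eq_square)
  qed (intro b b3 abs_sin_le_one abs_cos_le_one)+
  then show "(sin_tail \<alpha> N (p + 3) has_real_derivative cos_tail \<alpha> N (p + 2) x) (at x)"
    by (simp only: sin_tail_def[abs_def] cos_tail_def)
  have "((\<lambda>x. \<Sum>n. if n < N then 0 else sin (real n * \<alpha>) * cos (real n * x) / real n ^ (p + 3)) has_real_derivative
      (\<Sum>n. if n < N then 0 else sin (real n * \<alpha>) * (- sin (real n * x)) / real n ^ (p + 2))) (at x)"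
  proof (rule termwise_derivative[OF _ summable_inverse_square])
    show "((\<lambda>x. if n < N then 0 else sin (real n * \<alpha>) * cos (real n * x) / real n ^ (p + 3)) has_real_derivative
      (if n < N then 0 else sin (real n * \<alpha>) * (- sin (real n * x)) / real n ^ (p + 2))) (at x)" for n x
      using assms by (cases "n < N") (auto intro!: derivative_eq_intros simp: field_simps numeral_3_eq_3 power2_eq_square)
  qed (intro b b3 abs_sin_le_one abs_cos_le_one | simp)+
  also have "(\<Sum>n. if n < N then 0 else sin (real n * \<alpha>) * (- sin (real n * x)) / real n ^ (p + 2)) = - sin_tail \<alpha> N (p + 2) x"
  proof -
    have "summable (\<lambda>n. if n < N then 0 else sin (real n * \<alpha>) * sin (real n * x) / real n ^ (p + 2))"
      by (rule summable_comparison_test'[OF summable_inverse_square, of 0])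
        (use b in \<open>simp only: real_norm_def abs_sin_le_one\<close>)
    from suminf_minus[OF this] show ?thesis
      unfolding sin_tail_def by (simp add: if_distrib[of uminus] cong: if_cong)
  qed
  finally show "(cos_tail \<alpha> N (p + 3) has_real_derivative - sin_tail \<alpha> N (p + 2) x) (at x)"
    by (simp only: cos_tail_def[abs_def])
qed

text \<open>
  \<open>K = 0\<close> in the Green function: beyond \<open>\<alpha>\<close> the slowest decaying tail is linear up to
  finitely many modes, hence smooth.
\<close>

lemma sin_tail_2:
  assumes \<alpha>: "0 < \<alpha>" "\<alpha> < pi" and x: "x \<in> {\<alpha><..<pi}"
  shows "sin_tail \<alpha> N 2 x = \<alpha> * (pi - x) / 2 - (\<Sum>n<N. sin (real n * \<alpha>) / (real n)\<^sup>2 * sin (real n * x))"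
proof -
  let ?b = "\<lambda>n. sin (real n * \<alpha>) / (real n)\<^sup>2 * sin (real n * x)"
  have "\<alpha> * (pi - x) / pi = 2 / pi * (\<Sum>n. sin (real n * \<alpha>) / ((real n)\<^sup>2 + 0) * sin (real n * x))"
    by (rule green_function_sine_series[OF _ \<alpha>, where A = "\<lambda>x. x * (pi - \<alpha>) / pi" and A' = "\<lambda>x. (pi - \<alpha>) / pi"
          and B' = "\<lambda>x. - \<alpha> / pi" and B = "\<lambda>x. \<alpha> * (pi - x) / pi"])
      (use x in \<open>auto intro!: derivative_eq_intros simp: field_simps\<close>)
  then have s: "(\<Sum>n. ?b n) = \<alpha> * (pi - x) / 2" by (simp add: field_simps)
  have sm: "summable ?b"
  proof (rule summable_comparison_test'[OF summable_inverse_square, of 0])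
    show "norm (?b n) \<le> 1 / (real n)\<^sup>2" for n
      using tail_term_bound[of 1 "sin (real n * \<alpha>)" "sin (real n * x)" n 0] by (cases "n = 0") (auto simp: power2_eq_square)
  qed
  show ?thesis
    unfolding sin_tail_def using suminf_tail(1)[OF sm, of N] s by (simp cong: if_cong)
qed

text \<open>\<open>green_tail \<alpha> N k j\<close> stands for the derivative of order
  \<open>j\<close> of \<open>sin_tail \<alpha> N (2 * k + 2)\<close> to the right of \<alpha>. Two
  derivatives lower \<open>k\<close> by one and change the sign; at \<open>k = 0\<close> a linear
  function minus finitely many modes can be differentiated without end. The phase
  \<open>j * pi / 2\<close> writes all derivatives of the sine as one formula.\<close>

primrec green_tail :: "real \<Rightarrow> nat \<Rightarrow> nat \<Rightarrow> nat \<Rightarrow> real \<Rightarrow> real" where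
  "green_tail \<alpha> N 0 = (\<lambda>j x. (if j = 0 then \<alpha> * (pi - x) / 2 else if j = 1 then - \<alpha> / 2 else 0)
     - (\<Sum>n<N. sin (real n * \<alpha>) / (real n)\<^sup>2 * (real n ^ j * sin (real n * x + real j * pi / 2))))"
| "green_tail \<alpha> N (Suc k) = (\<lambda>j. if j = 0 then sin_tail \<alpha> N (2 * k + 4)
     else if j = 1 then cos_tail \<alpha> N (2 * k + 3) else (\<lambda>x. - green_tail \<alpha> N k (j - 2) x))"

lemma green_tail_eq_sin_tail:
  assumes "0 < \<alpha>" "\<alpha> < pi" "x \<in> {\<alpha><..<pi}"
  shows "green_tail \<alpha> N k 0 x = sin_tail \<alpha> N (2 * k + 2) x"
proof (cases k)
  case 0
  then show ?thesis using sin_tail_2[OF assms, of N] by (simp add: numeral_2_eq_2)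
next
  case (Suc i)
  have "2 * Suc i + 2 = 2 * i + 4" by simp
  then show ?thesis unfolding Suc by (simp only: green_tail.simps simp_thms if_True)
qed

lemma sin_mult_deriv:
  "((\<lambda>x. a ^ j * sin (a * x + real j * pi / 2)) has_real_derivative a ^ Suc j * sin (a * x + real (Suc j) * pi / 2)) (at x)"
proof -
  have "sin (a * x + real (Suc j) * pi / 2) = sin (a * x + real j * pi / 2 + pi / 2)"
    by (simp add: algebra_simps add_divide_distrib)
  also have "\<dots> = cos (a * x + real j * pi / 2)" by (simp only: sin_add) simp
  finally show ?thesis by (auto intro!: derivative_eq_intros)
qed

lemma green_tail_deriv:
  assumes \<alpha>: "0 < \<alpha>" "\<alpha> < pi" and N: "1 \<le> N" and x: "x \<in> {\<alpha><..<pi}"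
  shows "(green_tail \<alpha> N k j has_real_derivative green_tail \<alpha> N k (Suc j) x) (at x)"
proof (induction k arbitrary: j)
  case 0
  have "((\<lambda>x. if j = 0 then \<alpha> * (pi - x) / 2 else if j = 1 then - \<alpha> / 2 else 0) has_real_derivative
    (if Suc j = 0 then \<alpha> * (pi - x) / 2 else if Suc j = 1 then - \<alpha> / 2 else 0)) (at x)"
    by (cases j) (auto intro!: derivative_eq_intros)
  then show ?case
    unfolding green_tail.simps by (intro DERIV_diff DERIV_sum DERIV_cmult sin_mult_deriv)
next
  case (Suc k)
  consider "j = 0" | "j = 1" | i where "j = Suc (Suc i)" by (metis One_nat_def not0_implies_Suc)
  then show ?case
  proof cases
    case 1
    then show ?thesis using tail_deriv(1)[OF N, of \<alpha> "2 * k + 1" x] by (simp add: numeral_eq_Suc)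
  next
    \<comment> \<open>At the lowest level \<open>k = 0\<close> the tail of exponent 2 is reached
      here, and it agrees with the closed form only to the right of \<alpha>.\<close>
    case 2
    then show ?thesis
      using tail_deriv(2)[OF N, of \<alpha> "2 * k" x] green_tail_eq_sin_tail[OF \<alpha> x, of N k] by simp
  next
    case 3
    then show ?thesis using DERIV_minus[OF Suc.IH[of i]] by simp
  qed
qed

text \<open>The constant may depend on \<open>j\<close> but not on \<open>k\<close>. Two derivatives
  trade one level of \<open>k\<close> for a factor \<open>N\<^sup>2\<close>, paid once per pair of
  derivatives and not once per level, so orders 0 and 1 are estimated directly and the induction
  moves by two.\<close>

lemma green_tail_bound:
  assumes \<alpha>: "0 < \<alpha>" "\<alpha> < pi" and N: "1 \<le> N"
  shows "\<exists>C. \<forall>k. \<forall>x\<in>{\<alpha><..<pi}. \<bar>green_tail \<alpha> N k j x\<bar> \<le> C / (real N ^ 2) ^ k"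
proof -
  define S where "S = (\<Sum>n. 1 / (real n)\<^sup>2)"
  define C0 where "C0 j = \<alpha> * pi + (\<Sum>n<N. real n ^ j)" for j
  have S: "S \<ge> 0" unfolding S_def by (intro suminf_nonneg summable_inverse_square) auto
  have C0: "C0 j \<ge> 0" for j unfolding C0_def using \<alpha> by (intro add_nonneg_nonneg sum_nonneg) auto
  have Np: "(real N)\<^sup>2 ^ k > 0" for k using N by simp
  have b0: "\<bar>green_tail \<alpha> N 0 j x\<bar> \<le> C0 j" if x: "x \<in> {\<alpha><..<pi}" for j x
  proof -
    have "\<bar>\<alpha> * (pi - x) / 2\<bar> \<le> \<alpha> * pi" "\<bar>- \<alpha> / 2\<bar> \<le> \<alpha> * pi" "0 \<le> \<alpha> * pi"
    proof -
      have "\<alpha> * (pi - x) \<le> \<alpha> * pi" "0 \<le> \<alpha> * (pi - x)" using \<alpha> x by auto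
      then show "\<bar>\<alpha> * (pi - x) / 2\<bar> \<le> \<alpha> * pi" by linarith
      have "\<alpha> * 1 \<le> \<alpha> * pi" using \<alpha> pi_gt3 by (intro mult_left_mono) auto
      then show "\<bar>- \<alpha> / 2\<bar> \<le> \<alpha> * pi" "0 \<le> \<alpha> * pi" using \<alpha> by auto
    qed
    then have 1: "\<bar>if j = 0 then \<alpha> * (pi - x) / 2 else if j = 1 then - \<alpha> / 2 else 0\<bar> \<le> \<alpha> * pi" by auto
    have "\<bar>\<Sum>n<N. sin (real n * \<alpha>) / (real n)\<^sup>2 * (real n ^ j * sin (real n * x + real j * pi / 2))\<bar>
      \<le> (\<Sum>n<N. \<bar>sin (real n * \<alpha>) / (real n)\<^sup>2 * (real n ^ j * sin (real n * x + real j * pi / 2))\<bar>)"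
      by (rule sum_abs)
    also have "\<dots> \<le> (\<Sum>n<N. real n ^ j)"
    proof (rule sum_mono)
      fix n
      have "\<bar>sin (real n * \<alpha>) / (real n)\<^sup>2\<bar> \<le> 1"
        by (cases "n = 0") (auto simp: divide_le_eq intro!: order_trans[OF abs_sin_le_one])
      moreover have "\<bar>real n ^ j * sin (real n * x + real j * pi / 2)\<bar> \<le> real n ^ j * 1"
        unfolding abs_mult by (intro mult_mono) auto
      ultimately have "\<bar>sin (real n * \<alpha>) / (real n)\<^sup>2\<bar> * \<bar>real n ^ j * sin (real n * x + real j * pi / 2)\<bar> \<le> 1 * (real n ^ j * 1)"
        by (intro mult_mono) auto
      then show "\<bar>sin (real n * \<alpha>) / (real n)\<^sup>2 * (real n ^ j * sin (real n * x + real j * pi / 2))\<bar> \<le> real n ^ j"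
        by (simp only: abs_mult mult_1 mult_1_right)
    qed
    finally show ?thesis using 1 unfolding green_tail.simps C0_def by linarith
  qed
  \<comment> \<open>Level 0 has its own direct bound \<open>C0 j\<close>; adding it to the constant
    for the higher levels gives one constant for all \<open>k\<close>.\<close>
  have step: "\<exists>C. \<forall>k. \<forall>x\<in>{\<alpha><..<pi}. \<bar>green_tail \<alpha> N k j x\<bar> \<le> C / (real N ^ 2) ^ k"
    if "D \<ge> 0" "\<And>k x. x \<in> {\<alpha><..<pi} \<Longrightarrow> \<bar>green_tail \<alpha> N (Suc k) j x\<bar> \<le> D / (real N ^ 2) ^ Suc k" for j D
  proof (intro exI[of _ "C0 j + D"] allI ballI)
    fix k x assume x: "x \<in> {\<alpha><..<pi}"
    show "\<bar>green_tail \<alpha> N k j x\<bar> \<le> (C0 j + D) / (real N ^ 2) ^ k"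
    proof (cases k)
      case 0
      then show ?thesis using b0[OF x, of j] that(1) by simp
    next
      case (Suc i)
      have "D / (real N ^ 2) ^ k \<le> (C0 j + D) / (real N ^ 2) ^ k"
        using C0[of j] Np[of k] by (intro divide_right_mono) auto
      then show ?thesis using that(2)[OF x, of i] unfolding Suc by linarith
    qed
  qed
  show ?thesis
  proof (induction j rule: induct_nat_012)
    case 0
    show ?case
    proof (rule step[OF S])
      fix k x
      show "\<bar>green_tail \<alpha> N (Suc k) 0 x\<bar> \<le> S / (real N ^ 2) ^ Suc k"
        using tail_bounds(1)[OF N, of \<alpha> "2 * k + 2" x]
        by (simp add: S_def numeral_Bit0 power_mult[symmetric] power_add[symmetric] del: power_Suc)
    qed
  next
    case 1
    show ?case
    proof (rule step)
      show "real N * S \<ge> 0" using S by simp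
      fix k x
      have "\<bar>green_tail \<alpha> N (Suc k) (Suc 0) x\<bar> \<le> 1 / real N ^ (2 * k + 1) * S"
        using tail_bounds(2)[OF N, of \<alpha> "2 * k + 1" x] by (simp add: S_def numeral_3_eq_3)
      also have "\<dots> = real N * S / (real N ^ 2) ^ Suc k"
        using N by (simp add: power_mult power2_eq_square field_simps)
      finally show "\<bar>green_tail \<alpha> N (Suc k) (Suc 0) x\<bar> \<le> real N * S / (real N ^ 2) ^ Suc k" .
    qed
  next
    case (ge2 j)
    then obtain C where C: "\<And>k x. x \<in> {\<alpha><..<pi} \<Longrightarrow> \<bar>green_tail \<alpha> N k j x\<bar> \<le> C / (real N ^ 2) ^ k" by blast
    \<comment> \<open>Evaluating the bound at one point of the interval shows that \<open>C\<close>
      is nonnegative.\<close>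
    have "(\<alpha> + pi) / 2 \<in> {\<alpha><..<pi}" using \<alpha> by simp
    from order_trans[OF abs_ge_zero C[OF this, of 0]] have "C \<ge> 0" by simp
    show ?case
    proof (rule step)
      show "(real N)\<^sup>2 * C \<ge> 0" using \<open>C \<ge> 0\<close> by simp
      fix k x assume "x \<in> {\<alpha><..<pi}"
      then show "\<bar>green_tail \<alpha> N (Suc k) (Suc (Suc j)) x\<bar> \<le> (real N)\<^sup>2 * C / (real N ^ 2) ^ Suc k"
        using C[of x k] N by simp
    qed
  qed
qed

section \<open>Separation of the fast and the slow root\<close>

lemma suminf_swap:
  fixes F :: "nat \<Rightarrow> nat \<Rightarrow> real"
  assumes F: "\<And>k n. \<bar>F k n\<bar> \<le> a k * b n" and a: "summable a" and b: "summable b"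
  shows "(\<Sum>k. \<Sum>n. F k n) = (\<Sum>n. \<Sum>k. F k n)"
proof -
  let ?M = "count_space (UNIV :: nat set)"
  have sn: "summable (\<lambda>n. norm (F k n))" for k
    by (rule summable_comparison_test'[OF summable_mult[OF b, of "a k"], of 0]) (use F in auto)
  have sk: "summable (\<lambda>k. norm (F k n))" for n
    by (rule summable_comparison_test'[OF summable_mult2[OF a, of "b n"], of 0]) (use F in auto)
  have i: "integrable ?M (F k)" for k using sn by (simp add: integrable_count_space_nat_iff)
  have ss: "summable (\<lambda>k. \<integral>n. norm (F k n) \<partial>?M)"
  proof (rule summable_comparison_test'[OF summable_mult2[OF a, of "\<Sum>n. b n"], of 0])
    fix k
    have "(\<integral>n. norm (F k n) \<partial>?M) = (\<Sum>n. norm (F k n))"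
      using sn by (intro integral_count_space_nat) (simp add: integrable_count_space_nat_iff)
    also have "\<dots> \<le> (\<Sum>n. a k * b n)" using F sn by (intro suminf_le summable_mult b) auto
    also have "\<dots> = a k * (\<Sum>n. b n)" by (rule suminf_mult[OF b])
    finally show "norm (\<integral>n. norm (F k n) \<partial>?M) \<le> a k * (\<Sum>n. b n)"
      by simp
  qed
  have A: "AE n in ?M. summable (\<lambda>k. norm (F k n))" using sk by simp
  have "(\<Sum>k. \<Sum>n. F k n) = (\<Sum>k. \<integral>n. F k n \<partial>?M)"
    by (simp add: integral_count_space_nat i)
  also have "\<dots> = (\<integral>n. (\<Sum>k. F k n) \<partial>?M)"
    using integral_suminf[OF i A ss] by simp
  also have "\<dots> = (\<Sum>n. \<Sum>k. F k n)"
    by (rule integral_count_space_nat[OF integrable_suminf[OF i A ss]])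
  finally show ?thesis .
qed

lemma summable_power_mult_exp:
  fixes d :: real
  assumes "d > 0"
  shows "summable (\<lambda>n. real n ^ m * exp (- d * real n))"
proof (rule summable_comparison_test_bigo)
  show "summable (\<lambda>n. norm (1 / (real n)\<^sup>2))" using summable_inverse_square by simp
  show "(\<lambda>n. real n ^ m * exp (- d * real n)) \<in> O(\<lambda>n. 1 / (real n)\<^sup>2)"
    using assms by real_asymp
qed

text \<open>Here \<open>sqrt D = n\<^sup>2 * \<sigma> / 2\<close>, so the two exponentials in
  \<open>sinh\<close> carry the roots \<open>n\<^sup>2 * (\<sigma> - 1) / 2\<close> and
  \<open>- n\<^sup>2 * (1 + \<sigma>) / 2\<close>, which the hypothesis makes real and
  distinct.\<close>

lemma mode_split:
  fixes n :: nat and c s :: real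
  defines "\<sigma> \<equiv> sqrt (1 - 4 * c\<^sup>2 * (1 / (real n)\<^sup>2))"
  assumes n: "4 * c\<^sup>2 < (real n)\<^sup>2"
  shows "mode c n s = exp (- 2 * c\<^sup>2 / (1 + \<sigma>) * s) / \<sigma> / (real n)\<^sup>2
    - exp (- (real n)\<^sup>2 * (1 + \<sigma>) / 2 * s) / ((real n)\<^sup>2 * \<sigma>)"
proof -
  let ?N = "(real n)\<^sup>2"
  have N: "?N > 0" using n by (smt (verit) zero_le_power2)
  have p: "1 - 4 * c\<^sup>2 * (1 / ?N) > 0" using n N by (simp add: field_simps)
  then have \<sigma>: "\<sigma> > 0" "\<sigma>\<^sup>2 = 1 - 4 * c\<^sup>2 / ?N" by (auto simp: \<sigma>_def)
  define D where "D = (real n)^4 / 4 - c\<^sup>2 * ?N"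
  have "D = (?N * \<sigma> / 2)\<^sup>2"
    unfolding D_def power_divide power_mult_distrib \<sigma>(2) using N
    by (simp add: field_simps power2_eq_square power4_eq_xxxx)
  then have sD: "sqrt D = ?N * \<sigma> / 2" "D > 0" using N \<sigma> by (auto simp: real_sqrt_unique)
  \<comment> \<open>Multiplication by the conjugate \<open>1 + \<sigma>\<close> removes the
    cancellation in \<open>\<sigma> - 1\<close> and gives the form that is analytic in
    \<open>1 / n\<^sup>2\<close>.\<close>
  have l: "- 2 * c\<^sup>2 / (1 + \<sigma>) = ?N * (\<sigma> - 1) / 2"
  proof -
    have "?N * (\<sigma>\<^sup>2 - 1) = - 4 * c\<^sup>2" unfolding \<sigma>(2) using N by simp
    then have "?N * (\<sigma> - 1) * (1 + \<sigma>) = - 4 * c\<^sup>2" by (simp add: power2_eq_square algebra_simps)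
    then show ?thesis using \<sigma>(1) by (simp add: field_simps)
  qed
  have e: "exp (- 2 * c\<^sup>2 / (1 + \<sigma>) * s) = exp (- (?N / 2) * s) * exp (sqrt D * s)"
    "exp (- ?N * (1 + \<sigma>) / 2 * s) = exp (- (?N / 2) * s) * exp (- (sqrt D * s))"
    unfolding l sD(1) exp_add[symmetric] by (simp_all add: algebra_simps diff_divide_distrib)
  have "mode c n s = exp (- (?N / 2) * s) * (sinh (sqrt D * s) / sqrt D)"
    unfolding mode_def D_def[symmetric] osc_def using sD(2) by simp
  also have "\<dots> = exp (- (?N / 2) * s) * (exp (sqrt D * s) - exp (- (sqrt D * s))) / (?N * \<sigma>)"
    unfolding sinh_field_def sD(1) by (simp del: left_diff_distrib_numeral)
  finally show ?thesis unfolding e by (simp only: right_diff_distrib diff_divide_distrib) (simp add: mult.commute)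
qed

lemma smooth_on_fst_snd_mult:
  fixes u v :: "real \<Rightarrow> real"
  assumes "open I" "open J" "smooth_on I u" "smooth_on J v"
  shows "smooth_on (I \<times> J) (\<lambda>(s, x). u s * v x)"
proof -
  have "smooth_on (I \<times> J) (\<lambda>p. u (0 + fst p))"
    by (rule smooth_on_affine[of I "I \<times> J" fst]) (use assms in \<open>auto intro: open_Times bounded_linear_fst\<close>)
  moreover have "smooth_on (I \<times> J) (\<lambda>p. v (0 + snd p))"
    by (rule smooth_on_affine[of J "I \<times> J" snd]) (use assms in \<open>auto intro: open_Times bounded_linear_snd\<close>)
  ultimately have "smooth_on (I \<times> J) (\<lambda>p. u (0 + fst p) * v (0 + snd p))"
    by (intro smooth_on_mult open_Times assms)
  then show ?thesis by (simp add: case_prod_unfold)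
qed

lemma mode_smooth: "smooth_on UNIV (mode c n)"
  using smooth_on_real_family[of UNIV "\<lambda>i. fst (mode_derivs c n i)" 0] mode_derivs_deriv by simp

lemma summable_modes:
  assumes "0 \<le> s"
  shows "summable (\<lambda>n. \<bar>mode c n s * (sin (real n * \<alpha>) * sin (real n * x))\<bar>)"
    "\<bar>mode c n s * (sin (real n * \<alpha>) * sin (real n * x))\<bar> \<le> 1 / (real n)\<^sup>2"
proof -
  show b: "\<bar>mode c n s * (sin (real n * \<alpha>) * sin (real n * x))\<bar> \<le> 1 / (real n)\<^sup>2" for n
  proof (cases "n = 0")
    case False
    have "\<bar>sin (real n * \<alpha>) * sin (real n * x)\<bar> \<le> 1 * 1"
      unfolding abs_mult by (intro mult_mono) auto
    then have "\<bar>mode c n s\<bar> * \<bar>sin (real n * \<alpha>) * sin (real n * x)\<bar> \<le> 1 / (real n)\<^sup>2 * 1"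
      using mode_bounds(1)[OF False assms, of c] by (intro mult_mono) auto
    then show ?thesis by (simp add: abs_mult)
  qed simp
  show "summable (\<lambda>n. \<bar>mode c n s * (sin (real n * \<alpha>) * sin (real n * x))\<bar>)"
    by (rule summable_comparison_test'[OF summable_inverse_square, of 0]) (use b in simp)
qed

text \<open>
  Beyond finitely many modes, \<open>mode c n s\<close> splits into a rapidly decaying part, smooth for \<open>s > 0\<close>,
  and a function of \<open>1 / n\<^sup>2\<close> whose power series turns the sum over \<open>n\<close> into a sum over \<open>k\<close> of
  products with the tails \<open>\<Sum>\<^sub>n sin (n * \<alpha>) * sin (n * x) / n ^ (2 * k + 2)\<close>.  These are smooth for
  \<open>x > \<alpha>\<close>, and their derivatives are \<open>O(N ^ (- 2 * k))\<close>.
\<close>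

lemma mode_series_smooth:
  assumes c: "c > 0" and \<alpha>: "0 < \<alpha>" "\<alpha> < pi"
  shows "smooth_on ({0<..<T} \<times> {\<alpha><..<pi}) (\<lambda>(s, x). \<Sum>n. mode c n s * (sin (real n * \<alpha>) * sin (real n * x)))"
proof -
  let ?J = "{\<alpha><..<pi}"
  define b where "b n x = sin (real n * \<alpha>) * sin (real n * x)" for n x
  define \<sigma> where "\<sigma> n = sqrt (1 - 4 * c\<^sup>2 * (1 / (real n)\<^sup>2))" for n
  define \<mu> where "\<mu> n = - (real n)\<^sup>2 * (1 + \<sigma> n) / 2" for n
  define \<kappa> where "\<kappa> n s = exp (- 2 * c\<^sup>2 / (1 + \<sigma> n) * s) / \<sigma> n" for n s
  \<comment> \<open>\<open>N > 2 * c\<close> makes the roots real and distinct for all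
    \<open>n \<ge> N\<close> and places \<open>1 / N\<^sup>2\<close> inside the disc of
    analyticity.\<close>
  obtain N where N: "1 \<le> N" "2 * c < real N"
  proof -
    obtain m where "2 * c < real m" using reals_Archimedean2 by blast
    then show ?thesis using c by (intro that[of m]) (auto intro: Suc_leI gr0I)
  qed
  have Nc: "4 * c\<^sup>2 < (real n)\<^sup>2" if "n \<ge> N" for n
  proof -
    have "(2 * c)\<^sup>2 < (real n)\<^sup>2" using N that c by (intro power_strict_mono) auto
    then show ?thesis by (simp add: power_mult_distrib)
  qed
  have y: "1 / (real n)\<^sup>2 \<le> 1 / (real N)\<^sup>2" if "n \<ge> N" for n
    using N that by (intro divide_left_mono power_mono) auto
  have yN: "1 / (real N)\<^sup>2 < 1 / (4 * c\<^sup>2)"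
    using Nc[of N] N c by (intro divide_strict_left_mono) auto
  \<comment> \<open>With a radius strictly in between, the Cauchy bound \<open>B / r ^ k\<close>
    times the tail bound \<open>C / N ^ (2 * k)\<close> is geometric with ratio
    \<open>1 / (r * N\<^sup>2) < 1\<close>.\<close>
  then obtain r where r: "1 / (real N)\<^sup>2 < r" "r < 1 / (4 * c\<^sup>2)" using dense by blast
  have r0: "r > 0" using r(1) by (rule le_less_trans[rotated]) simp
  obtain A :: "nat \<Rightarrow> nat \<Rightarrow> real \<Rightarrow> real" where
    A: "\<And>k i s. (A k i has_real_derivative A k (Suc i) s) (at s)"
      "\<And>i S. \<exists>B. \<forall>k s. \<bar>s\<bar> \<le> S \<longrightarrow> \<bar>A k i s\<bar> \<le> B / r ^ k"
      "\<And>s y. 0 \<le> y \<Longrightarrow> y < 1 / (4 * c\<^sup>2) \<Longrightarrow> (\<lambda>k. A k 0 s * y ^ k) sums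
         (exp (- 2 * c\<^sup>2 / (1 + sqrt (1 - 4 * c\<^sup>2 * y)) * s) / sqrt (1 - 4 * c\<^sup>2 * y))"
    using slow_branch_expansion[OF c r0 r(2)] by blast
  have geo: "summable (\<lambda>k. B / r ^ k * (C / ((real N)\<^sup>2) ^ k))" for B C
  proof -
    have "\<bar>1 / (r * (real N)\<^sup>2)\<bar> < 1" using r r0 N by (simp add: field_simps)
    then have "summable (\<lambda>k. (B * C) * (1 / (r * (real N)\<^sup>2)) ^ k)"
      by (intro summable_mult summable_geometric) simp
    then show ?thesis by (simp add: power_divide power_mult_distrib field_simps)
  qed
  have slow: "smooth_on ({0<..<T} \<times> ?J) (\<lambda>(s, x). \<Sum>k. A k 0 s * green_tail \<alpha> N k 0 x)"
  proof (rule smooth_on_product_series)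
    show "\<exists>M. summable M \<and> (\<forall>k. \<forall>s\<in>{0<..<T}. \<forall>x\<in>?J. \<bar>A k i s * green_tail \<alpha> N k j x\<bar> \<le> M k)" for i j
    proof -
      obtain B where B: "\<And>k s. \<bar>s\<bar> \<le> T \<Longrightarrow> \<bar>A k i s\<bar> \<le> B / r ^ k" using A(2) by blast
      obtain C where C: "\<And>k x. x \<in> ?J \<Longrightarrow> \<bar>green_tail \<alpha> N k j x\<bar> \<le> C / ((real N)\<^sup>2) ^ k"
        using green_tail_bound[OF \<alpha> N(1)] by blast
      show ?thesis
      proof (intro exI conjI allI ballI)
        fix k s x assume "s \<in> {0<..<T}" "x \<in> ?J"
        then have "\<bar>A k i s\<bar> \<le> B / r ^ k" "\<bar>green_tail \<alpha> N k j x\<bar> \<le> C / ((real N)\<^sup>2) ^ k"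
          using B C by auto
        then show "\<bar>A k i s * green_tail \<alpha> N k j x\<bar> \<le> B / r ^ k * (C / ((real N)\<^sup>2) ^ k)"
          unfolding abs_mult by (intro mult_mono) auto
      qed (rule geo)
    qed
  qed (auto intro: A green_tail_deriv[OF \<alpha> N(1)])
  \<comment> \<open>The sums over \<open>n\<close> and \<open>k\<close> may be exchanged because the
    terms are dominated by a geometric sequence in \<open>k\<close> times
    \<open>1 / n\<^sup>2\<close>.\<close>
  have slow_eq: "(\<Sum>n. if n < N then 0 else \<kappa> n s / (real n)\<^sup>2 * b n x) = (\<Sum>k. A k 0 s * green_tail \<alpha> N k 0 x)"
    if x: "x \<in> ?J" for s x
  proof -
    let ?F = "\<lambda>k n. if n < N then 0 else A k 0 s * (b n x / real n ^ (2 * k + 2))"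
    obtain B where B: "\<And>k. \<bar>A k 0 s\<bar> \<le> B / r ^ k" using A(2)[of "\<bar>s\<bar>" 0] by blast
    have swap: "(\<Sum>k. \<Sum>n. ?F k n) = (\<Sum>n. \<Sum>k. ?F k n)"
    proof (rule suminf_swap[OF _ geo[of B 1] summable_inverse_square])
      fix k n
      have "\<bar>?F k n\<bar> = \<bar>A k 0 s\<bar> * \<bar>if n < N then 0 else sin (real n * \<alpha>) * sin (real n * x) / real n ^ (2 * k + 2)\<bar>"
        by (simp add: abs_mult b_def)
      also have "\<dots> \<le> B / r ^ k * (1 / real N ^ (2 * k) * (1 / (real n)\<^sup>2))"
        using B[of k] order_trans[OF abs_ge_zero B[of k]] by (intro mult_mono tail_term_bound N abs_sin_le_one) auto
      finally show "\<bar>?F k n\<bar> \<le> B / r ^ k * (1 / ((real N)\<^sup>2) ^ k) * (1 / (real n)\<^sup>2)"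
        by (simp add: power_mult mult.assoc)
    qed
    have sum_k: "(\<Sum>k. ?F k n) = (if n < N then 0 else \<kappa> n s / (real n)\<^sup>2 * b n x)" for n
    proof (cases "n < N")
      case False
      have "(\<lambda>k. A k 0 s * (1 / (real n)\<^sup>2) ^ k) sums \<kappa> n s"
        unfolding \<kappa>_def \<sigma>_def using A(3)[of "1 / (real n)\<^sup>2" s] y[of n] yN False by simp
      note * = sums_mult2[OF this, of "b n x / (real n)\<^sup>2"]
      have "real n ^ (2 * k + 2) = ((real n)\<^sup>2) ^ k * (real n)\<^sup>2" for k by (simp only: power_add power_mult)
      with *
      have "(\<lambda>k. A k 0 s * (b n x / real n ^ (2 * k + 2))) sums (\<kappa> n s / (real n)\<^sup>2 * b n x)"
        by (simp add: power_divide mult_ac)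
      then show ?thesis using False by (simp add: sums_iff)
    qed simp
    have sum_n: "(\<Sum>n. ?F k n) = A k 0 s * green_tail \<alpha> N k 0 x" for k
    proof -
      have "summable (\<lambda>n. if n < N then 0 else b n x / real n ^ (2 * k + 2))"
      proof (rule summable_comparison_test'[OF summable_mult[OF summable_inverse_square, of "1 / real N ^ (2 * k)"], of 0])
        show "norm (if n < N then 0 else b n x / real n ^ (2 * k + 2)) \<le> 1 / real N ^ (2 * k) * (1 / (real n)\<^sup>2)" for n
          unfolding real_norm_def b_def by (intro tail_term_bound N abs_sin_le_one)
      qed
      from suminf_mult[OF this, of "A k 0 s"] show ?thesis
        unfolding green_tail_eq_sin_tail[OF \<alpha> x] sin_tail_def b_def by (simp add: if_distrib[of "(*) _"] cong: if_cong)
    qed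
    show ?thesis using swap by (simp only: sum_k sum_n)
  qed
  have \<sigma>: "0 < \<sigma> N" "\<sigma> N \<le> \<sigma> n" "\<sigma> n \<le> 1" if "n \<ge> N" for n
  proof -
    show "0 < \<sigma> N" unfolding \<sigma>_def using Nc[of N] N by (simp add: field_simps)
    show "\<sigma> N \<le> \<sigma> n" unfolding \<sigma>_def
      using y[OF that] by (intro real_sqrt_le_mono diff_left_mono mult_left_mono) auto
    show "\<sigma> n \<le> 1" unfolding \<sigma>_def by simp
  qed
  define u where "u n i s = (if n < N then 0 else \<mu> n ^ i * exp (\<mu> n * s) / ((real n)\<^sup>2 * \<sigma> n))" for n i s
  define v where "v n j x = sin (real n * \<alpha>) * (real n ^ j * sin (real n * x + real j * pi / 2))" for n j x
  \<comment> \<open>The fast root satisfies \<open>\<mu> n \<le> - n\<^sup>2 / 2\<close> and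
    \<open>\<bar>\<mu> n\<bar> \<le> n\<^sup>2\<close>. For positive \<epsilon> even the weaker
    decay \<open>exp (- \<epsilon> * n / 2)\<close> absorbs every power of \<open>n\<close> that
    derivatives produce.\<close>
  have ub: "\<bar>u n i s\<bar> \<le> 1 / \<sigma> N * (real n ^ (2 * i) * exp (- (\<epsilon> / 2) * real n))" if "s \<ge> \<epsilon>" "\<epsilon> \<ge> 0" for n i s \<epsilon>
  proof (cases "n < N")
    case False
    then have n: "real n \<ge> 1" "n \<ge> N" using N by auto
    have s: "0 < \<sigma> N" "\<sigma> N \<le> \<sigma> n" "\<sigma> n \<le> 1" using \<sigma>[OF n(2)] by auto
    have nn: "real n \<le> (real n)\<^sup>2" "1 \<le> (real n)\<^sup>2" using n by (auto simp: power2_eq_square intro: mult_mono[of 1 "real n" 1 "real n", simplified])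
    have m1: "\<mu> n \<le> - (real n)\<^sup>2 / 2" unfolding \<mu>_def using s by (simp add: field_simps)
    have "\<bar>\<mu> n\<bar> = (real n)\<^sup>2 * ((1 + \<sigma> n) / 2)" unfolding \<mu>_def using s by (simp add: abs_mult)
    also have "\<dots> \<le> (real n)\<^sup>2 * 1" using s by (intro mult_left_mono) auto
    finally have m2: "\<bar>\<mu> n\<bar> ^ i \<le> real n ^ (2 * i)" by (simp add: power_mult power_mono)
    have "\<mu> n * s \<le> - (real n)\<^sup>2 / 2 * s" using m1 that by (intro mult_right_mono) auto
    also have "\<dots> \<le> - (\<epsilon> / 2) * real n"
    proof -
      have "\<epsilon> * real n \<le> s * (real n)\<^sup>2" using that nn by (intro mult_mono) auto
      then show ?thesis by (simp add: mult.commute)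
    qed
    finally have m3: "exp (\<mu> n * s) \<le> exp (- (\<epsilon> / 2) * real n)" by simp
    have "\<sigma> N \<le> (real n)\<^sup>2 * \<sigma> n" using s nn mult_mono[of 1 "(real n)\<^sup>2" "\<sigma> N" "\<sigma> n"] by simp
    then have m4: "1 / ((real n)\<^sup>2 * \<sigma> n) \<le> 1 / \<sigma> N" using s by (intro divide_left_mono) auto
    have "\<bar>u n i s\<bar> = 1 / ((real n)\<^sup>2 * \<sigma> n) * (\<bar>\<mu> n\<bar> ^ i * exp (\<mu> n * s))"
      using False s by (simp add: u_def abs_mult abs_divide power_abs)
    also have "\<dots> \<le> 1 / \<sigma> N * (real n ^ (2 * i) * exp (- (\<epsilon> / 2) * real n))"
      using s by (intro mult_mono m2 m3 m4) auto
    finally show ?thesis .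
  qed (use \<sigma>[of N] in \<open>simp add: u_def\<close>)
  have vb: "\<bar>v n j x\<bar> \<le> real n ^ j" for n j x
  proof -
    have "\<bar>sin (real n * \<alpha>)\<bar> * (\<bar>real n ^ j\<bar> * \<bar>sin (real n * x + real j * pi / 2)\<bar>) \<le> 1 * (real n ^ j * 1)"
      by (intro mult_mono) auto
    then show ?thesis by (simp only: v_def abs_mult mult_1 mult_1_right)
  qed
  have fast_local: "smooth_on ({\<epsilon><..<T} \<times> ?J) (\<lambda>(s, x). \<Sum>n. u n 0 s * v n 0 x)" if \<epsilon>: "\<epsilon> > 0" for \<epsilon>
  proof (rule smooth_on_product_series)
    show "\<exists>M. summable M \<and> (\<forall>n. \<forall>s\<in>{\<epsilon><..<T}. \<forall>x\<in>?J. \<bar>u n i s * v n j x\<bar> \<le> M n)" for i j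
    proof (intro exI conjI allI ballI)
      show "summable (\<lambda>n. 1 / \<sigma> N * (real n ^ (2 * i + j) * exp (- (\<epsilon> / 2) * real n)))"
        using \<epsilon> by (intro summable_mult summable_power_mult_exp) simp
      fix n s x assume "s \<in> {\<epsilon><..<T}"
      then have "\<bar>u n i s\<bar> * \<bar>v n j x\<bar> \<le> (1 / \<sigma> N * (real n ^ (2 * i) * exp (- (\<epsilon> / 2) * real n))) * real n ^ j"
        using \<epsilon> \<sigma>[of N] by (intro mult_mono ub vb) auto
      then show "\<bar>u n i s * v n j x\<bar> \<le> 1 / \<sigma> N * (real n ^ (2 * i + j) * exp (- (\<epsilon> / 2) * real n))"
        by (simp add: abs_mult power_add mult_ac)
    qed
    show "(u n i has_real_derivative u n (Suc i) s) (at s)" for n i s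
    proof (cases "n < N")
      case False
      have "((\<lambda>s. \<mu> n ^ i * exp (\<mu> n * s)) has_real_derivative \<mu> n ^ Suc i * exp (\<mu> n * s)) (at s)"
        by (auto intro!: derivative_eq_intros)
      from DERIV_cdivide[OF this, of "(real n)\<^sup>2 * \<sigma> n"] show ?thesis
        using False by (simp add: u_def[abs_def])
    qed (simp add: u_def[abs_def])
    show "(v n j has_real_derivative v n (Suc j) x) (at x)" for n j x
      unfolding v_def[abs_def] by (intro DERIV_cmult sin_mult_deriv)
  qed auto
  have fast: "smooth_on ({0<..<T} \<times> ?J) (\<lambda>(s, x). \<Sum>n. u n 0 s * v n 0 x)"
  proof (rule smooth_on_locally)
    fix p assume p: "p \<in> {0<..<T} \<times> ?J"
    \<comment> \<open>The estimates for the fast part degenerate at \<open>s = 0\<close>, but each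
      point keeps a distance from it; half its first coordinate serves as \<epsilon>.\<close>
    show "\<exists>U. open U \<and> p \<in> U \<and> smooth_on U (\<lambda>(s, x). \<Sum>n. u n 0 s * v n 0 x)"
      using p by (intro exI[of _ "{fst p / 2<..<T} \<times> ?J"]) (auto intro!: open_Times fast_local)
  qed
  have low: "smooth_on ({0<..<T} \<times> ?J) (\<lambda>p. \<Sum>n<N. (\<lambda>(s, x). mode c n s * (sin (real n * \<alpha>) * sin (real n * x))) p)"
  proof (intro smooth_on_sum open_Times smooth_on_fst_snd_mult)
    show "smooth_on {0<..<T} (mode c n)" "smooth_on ?J (\<lambda>x. sin (real n * \<alpha>) * sin (real n * x))" for n
      by (auto intro!: smooth_on_mult smooth_on_const smooth_on_subset[OF mode_smooth] smooth_on_subset[OF smooth_on_sin])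
  qed auto
  have eq: "(\<Sum>n. mode c n s * b n x) = (\<Sum>n<N. mode c n s * b n x)
      + ((\<Sum>k. A k 0 s * green_tail \<alpha> N k 0 x) + (- 1) * (\<Sum>n. u n 0 s * v n 0 x))"
    if s: "s \<in> {0<..<T}" and x: "x \<in> ?J" for s x
  proof -
    have sm: "summable (\<lambda>n. mode c n s * b n x)"
      unfolding b_def by (rule summable_rabs_cancel[OF summable_modes(1)]) (use s in simp)
    have su: "summable (\<lambda>n. u n 0 s * v n 0 x)"
    proof (rule summable_comparison_test'[OF summable_mult[OF summable_power_mult_exp[of "s / 2" 0], of "1 / \<sigma> N"], of 0])
      show "norm (u n 0 s * v n 0 x) \<le> 1 / \<sigma> N * (real n ^ 0 * exp (- (s / 2) * real n))" for n
      proof -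
        have "\<bar>u n 0 s\<bar> * \<bar>v n 0 x\<bar> \<le> (1 / \<sigma> N * (real n ^ (2 * 0) * exp (- (s / 2) * real n))) * real n ^ 0"
          using s \<sigma>[of N] by (intro mult_mono ub vb) auto
        then show ?thesis by (simp add: abs_mult)
      qed
    qed (use s in auto)
    have "(\<Sum>n. if n < N then 0 else \<kappa> n s / (real n)\<^sup>2 * b n x)
      = (\<Sum>n. (if n < N then 0 else mode c n s * b n x) + u n 0 s * v n 0 x)"
    proof (intro suminf_cong)
      fix n
      show "(if n < N then 0 else \<kappa> n s / (real n)\<^sup>2 * b n x) = (if n < N then 0 else mode c n s * b n x) + u n 0 s * v n 0 x"
      proof (cases "n < N")
        case False
        then have "n \<noteq> 0" "\<sigma> n > 0" using N(1) \<sigma>(1,2)[of n] by auto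
        then show ?thesis
          using mode_split[OF Nc, of n s] False
          by (simp add: u_def v_def b_def \<kappa>_def \<mu>_def \<sigma>_def left_diff_distrib)
      qed (simp add: u_def)
    qed
    also have "\<dots> = (\<Sum>n. if n < N then 0 else mode c n s * b n x) + (\<Sum>n. u n 0 s * v n 0 x)"
      by (intro suminf_add[symmetric] suminf_tail(2) sm su)
    finally show ?thesis using suminf_tail(1)[OF sm, of N] slow_eq[OF x, of s] by simp
  qed
  have op: "open ({0<..<T} \<times> ?J)" by (intro open_Times) auto
  have "smooth_on ({0<..<T} \<times> ?J) (\<lambda>p. (\<Sum>n<N. (\<lambda>(s, x). mode c n s * (sin (real n * \<alpha>) * sin (real n * x))) p)
     + ((\<lambda>(s, x). \<Sum>k. A k 0 s * green_tail \<alpha> N k 0 x) p + (- 1) * (\<lambda>(s, x). \<Sum>n. u n 0 s * v n 0 x) p))"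
    by (intro smooth_on_add smooth_on_mult smooth_on_const op low slow fast)
  then show ?thesis
    by (rule smooth_on_cong[OF op, THEN iffD1, rotated]) (use eq in \<open>auto simp: b_def\<close>)
qed

section \<open>Unique continuation by the Laplace transform\<close>

lemma laplace_mode:
  assumes n: "n \<noteq> 0" and p: "p > 0" and T: "T \<ge> 0"
  shows "(LINT s:{0<..<T}|lborel. exp (- p * s) * mode c n s)
    = (1 - exp (- p * T) * (mode' c n T + (p + (real n)\<^sup>2) * mode c n T)) / (p\<^sup>2 + p * (real n)\<^sup>2 + c\<^sup>2 * (real n)\<^sup>2)"
proof -
  let ?N = "(real n)\<^sup>2"
  define D where "D = p\<^sup>2 + p * ?N + c\<^sup>2 * ?N"
  have D: "D > 0" unfolding D_def using n p by (intro add_pos_nonneg) auto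
  \<comment> \<open>Two integrations by parts against \<open>exp (- p * s)\<close> lead to this
    antiderivative up to the factor \<open>- D\<close>, where \<open>D\<close> is the characteristic
    polynomial of the mode evaluated at \<open>p\<close>.\<close>
  define H where "H s = exp (- p * s) * (mode' c n s + (p + ?N) * mode c n s)" for s
  have H: "(H has_real_derivative - D * (exp (- p * s) * mode c n s)) (at s)" for s
  proof -
    have "((\<lambda>s. exp (- p * s)) has_real_derivative - p * exp (- p * s)) (at s)"
      by (auto intro!: derivative_eq_intros)
    moreover have "((\<lambda>s. mode' c n s + (p + ?N) * mode c n s) has_real_derivative
        (- ?N * mode' c n s - c\<^sup>2 * ?N * mode c n s) + (p + ?N) * mode' c n s) (at s)"
      by (intro DERIV_add DERIV_cmult mode_deriv)
    ultimately have "(H has_real_derivative - p * exp (- p * s) * (mode' c n s + (p + ?N) * mode c n s)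
      + ((- ?N * mode' c n s - c\<^sup>2 * ?N * mode c n s) + (p + ?N) * mode' c n s) * exp (- p * s)) (at s)"
      unfolding H_def by (rule DERIV_mult)
    then show ?thesis by (rule DERIV_cong) (simp add: D_def algebra_simps power2_eq_square)
  qed
  have "(LINT s:{0<..<T}|lborel. exp (- p * s) * mode c n s) = - H T / D - (- H 0 / D)"
  proof (rule set_integral_FTC_open[OF T])
    show "((\<lambda>s. - H s / D) has_real_derivative exp (- p * s) * mode c n s) (at s within {0..T})" for s
      using DERIV_cdivide[OF DERIV_minus[OF H], of D] D by (auto intro: has_field_derivative_at_within)
    show "continuous_on {0..T} (\<lambda>s. exp (- p * s) * mode c n s)"
      by (intro continuous_intros continuous_at_imp_continuous_on ballI DERIV_isCont[OF mode_deriv(1)])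
  qed
  also have "\<dots> = (1 - H T) / D" by (simp add: H_def diff_divide_distrib)
  finally show ?thesis by (simp add: H_def D_def)
qed

text \<open>
  If the series vanishes on \<open>(0, T)\<close>, its Laplace transform over \<open>(0, T)\<close> vanishes; up to boundary
  terms at \<open>T\<close> of size \<open>exp (- p * T)\<close> this is the series of a Green function with
  \<open>K = p\<^sup>2 / (p + c\<^sup>2)\<close>.
\<close>

lemma vanishing_mode_series_laplace:
  assumes c: "c > 0" and p: "p > 0" and T: "T > 0"
    and \<beta>: "\<And>n. \<bar>\<beta> n\<bar> \<le> B" "\<beta> 0 = 0"
    and z: "\<And>s. s \<in> {0<..<T} \<Longrightarrow> (\<Sum>n. mode c n s * \<beta> n) = 0"
  shows "\<bar>\<Sum>n. \<beta> n / ((real n)\<^sup>2 + p\<^sup>2 / (p + c\<^sup>2))\<bar>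
    \<le> (p + c\<^sup>2) * (exp (- p * T) * (B * (3 + p) / p * (\<Sum>n. 1 / (real n)\<^sup>2)))"
proof -
  have B: "B \<ge> 0" using \<beta>(1)[of 0] by linarith
  define D where "D n = p\<^sup>2 + p * (real n)\<^sup>2 + c\<^sup>2 * (real n)\<^sup>2" for n
  define R where "R n = mode' c n T + (p + (real n)\<^sup>2) * mode c n T" for n
  have D: "D n > 0" "p * (real n)\<^sup>2 \<le> D n" for n
    unfolding D_def using p by (auto intro!: add_pos_nonneg)
  \<comment> \<open>The bounds on \<open>mode'\<close> and on \<open>n\<^sup>2 * mode\<close> keep
    the boundary terms bounded in \<open>n\<close>, so that division by
    \<open>D n \<ge> p * n\<^sup>2\<close> leaves a summable remainder.\<close>
  have R: "\<bar>R n\<bar> \<le> 3 + p" if "n \<noteq> 0" for n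
  proof -
    have N: "(real n)\<^sup>2 \<ge> 1" using that by (simp add: one_le_power)
    have "(p + (real n)\<^sup>2) * \<bar>mode c n T\<bar> \<le> (p + (real n)\<^sup>2) * (1 / (real n)\<^sup>2)"
      using mode_bounds(1)[OF that, of T c] T p by (intro mult_left_mono) auto
    also have "\<dots> = p * (1 / (real n)\<^sup>2) + 1" using that by (simp add: field_simps)
    also have "\<dots> \<le> p * 1 + 1" using N p by (intro add_mono mult_left_mono) (auto simp: divide_le_eq)
    finally have "\<bar>(p + (real n)\<^sup>2) * mode c n T\<bar> \<le> p + 1" using p by (simp add: abs_mult)
    then show ?thesis using mode_bounds(2)[OF that, of T c] T unfolding R_def by linarith
  qed
  let ?f = "\<lambda>n s. indicator {0<..<T} s * (exp (- p * s) * (mode c n s * \<beta> n))"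
  have fb: "\<bar>?f n s\<bar> \<le> indicator {0<..<T} s * (B * (1 / (real n)\<^sup>2))" for n s
  proof (cases "n = 0 \<or> s \<notin> {0<..<T}")
    case False
    then have n: "n \<noteq> 0" and s: "s \<in> {0<..<T}" by auto
    have "exp (- p * s) * (\<bar>mode c n s\<bar> * \<bar>\<beta> n\<bar>) \<le> 1 * (1 / (real n)\<^sup>2 * B)"
      using mode_bounds(1)[OF n, of s c] s p \<beta>(1)[of n] by (intro mult_mono) auto
    then show ?thesis using s by (simp add: abs_mult)
  qed (use \<beta> B in auto)
  have sB: "summable (\<lambda>n. B * (1 / (real n)\<^sup>2))" by (intro summable_mult summable_inverse_square)
  have cm: "continuous_on UNIV (\<lambda>s. exp (- p * s) * (mode c n s * \<beta> n))" for n
    by (intro continuous_intros continuous_at_imp_continuous_on ballI DERIV_isCont[OF mode_deriv(1)])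
  have fi: "integrable lborel (?f n)" for n
  proof -
    have "set_integrable lborel {0<..<T} (\<lambda>s. exp (- p * s) * (mode c n s * \<beta> n))"
      by (rule set_integrable_subset[OF borel_integrable_atLeastAtMost'[OF continuous_on_subset[OF cm subset_UNIV], of 0 T]]) auto
    then show ?thesis by (simp add: set_integrable_def)
  qed
  have ii: "integrable lborel (\<lambda>s. indicator {0<..<T} s * C)" for C :: real
    using T by (intro integrable_mult_left integrable_real_indicator) auto
  have "(\<lambda>n. LINT s|lborel. ?f n s) sums (LINT s|lborel. (\<Sum>n. ?f n s))"
  proof (rule sums_integral[OF fi])
    have "summable (\<lambda>n. norm (?f n s))" for s
      by (rule summable_comparison_test'[OF summable_mult[OF sB, of "indicator {0<..<T} s"], of 0]) (use fb in simp)
    then show "AE s in lborel. summable (\<lambda>n. norm (?f n s))" by simp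
    show "summable (\<lambda>n. LINT s|lborel. norm (?f n s))"
    proof (rule summable_comparison_test'[OF summable_mult[OF sB, of T], of 0])
      fix n :: nat
      have "(LINT s|lborel. norm (?f n s)) \<le> (LINT s|lborel. indicator {0<..<T} s * (B * (1 / (real n)\<^sup>2)))"
        by (rule integral_mono[OF integrable_norm[OF fi] ii]) (use fb in simp)
      also have "\<dots> = T * (B * (1 / (real n)\<^sup>2))" using T by simp
      finally show "norm (LINT s|lborel. norm (?f n s)) \<le> T * (B * (1 / (real n)\<^sup>2))" by simp
    qed
  qed
  also have "(\<lambda>s. (\<Sum>n. ?f n s)) = (\<lambda>s. 0)"
  proof
    fix s
    show "(\<Sum>n. ?f n s) = 0"
    proof (cases "s \<in> {0<..<T}")
      case True
      have "summable (\<lambda>n. \<bar>exp (- p * s) * (mode c n s * \<beta> n)\<bar>)"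
        by (rule summable_comparison_test'[OF sB, of 0]) (use fb[where s = s] True in simp)
      then have "summable (\<lambda>n. exp (- p * s) * (mode c n s * \<beta> n))" by (rule summable_rabs_cancel)
      then have "summable (\<lambda>n. mode c n s * \<beta> n)" by (subst (asm) summable_cmult_iff) auto
      from suminf_mult[OF this, of "exp (- p * s)"] show ?thesis using True z[OF True] by simp
    qed simp
  qed
  also have "(\<lambda>n. LINT s|lborel. ?f n s) = (\<lambda>n. \<beta> n / D n - exp (- p * T) * (\<beta> n * R n / D n))"
  proof
    fix n
    show "(LINT s|lborel. ?f n s) = \<beta> n / D n - exp (- p * T) * (\<beta> n * R n / D n)"
    proof (cases "n = 0")
      case False
      have "(LINT s|lborel. ?f n s) = (LINT s|lborel. \<beta> n * (indicator {0<..<T} s *\<^sub>R (exp (- p * s) * mode c n s)))"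
        by (simp add: algebra_simps)
      also have "\<dots> = \<beta> n * (LINT s:{0<..<T}|lborel. exp (- p * s) * mode c n s)"
        by (simp add: set_lebesgue_integral_def)
      also have "\<dots> = \<beta> n * ((1 - exp (- p * T) * R n) / D n)"
        using laplace_mode[OF False p, of T c] T by (simp add: R_def D_def)
      finally show ?thesis by (simp add: diff_divide_distrib right_diff_distrib mult.left_commute)
    qed (use \<beta> in simp)
  qed
  finally have S0: "(\<lambda>n. \<beta> n / D n - exp (- p * T) * (\<beta> n * R n / D n)) sums 0" by simp
  have RD: "\<bar>\<beta> n * R n / D n\<bar> \<le> B * (3 + p) / p * (1 / (real n)\<^sup>2)" for n
  proof (cases "n = 0")
    case False
    have "\<bar>\<beta> n\<bar> * \<bar>R n\<bar> / D n \<le> B * (3 + p) / (p * (real n)\<^sup>2)"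
      using \<beta>(1)[of n] R[OF False] D[of n] p False B by (intro frac_le mult_mono) auto
    then show ?thesis using D(1)[of n] by (simp add: abs_mult abs_divide)
  qed (use \<beta> in simp)
  have sS: "summable (\<lambda>n. B * (3 + p) / p * (1 / (real n)\<^sup>2))" by (intro summable_mult summable_inverse_square)
  have sR: "summable (\<lambda>n. \<bar>\<beta> n * R n / D n\<bar>)"
    by (rule summable_comparison_test'[OF sS, of 0]) (use RD in simp)
  have "(\<lambda>n. \<beta> n / D n) sums (0 + exp (- p * T) * (\<Sum>n. \<beta> n * R n / D n))"
    using sums_add[OF S0 sums_mult[OF summable_sums[OF summable_rabs_cancel[OF sR]], of "exp (- p * T)"]] by simp
  then have bD: "(\<lambda>n. \<beta> n / D n) sums (exp (- p * T) * (\<Sum>n. \<beta> n * R n / D n))" by simp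
  have pc: "p + c\<^sup>2 > 0" using p by (simp add: add_pos_nonneg)
  \<comment> \<open>Factoring \<open>p + c\<^sup>2\<close> out of \<open>D n\<close> leaves
    \<open>n\<^sup>2 + K\<close>, the eigenvalue of \<open>- u'' + K u\<close> on
    \<open>sin (n * x)\<close>. This is the origin of \<open>K\<close>.\<close>
  have Dk: "\<beta> n / ((real n)\<^sup>2 + p\<^sup>2 / (p + c\<^sup>2)) = (p + c\<^sup>2) * (\<beta> n / D n)" for n
  proof -
    have "D n = (p + c\<^sup>2) * ((real n)\<^sup>2 + p\<^sup>2 / (p + c\<^sup>2))"
      unfolding D_def using pc by (simp add: field_simps)
    then show ?thesis using pc by simp
  qed
  have "(\<Sum>n. \<beta> n / ((real n)\<^sup>2 + p\<^sup>2 / (p + c\<^sup>2))) = (p + c\<^sup>2) * (exp (- p * T) * (\<Sum>n. \<beta> n * R n / D n))"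
    unfolding Dk using sums_mult[OF bD, of "p + c\<^sup>2"] by (simp add: sums_iff)
  also have "\<bar>\<dots>\<bar> = (p + c\<^sup>2) * (exp (- p * T) * \<bar>\<Sum>n. \<beta> n * R n / D n\<bar>)"
    using pc by (simp add: abs_mult)
  also have "\<dots> \<le> (p + c\<^sup>2) * (exp (- p * T) * (B * (3 + p) / p * (\<Sum>n. 1 / (real n)\<^sup>2)))"
  proof (intro mult_left_mono)
    have "\<bar>\<Sum>n. \<beta> n * R n / D n\<bar> \<le> (\<Sum>n. \<bar>\<beta> n * R n / D n\<bar>)" by (rule summable_rabs[OF sR])
    also have "\<dots> \<le> (\<Sum>n. B * (3 + p) / p * (1 / (real n)\<^sup>2))" by (intro suminf_le RD sR sS)
    also have "\<dots> = B * (3 + p) / p * (\<Sum>n. 1 / (real n)\<^sup>2)" by (rule suminf_mult[OF summable_inverse_square])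
    finally show "\<bar>\<Sum>n. \<beta> n * R n / D n\<bar> \<le> B * (3 + p) / p * (\<Sum>n. 1 / (real n)\<^sup>2)" .
  qed (use pc in auto)
  finally show ?thesis .
qed

text \<open>The branches are the multiples of \<open>sinh (k * x)\<close> and
  \<open>sinh (k * (pi - x))\<close> that agree at \<alpha>. The unit jump of the derivative is the
  addition theorem for \<open>sinh\<close> at
  \<open>k * (pi - \<alpha>) + k * \<alpha> = k * pi\<close>.\<close>

lemma green_function_sinh:
  assumes k: "k > 0" and \<alpha>: "0 < \<alpha>" "\<alpha> < pi" and x: "x \<in> {\<alpha><..<pi}"
  shows "sinh (k * \<alpha>) * sinh (k * (pi - x)) / (k * sinh (k * pi))
    = 2 / pi * (\<Sum>n. sin (real n * \<alpha>) / ((real n)\<^sup>2 + k\<^sup>2) * sin (real n * x))"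
proof (rule green_function_sine_series[where A = "\<lambda>x. sinh (k * (pi - \<alpha>)) * sinh (k * x) / (k * sinh (k * pi))"
      and A' = "\<lambda>x. sinh (k * (pi - \<alpha>)) * cosh (k * x) / sinh (k * pi)"
      and B' = "\<lambda>x. - sinh (k * \<alpha>) * cosh (k * (pi - x)) / sinh (k * pi)"
      and B = "\<lambda>x. sinh (k * \<alpha>) * sinh (k * (pi - x)) / (k * sinh (k * pi))", OF _ \<alpha> _ _ _ _ _ _ _ _ x])
  have s: "sinh (k * pi) \<noteq> 0" using k by simp
  have "sinh (k * (pi - \<alpha>)) * cosh (k * \<alpha>) + cosh (k * (pi - \<alpha>)) * sinh (k * \<alpha>) = sinh (k * (pi - \<alpha>) + k * \<alpha>)"
    by (simp only: sinh_add)
  also have "\<dots> = sinh (k * pi)" by (simp add: algebra_simps)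
  finally have e: "sinh (k * (pi - \<alpha>)) * cosh (k * \<alpha>) + cosh (k * (pi - \<alpha>)) * sinh (k * \<alpha>) = sinh (k * pi)" .
  have "sinh (k * (pi - \<alpha>)) * cosh (k * \<alpha>) / sinh (k * pi) - - sinh (k * \<alpha>) * cosh (k * (pi - \<alpha>)) / sinh (k * pi)
    = (sinh (k * (pi - \<alpha>)) * cosh (k * \<alpha>) + cosh (k * (pi - \<alpha>)) * sinh (k * \<alpha>)) / sinh (k * pi)"
    by (simp add: add_divide_distrib mult.commute)
  then show "sinh (k * (pi - \<alpha>)) * cosh (k * \<alpha>) / sinh (k * pi) - - sinh (k * \<alpha>) * cosh (k * (pi - \<alpha>)) / sinh (k * pi) = 1"
    unfolding e using s by simp
  have sh: "((\<lambda>x. sinh (k * x)) has_real_derivative k * cosh (k * x)) (at x)"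
    "((\<lambda>x. cosh (k * x)) has_real_derivative k * sinh (k * x)) (at x)"
    "((\<lambda>x. sinh (k * (pi - x))) has_real_derivative - k * cosh (k * (pi - x))) (at x)"
    "((\<lambda>x. cosh (k * (pi - x))) has_real_derivative - k * sinh (k * (pi - x))) (at x)" for x
    by (auto intro!: derivative_eq_intros)
  show "((\<lambda>x. sinh (k * (pi - \<alpha>)) * sinh (k * x) / (k * sinh (k * pi))) has_real_derivative
      sinh (k * (pi - \<alpha>)) * cosh (k * x) / sinh (k * pi)) (at x)" for x
    by (rule DERIV_cong[OF DERIV_cdivide[OF DERIV_cmult[OF sh(1)]]]) (use k in simp)
  show "((\<lambda>x. sinh (k * (pi - \<alpha>)) * cosh (k * x) / sinh (k * pi)) has_real_derivative
      k\<^sup>2 * (sinh (k * (pi - \<alpha>)) * sinh (k * x) / (k * sinh (k * pi)))) (at x)" for x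
    by (rule DERIV_cong[OF DERIV_cdivide[OF DERIV_cmult[OF sh(2)]]]) (use k in \<open>simp add: power2_eq_square\<close>)
  show "((\<lambda>x. sinh (k * \<alpha>) * sinh (k * (pi - x)) / (k * sinh (k * pi))) has_real_derivative
      - sinh (k * \<alpha>) * cosh (k * (pi - x)) / sinh (k * pi)) (at x)" for x
    by (rule DERIV_cong[OF DERIV_cdivide[OF DERIV_cmult[OF sh(3)]]]) (use k in simp)
  show "((\<lambda>x. - sinh (k * \<alpha>) * cosh (k * (pi - x)) / sinh (k * pi)) has_real_derivative
      k\<^sup>2 * (sinh (k * \<alpha>) * sinh (k * (pi - x)) / (k * sinh (k * pi)))) (at x)" for x
    by (rule DERIV_cong[OF DERIV_cdivide[OF DERIV_cmult[OF sh(4)]]]) (use k in \<open>simp add: power2_eq_square\<close>)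
qed (auto simp: mult.commute)

text \<open>Beyond both sources the two Green functions share the factor
  \<open>sinh (k * (pi - x)) / (k * sinh (k * pi))\<close>, which can be divided out. Only the
  combination \<open>h\<close> is left, so the time dependence at this one \<open>x\<close>
  decides.\<close>

lemma mode_series_independent:
  assumes c: "c > 0" and T: "T > 0" and \<alpha>: "0 < \<alpha>1" "\<alpha>1 < \<alpha>2" and x: "x \<in> {\<alpha>2<..<pi}"
    and z: "\<And>s. s \<in> {0<..<T} \<Longrightarrow>
      a * (\<Sum>n. mode c n s * (sin (real n * \<alpha>1) * sin (real n * x)))
      + b * (\<Sum>n. mode c n s * (sin (real n * \<alpha>2) * sin (real n * x))) = 0"
  shows "a = 0 \<and> b = 0"
proof -
  define \<beta> where "\<beta> n = (a * sin (real n * \<alpha>1) + b * sin (real n * \<alpha>2)) * sin (real n * x)" for n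
  define S where "S = (\<Sum>n. 1 / (real n)\<^sup>2)"
  define B where "B = \<bar>a\<bar> + \<bar>b\<bar>"
  define k where "k p = p / sqrt (p + c\<^sup>2)" for p
  define h where "h y = a * sinh (y * \<alpha>1) + b * sinh (y * \<alpha>2)" for y
  have S: "S \<ge> 0" unfolding S_def by (intro suminf_nonneg summable_inverse_square) auto
  have \<beta>B: "\<bar>\<beta> n\<bar> \<le> B" for n
  proof -
    have "\<bar>a * sin (real n * \<alpha>1)\<bar> \<le> \<bar>a\<bar>" "\<bar>b * sin (real n * \<alpha>2)\<bar> \<le> \<bar>b\<bar>"
      by (simp_all add: abs_mult mult_left_le)
    then have "\<bar>a * sin (real n * \<alpha>1) + b * sin (real n * \<alpha>2)\<bar> \<le> B" unfolding B_def by linarith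
    then have "\<bar>a * sin (real n * \<alpha>1) + b * sin (real n * \<alpha>2)\<bar> * \<bar>sin (real n * x)\<bar> \<le> B * 1"
      by (intro mult_mono) (auto simp: B_def)
    then show ?thesis by (simp add: \<beta>_def abs_mult)
  qed
  have z\<beta>: "(\<Sum>n. mode c n s * \<beta> n) = 0" if "s \<in> {0<..<T}" for s
  proof -
    have sm: "summable (\<lambda>n. mode c n s * (sin (real n * \<alpha>) * sin (real n * x)))" for \<alpha>
      by (rule summable_rabs_cancel[OF summable_modes(1)]) (use that in simp)
    have "(\<lambda>n. a * (mode c n s * (sin (real n * \<alpha>1) * sin (real n * x)))
       + b * (mode c n s * (sin (real n * \<alpha>2) * sin (real n * x)))) sums 0"
      using sums_add[OF sums_mult[OF summable_sums[OF sm[of \<alpha>1]], of a] sums_mult[OF summable_sums[OF sm[of \<alpha>2]], of b]]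
        z[OF that] by simp
    then show ?thesis by (simp add: \<beta>_def sums_iff algebra_simps)
  qed
  have main: "\<bar>h (k p)\<bar> \<le> (k p * sinh (k p * pi)) / sinh (k p * (pi - x)) *
      ((p + c\<^sup>2) * (exp (- p * T) * (B * (3 + p) / p * S)))" if p: "p > 0" for p
  proof -
    have pc: "p + c\<^sup>2 > 0" using p by (simp add: add_pos_nonneg)
    have kp: "k p > 0" "(k p)\<^sup>2 = p\<^sup>2 / (p + c\<^sup>2)" using p pc by (auto simp: k_def power_divide)
    define E where "E = sinh (k p * (pi - x)) / (k p * sinh (k p * pi))"
    have E: "E > 0" unfolding E_def using kp x by (intro divide_pos_pos mult_pos_pos) auto
    have sg: "summable (\<lambda>n. sin (real n * \<alpha>) / ((real n)\<^sup>2 + (k p)\<^sup>2) * sin (real n * x))" for \<alpha>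
    proof (rule summable_comparison_test'[OF summable_inverse_square, of 1])
      fix n :: nat assume "n \<ge> 1"
      have "\<bar>sin (real n * \<alpha>) * sin (real n * x)\<bar> \<le> 1 * 1" unfolding abs_mult by (intro mult_mono) auto
      then have "\<bar>sin (real n * \<alpha>) * sin (real n * x)\<bar> / ((real n)\<^sup>2 + (k p)\<^sup>2) \<le> 1 / (real n)\<^sup>2"
        using \<open>n \<ge> 1\<close> by (intro frac_le) auto
      moreover have "\<bar>(real n)\<^sup>2 + (k p)\<^sup>2\<bar> = (real n)\<^sup>2 + (k p)\<^sup>2" by simp
      ultimately show "norm (sin (real n * \<alpha>) / ((real n)\<^sup>2 + (k p)\<^sup>2) * sin (real n * x)) \<le> 1 / (real n)\<^sup>2"
        by (simp only: real_norm_def abs_divide times_divide_eq_left)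
    qed
    have gr: "sinh (k p * \<alpha>) * E = 2 / pi * (\<Sum>n. sin (real n * \<alpha>) / ((real n)\<^sup>2 + (k p)\<^sup>2) * sin (real n * x))"
      if "\<alpha> \<in> {\<alpha>1, \<alpha>2}" for \<alpha>
      using green_function_sinh[OF kp(1), of \<alpha> x] that \<alpha> x by (auto simp: E_def)
    have "h (k p) * E = a * (sinh (k p * \<alpha>1) * E) + b * (sinh (k p * \<alpha>2) * E)"
      by (simp add: h_def algebra_simps)
    also have "\<dots> = 2 / pi * (a * (\<Sum>n. sin (real n * \<alpha>1) / ((real n)\<^sup>2 + (k p)\<^sup>2) * sin (real n * x))
        + b * (\<Sum>n. sin (real n * \<alpha>2) / ((real n)\<^sup>2 + (k p)\<^sup>2) * sin (real n * x)))"
      unfolding gr[OF insertI1] gr[OF insertI2[OF singletonI]] by (simp only: distrib_left mult_ac)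
    also have "a * (\<Sum>n. sin (real n * \<alpha>1) / ((real n)\<^sup>2 + (k p)\<^sup>2) * sin (real n * x))
        + b * (\<Sum>n. sin (real n * \<alpha>2) / ((real n)\<^sup>2 + (k p)\<^sup>2) * sin (real n * x))
      = (\<Sum>n. \<beta> n / ((real n)\<^sup>2 + (k p)\<^sup>2))"
      using sums_add[OF sums_mult[OF summable_sums[OF sg[of \<alpha>1]], of a] sums_mult[OF summable_sums[OF sg[of \<alpha>2]], of b]]
      by (simp add: sums_iff \<beta>_def distrib_right add_divide_distrib mult.assoc)
    finally have hE: "h (k p) * E = 2 / pi * (\<Sum>n. \<beta> n / ((real n)\<^sup>2 + (k p)\<^sup>2))" .
    have "\<bar>h (k p)\<bar> * E = 2 / pi * \<bar>\<Sum>n. \<beta> n / ((real n)\<^sup>2 + (k p)\<^sup>2)\<bar>"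
      using arg_cong[OF hE, of abs] E by (simp add: abs_mult)
    also have "\<dots> \<le> 1 * \<bar>\<Sum>n. \<beta> n / ((real n)\<^sup>2 + (k p)\<^sup>2)\<bar>"
      using pi_gt3 by (intro mult_right_mono) auto
    also have "\<dots> \<le> (p + c\<^sup>2) * (exp (- p * T) * (B * (3 + p) / p * S))"
      using vanishing_mode_series_laplace[OF c p T \<beta>B _ z\<beta>] unfolding S_def kp(2) by (simp add: \<beta>_def)
    finally have "\<bar>h (k p)\<bar> \<le> ((p + c\<^sup>2) * (exp (- p * T) * (B * (3 + p) / p * S))) / E"
      by (simp only: pos_le_divide_eq[OF E])
    then show ?thesis by (simp add: E_def mult.commute)
  qed
  have kinf: "filterlim k at_top at_top"
    unfolding k_def[abs_def] by real_asymp
  \<comment> \<open>As \<open>k p \<le> sqrt p\<close>, and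
    \<open>sinh (k p * (pi - x)) \<ge> sinh (pi - x)\<close> once \<open>k p \<ge> 1\<close>,
    dividing by the common factor costs at most
    \<open>sqrt p * exp (sqrt p * pi) / sinh (pi - x)\<close>. The exponent
    \<open>sqrt p * pi - p * T\<close> tends to minus infinity for every positive
    \<open>T\<close>.\<close>
  have h0: "((\<lambda>p. h (k p)) \<longlongrightarrow> 0) at_top"
  proof (rule Lim_null_comparison)
    have d: "pi - x > 0" using x by simp
    show "\<forall>\<^sub>F p in at_top. norm (h (k p)) \<le> sqrt p * exp (sqrt p * pi) / sinh (pi - x) *
      ((p + c\<^sup>2) * (exp (- p * T) * (B * (3 + p) / p * S)))"
      using eventually_gt_at_top[of 0] filterlim_at_top[THEN iffD1, OF kinf, rule_format, of 1]
    proof eventually_elim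
      case (elim p)
      have pc: "p + c\<^sup>2 > 0" using elim by (simp add: add_pos_nonneg)
      have "(k p)\<^sup>2 \<le> p" using elim pc c by (simp add: k_def power_divide divide_le_eq power2_eq_square algebra_simps)
      then have k: "k p \<le> sqrt p" by (rule real_le_rsqrt)
      have "sinh (k p * pi) \<le> exp (k p * pi)" unfolding sinh_field_def by (simp add: field_simps order_trans[of _ 0])
      also have "\<dots> \<le> exp (sqrt p * pi)" using k by simp
      finally have "k p * sinh (k p * pi) \<le> sqrt p * exp (sqrt p * pi)"
        using k elim by (intro mult_mono) auto
      moreover have "sinh (pi - x) \<le> sinh (k p * (pi - x))"
        using elim d by (simp add: mult_le_cancel_right1)
      ultimately have "k p * sinh (k p * pi) / sinh (k p * (pi - x)) \<le> sqrt p * exp (sqrt p * pi) / sinh (pi - x)"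
        using d elim by (intro frac_le) auto
      then show ?case
        using main[of p] elim pc S mult_right_mono[of "k p * sinh (k p * pi) / sinh (k p * (pi - x))"
            "sqrt p * exp (sqrt p * pi) / sinh (pi - x)" "(p + c\<^sup>2) * (exp (- p * T) * (B * (3 + p) / p * S))"]
        by (auto simp: B_def)
    qed
    have "((\<lambda>p. sqrt p * exp (sqrt p * pi) * ((p + c\<^sup>2) * (exp (- p * T) * ((3 + p) / p)))) \<longlongrightarrow> 0) at_top"
      using T by real_asymp
    from tendsto_mult_left_zero[OF this, of "B * S / sinh (pi - x)"]
    show "((\<lambda>p. sqrt p * exp (sqrt p * pi) / sinh (pi - x) *
      ((p + c\<^sup>2) * (exp (- p * T) * (B * (3 + p) / p * S)))) \<longlongrightarrow> 0) at_top"
      by (simp add: field_simps)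
  qed
  have i: "filterlim (\<lambda>y. sinh (y * \<alpha>)) at_top at_top" if "\<alpha> > 0" for \<alpha> :: real
    unfolding sinh_field_def using that by real_asymp
  have q: "((\<lambda>y. sinh (y * \<alpha>1) / sinh (y * \<alpha>2)) \<longlongrightarrow> 0) at_top"
    unfolding sinh_field_def using \<alpha> by real_asymp
  have \<alpha>2: "\<alpha>2 > 0" using \<alpha> by simp
  \<comment> \<open>Division by the dominant \<open>sinh (k p * \<alpha>2)\<close> isolates
    \<open>b\<close>, since the other source is negligible against it. With \<open>b = 0\<close>
    known, division by \<open>sinh (k p * \<alpha>1)\<close> isolates \<open>a\<close>.\<close>
  have lim0: "((\<lambda>p. h (k p) / sinh (k p * \<alpha>2)) \<longlongrightarrow> 0) at_top"
    by (intro tendsto_divide_0[OF h0] filterlim_at_top_imp_at_infinity filterlim_compose[OF i[OF \<alpha>2] kinf])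
  have limb: "((\<lambda>p. a * (sinh (k p * \<alpha>1) / sinh (k p * \<alpha>2)) + b) \<longlongrightarrow> a * 0 + b) at_top"
    by (intro tendsto_intros filterlim_compose[OF q kinf])
  have "\<forall>\<^sub>F p in at_top. h (k p) / sinh (k p * \<alpha>2) = a * (sinh (k p * \<alpha>1) / sinh (k p * \<alpha>2)) + b"
    using filterlim_at_top[THEN iffD1, OF kinf, rule_format, of 1]
  proof eventually_elim
    case (elim p)
    then have "sinh (k p * \<alpha>2) \<noteq> 0" using \<alpha>2 by simp
    then show ?case by (simp add: h_def field_simps)
  qed
  from tendsto_unique[OF trivial_limit_at_top_linorder Lim_transform_eventually[OF lim0 this] limb]
  have b: "b = 0" by simp
  have "((\<lambda>p. h (k p) / sinh (k p * \<alpha>1)) \<longlongrightarrow> 0) at_top"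
    by (intro tendsto_divide_0[OF h0] filterlim_at_top_imp_at_infinity filterlim_compose[OF i[OF \<alpha>(1)] kinf])
  moreover have "\<forall>\<^sub>F p in at_top. h (k p) / sinh (k p * \<alpha>1) = a"
    using filterlim_at_top[THEN iffD1, OF kinf, rule_format, of 1]
  proof eventually_elim
    case (elim p)
    then have "sinh (k p * \<alpha>1) \<noteq> 0" using \<alpha> by simp
    then show ?case by (simp add: h_def b)
  qed
  ultimately have "((\<lambda>p :: real. a) \<longlongrightarrow> 0) at_top" by (rule Lim_transform_eventually)
  then have "a = 0" by (simp add: tendsto_const_iff)
  then show ?thesis using b by simp
qed

section \<open>The adjoint states\<close>

text \<open>A representative with a value at every \<open>(t, x)\<close>, for which pointwise
  statements make sense.\<close>

definition adjoint_profile :: "real \<Rightarrow> real \<Rightarrow> real \<Rightarrow> real \<times> real \<Rightarrow> real" where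
  "adjoint_profile c T \<alpha> = (\<lambda>(t, x). 2 / pi * (\<Sum>n. mode c n (T - t) * (sin (real n * \<alpha>) * sin (real n * x))))"

lemma adjoint_profile_bound:
  assumes "t \<le> T"
  shows "\<bar>adjoint_profile c T \<alpha> (t, x)\<bar> \<le> 2 / pi * (\<Sum>n. 1 / (real n)\<^sup>2)"
proof -
  let ?f = "\<lambda>n. mode c n (T - t) * (sin (real n * \<alpha>) * sin (real n * x))"
  have "\<bar>\<Sum>n. ?f n\<bar> \<le> (\<Sum>n. \<bar>?f n\<bar>)" using summable_modes(1)[of "T - t" c \<alpha> x] assms by (intro summable_rabs) auto
  also have "\<dots> \<le> (\<Sum>n. 1 / (real n)\<^sup>2)"
    by (intro suminf_le summable_modes summable_inverse_square) (use assms in auto)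
  finally have "\<bar>2 / pi\<bar> * \<bar>\<Sum>n. ?f n\<bar> \<le> \<bar>2 / pi\<bar> * (\<Sum>n. 1 / (real n)\<^sup>2)" by (intro mult_left_mono) auto
  then show ?thesis by (simp add: adjoint_profile_def abs_mult)
qed

lemma adjoint_profile_smooth:
  assumes "c > 0" "0 < \<alpha>" "\<alpha> < pi"
  shows "smooth_on ({0<..<T} \<times> {\<alpha><..<pi}) (adjoint_profile c T \<alpha>)"
proof -
  let ?G = "\<lambda>(s, x). \<Sum>n. mode c n s * (sin (real n * \<alpha>) * sin (real n * x))"
  let ?S = "{0<..<T} \<times> {\<alpha><..<pi}" and ?L = "\<lambda>p :: real \<times> real. (- fst p, snd p)"
  have op: "open ?S" by (intro open_Times) auto
  have "bounded_linear ?L" by (intro bounded_linear_Pair bounded_linear_minus bounded_linear_fst bounded_linear_snd)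
  then have "smooth_on ?S (\<lambda>p. ?G ((T, 0) + ?L p))"
    by (rule smooth_on_affine[OF op op _ _ mode_series_smooth[OF assms]]) auto
  from smooth_on_mult[OF op smooth_on_const[OF op, of "2 / pi"] this]
  show ?thesis by (simp add: adjoint_profile_def case_prod_unfold)
qed

text \<open>For each fixed \<open>t\<close> the sine expansion gives equality at almost every
  \<open>x\<close>. Passing to almost every point of the rectangle is Fubini, which needs the set of
  equality to be jointly measurable.\<close>

lemma weak_adjoint_solution_profile:
  assumes c: "c > 0" and T: "T > 0" and sol: "weak_adjoint_solution c T \<alpha> \<zeta> \<xi>"
  shows "AE p in lborel. p \<in> {0<..<T} \<times> {0<..<pi} \<longrightarrow> (case p of (t, x) \<Rightarrow> \<xi> t x) = adjoint_profile c T \<alpha> p"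
proof -
  let ?P = "{0<..<T} \<times> {0<..<pi}" and ?\<xi> = "\<lambda>(t, x). \<xi> t x"
  have L2: "L2_on ?P ?\<xi>" "\<And>t. t \<in> {0..T} \<Longrightarrow> L2_on {0<..<pi} (\<xi> t)"
    using sol by (simp_all add: weak_adjoint_solution_def C_L2_def)
  have t: "AE x in lborel. x \<in> {0<..<pi} \<longrightarrow> \<xi> t x = adjoint_profile c T \<alpha> (t, x)" if t: "t \<in> {0<..<T}" for t
  proof -
    have "AE x in lborel. x \<in> {0<..<pi} \<longrightarrow> \<xi> t x = 2 / pi * (\<Sum>n. (sin (real n * \<alpha>) * mode c n (T - t)) * sin (real n * x))"
    proof (rule sine_series_AE)
      show "set_integrable lborel {0<..<pi} (\<xi> t)" using L2(2)[of t] t by (intro L2_on_imp_set_integrable) auto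
      show "(LINT x:{0<..<pi}|lborel. \<xi> t x * sin (real n * x)) = sin (real n * \<alpha>) * mode c n (T - t)" for n
        using weak_adjoint_solution_coeff[OF c T sol, of t n] t by simp
      show "summable (\<lambda>n. \<bar>sin (real n * \<alpha>) * mode c n (T - t)\<bar>)"
      proof (rule summable_comparison_test'[OF summable_inverse_square, of 1])
        fix n :: nat assume "n \<ge> 1"
        then have "\<bar>sin (real n * \<alpha>)\<bar> * \<bar>mode c n (T - t)\<bar> \<le> 1 * (1 / (real n)\<^sup>2)"
          using t by (intro mult_mono mode_bounds(1)) auto
        then show "norm \<bar>sin (real n * \<alpha>) * mode c n (T - t)\<bar> \<le> 1 / (real n)\<^sup>2" by (simp add: abs_mult)
      qed
    qed
    then show ?thesis by (simp add: adjoint_profile_def mult_ac)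
  qed
  have m\<xi>: "(\<lambda>p. indicator ?P p *\<^sub>R ?\<xi> p) \<in> borel_measurable lborel"
    using L2(1) by (simp add: L2_on_def set_borel_measurable_def)
  have "continuous_on UNIV (mode c n)" for n
    by (intro continuous_at_imp_continuous_on ballI DERIV_isCont[OF mode_deriv(1)])
  then have [measurable]: "mode c n \<in> borel_measurable borel" for n by (intro borel_measurable_continuous_onI)
  have mg: "adjoint_profile c T \<alpha> \<in> borel_measurable lborel"
  proof -
    have "(\<lambda>p. 2 / pi * (\<Sum>n. mode c n (T - fst p) * (sin (real n * \<alpha>) * sin (real n * snd p)))) \<in> borel_measurable (borel \<Otimes>\<^sub>M borel)"
      by measurable
    then show ?thesis by (simp add: adjoint_profile_def case_prod_unfold borel_prod)
  qed
  have P: "?P \<in> sets lborel" by (simp add: borel_open open_Times)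
  let ?Q = "\<lambda>p. p \<in> ?P \<longrightarrow> ?\<xi> p = adjoint_profile c T \<alpha> p"
  \<comment> \<open>Both sides are cut off to the rectangle because joint measurability of \<xi> is
    known only there.\<close>
  have "{p \<in> space lborel. indicator ?P p *\<^sub>R ?\<xi> p = indicator ?P p *\<^sub>R adjoint_profile c T \<alpha> p} \<in> sets lborel"
    by (rule borel_measurable_eq[OF m\<xi> borel_measurable_scaleR[OF borel_measurable_indicator[OF P] mg]])
  also have "{p \<in> space lborel. indicator ?P p *\<^sub>R ?\<xi> p = indicator ?P p *\<^sub>R adjoint_profile c T \<alpha> p}
      = {p \<in> space (lborel \<Otimes>\<^sub>M lborel). ?Q p}"
    by (auto simp: indicator_def space_pair_measure split: if_splits)
  finally have ms: "{p \<in> space (lborel \<Otimes>\<^sub>M lborel). ?Q p} \<in> sets (lborel \<Otimes>\<^sub>M lborel)" by (simp only: lborel_prod)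
  have "AE t in lborel. AE x in lborel. ?Q (t, x)"
  proof (rule AE_I2)
    fix t show "AE x in lborel. ?Q (t, x)"
      using t[of t] by (cases "t \<in> {0<..<T}") auto
  qed
  from lborel_pair.AE_pair_measure[OF ms this] show ?thesis by (simp only: lborel_prod)
qed

lemma weak_adjoint_solution_bounded_smooth:
  assumes c: "c > 0" and T: "T > 0" and \<alpha>: "0 < \<alpha>" "\<alpha> < 1" and sol: "weak_adjoint_solution c T \<alpha> \<zeta> \<xi>"
  shows "bounded_smooth_ae_on ({0<..<T} \<times> {1<..<pi}) (\<lambda>(t, x). \<xi> t x)"
  unfolding bounded_smooth_ae_on_def
proof (intro exI conjI)
  let ?S = "{0<..<T} \<times> {1<..<pi}"
  have "\<alpha> < pi" using \<alpha>(2) pi_gt3 by linarith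
  from adjoint_profile_smooth[OF c \<alpha>(1) this, of T]
  show "smooth_on ?S (adjoint_profile c T \<alpha>)" by (rule smooth_on_subset) (use \<alpha> in auto)
  show "bounded (adjoint_profile c T \<alpha> ` ?S)"
    unfolding bounded_iff using adjoint_profile_bound[of _ T c \<alpha>] by (auto intro!: exI[of _ "2 / pi * (\<Sum>n. 1 / (real n)\<^sup>2)"])
  show "AE p in lborel. p \<in> ?S \<longrightarrow> (\<lambda>(t, x). \<xi> t x) p = adjoint_profile c T \<alpha> p"
    using weak_adjoint_solution_profile[OF c T sol] by eventually_elim auto
qed

text \<open>The profile may have a kink at \<open>x = \<alpha>\<close>, where the cut-off vanishes.
  The rectangle is covered by the strip over \<open>(1, \<pi>)\<close>, where both factors are
  smooth, and by the complement of the closed support, where the product is zero.\<close>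

lemma cutoff_bounded_smooth:
  assumes c: "c > 0" and T: "T > 0" and \<alpha>: "0 < \<alpha>" "\<alpha> < 1" and sol: "weak_adjoint_solution c T \<alpha> \<zeta> \<xi>"
    and \<omega>: "\<omega> \<subseteq> {1<..<pi}" and \<rho>: "cutoff \<omega> \<eta> \<rho>"
  shows "bounded_smooth_ae_on ({0<..<T} \<times> {0<..<pi}) (\<lambda>(t, x). \<rho> x * \<xi> t x)"
  unfolding bounded_smooth_ae_on_def
proof (intro exI conjI)
  let ?P = "{0<..<T} \<times> {0<..<pi}" and ?S = "{0<..<T} \<times> {1<..<pi}"
  define K where "K = closure {x. \<rho> x \<noteq> 0}"
  let ?g = "\<lambda>p. \<rho> (snd p) * adjoint_profile c T \<alpha> p"
  have \<rho>s: "smooth_on UNIV \<rho>" and K: "K \<subseteq> {1<..<pi}" using \<rho> \<omega> by (auto simp: cutoff_def K_def)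
  have clK: "closed K" by (simp add: K_def)
  have \<rho>0: "\<rho> x = 0" if "x \<notin> K" for x using that closure_subset[of "{x. \<rho> x \<noteq> 0}"] by (auto simp: K_def)
  have S: "smooth_on ?S (adjoint_profile c T \<alpha>)"
  proof -
    have "\<alpha> < pi" using \<alpha>(2) pi_gt3 by linarith
    from adjoint_profile_smooth[OF c \<alpha>(1) this, of T] show ?thesis by (rule smooth_on_subset) (use \<alpha> in auto)
  qed
  have opS: "open ?S" by (intro open_Times) auto
  show "smooth_on ?P ?g"
  proof (rule smooth_on_locally)
    fix p assume p: "p \<in> ?P"
    show "\<exists>U. open U \<and> p \<in> U \<and> smooth_on U ?g"
    proof (cases "snd p \<in> K")
      case True
      have "smooth_on ?S (\<lambda>p. \<rho> (0 + snd p))"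
        by (rule smooth_on_affine[OF open_UNIV opS bounded_linear_snd _ \<rho>s]) simp
      then have "smooth_on ?S ?g" using S by (intro smooth_on_mult opS) auto
      then show ?thesis using opS p True K by (intro exI[of _ ?S]) auto
    next
      case False
      have op: "open ({0<..<T} \<times> (- K))" using clK by (intro open_Times) auto
      have "smooth_on ({0<..<T} \<times> (- K)) ?g \<longleftrightarrow> smooth_on ({0<..<T} \<times> (- K)) (\<lambda>p. 0)"
        by (rule smooth_on_cong[OF op]) (auto simp: \<rho>0)
      then have "smooth_on ({0<..<T} \<times> (- K)) ?g" using smooth_on_const[OF op] by blast
      moreover have "p \<in> {0<..<T} \<times> (- K)" using p False by auto
      ultimately show ?thesis using op by blast
    qed
  qed
  have "compact K" using K clK bounded_subset[of "{1<..<pi}" K] by (simp add: compact_eq_bounded_closed)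
  then have "bounded (\<rho> ` K)"
    using smooth_on_continuous[OF \<rho>s] by (intro compact_imp_bounded compact_continuous_image) (auto intro: continuous_on_subset)
  then obtain R where R: "\<And>x. x \<in> K \<Longrightarrow> \<bar>\<rho> x\<bar> \<le> R" unfolding bounded_iff by (metis image_eqI real_norm_def)
  have "\<bar>\<rho> x\<bar> \<le> max R 0" for x using R[of x] \<rho>0[of x] by (cases "x \<in> K") auto
  then have "\<bar>?g p\<bar> \<le> max R 0 * (2 / pi * (\<Sum>n. 1 / (real n)\<^sup>2))" if "p \<in> ?P" for p
    unfolding abs_mult using adjoint_profile_bound[of "fst p" T c \<alpha> "snd p"] that by (intro mult_mono) auto
  then show "bounded (?g ` ?P)" unfolding bounded_iff by (intro exI[of _ "max R 0 * (2 / pi * (\<Sum>n. 1 / (real n)\<^sup>2))"]) auto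
  show "AE p in lborel. p \<in> ?P \<longrightarrow> (\<lambda>(t, x). \<rho> x * \<xi> t x) p = ?g p"
    using weak_adjoint_solution_profile[OF c T sol] by eventually_elim auto
qed

lemma L2_on_subset: "L2_on A u \<Longrightarrow> B \<in> sets lborel \<Longrightarrow> B \<subseteq> A \<Longrightarrow> L2_on B u"
  unfolding L2_on_def by (auto intro: set_integrable_subset set_borel_measurable_subset)

text \<open>The line over a single \<open>x\<close> is a null set, so the relation cannot be
  restricted to it directly. Continuity of the profiles first extends the relation to every point of
  the open set \<open>{0<..<T} \<times> \<omega>\<close>; any \<open>x\<close> in \<omega> then lies
  to the right of both sources.\<close>

lemma weak_adjoint_solutions_independent:
  assumes c: "c > 0" and T: "T > 0" and \<omega>: "open \<omega>" "\<omega> \<noteq> {}" "\<omega> \<subseteq> {1<..<pi}"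
    and \<alpha>: "0 < \<alpha>1" "\<alpha>1 < \<alpha>2" "\<alpha>2 < 1"
    and sol: "weak_adjoint_solution c T \<alpha>1 \<zeta>1 \<xi>1" "weak_adjoint_solution c T \<alpha>2 \<zeta>2 \<xi>2"
  shows "L2_linearly_independent ({0<..<T} \<times> \<omega>) (\<lambda>(t, x). \<xi>1 t x) (\<lambda>(t, x). \<xi>2 t x)"
  unfolding L2_linearly_independent_def
proof (intro conjI allI impI)
  let ?P = "{0<..<T} \<times> {0<..<pi}" and ?W = "{0<..<T} \<times> \<omega>"
  have op: "open ?W" using \<omega> by (intro open_Times) auto
  have sub: "?W \<subseteq> ?P" using \<omega> by auto
  have "L2_on ?P (\<lambda>(t, x). \<xi>1 t x)" "L2_on ?P (\<lambda>(t, x). \<xi>2 t x)"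
    using sol by (simp_all add: weak_adjoint_solution_def)
  then show "L2_on ?W (\<lambda>(t, x). \<xi>1 t x)" "L2_on ?W (\<lambda>(t, x). \<xi>2 t x)"
    using op sub by (auto intro!: L2_on_subset[OF _ _ sub] borel_open)
  fix a b
  assume z: "AE p in lborel. p \<in> ?W \<longrightarrow> a * (case p of (t, x) \<Rightarrow> \<xi>1 t x) + b * (case p of (t, x) \<Rightarrow> \<xi>2 t x) = 0"
  let ?h = "\<lambda>p. a * adjoint_profile c T \<alpha>1 p + b * adjoint_profile c T \<alpha>2 p"
  have cont: "continuous_on ?W (adjoint_profile c T \<alpha>)" if "0 < \<alpha>" "\<alpha> < 1" for \<alpha>
  proof -
    have "\<alpha> < pi" using that(2) pi_gt3 by linarith
    from smooth_on_continuous[OF adjoint_profile_smooth[OF c that(1) this]] show ?thesis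
      by (rule continuous_on_subset) (use \<omega> that in auto)
  qed
  have AE: "AE p in lborel. p \<in> ?W \<longrightarrow> ?h p = 0"
    using z weak_adjoint_solution_profile[OF c T sol(1)] weak_adjoint_solution_profile[OF c T sol(2)]
  proof eventually_elim
    case (elim p)
    then show ?case using sub by (auto simp del: mem_Sigma_iff)
  qed
  obtain x where x: "x \<in> \<omega>" using \<omega> by blast
  have h0: "?h (t, x) = 0" if "t \<in> {0<..<T}" for t
    by (rule continuous_AE_zero_imp_zero[OF op _ AE])
      (use that x \<alpha> in \<open>auto intro!: continuous_intros cont\<close>)
  have "a = 0 \<and> b = 0"
  proof (rule mode_series_independent[OF c T \<alpha>(1,2)])
    show "x \<in> {\<alpha>2<..<pi}" using x \<omega> \<alpha> by force
    fix s assume "s \<in> {0<..<T}"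
    then have "2 / pi * (a * (\<Sum>n. mode c n s * (sin (real n * \<alpha>1) * sin (real n * x)))
      + b * (\<Sum>n. mode c n s * (sin (real n * \<alpha>2) * sin (real n * x)))) = 0"
      using h0[of "T - s"] by (simp add: adjoint_profile_def algebra_simps)
    then show "a * (\<Sum>n. mode c n s * (sin (real n * \<alpha>1) * sin (real n * x)))
      + b * (\<Sum>n. mode c n s * (sin (real n * \<alpha>2) * sin (real n * x))) = 0" by simp
  qed
  then show "a = 0" "b = 0" by auto
qed

theorem proposition1p2:
  fixes p :: "real \<Rightarrow> real"
    and c T \<alpha>1 \<alpha>2 :: real
    and \<omega> :: "real set"
    and \<zeta>1 \<xi>1 \<zeta>2 \<xi>2 :: "real \<Rightarrow> real \<Rightarrow> real"
  assumes "\<exists>U. open U \<and> 1 \<in> U \<and> smooth_on U p"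
    and "deriv p 1 > 0"
    and "c = sqrt (deriv p 1)"
    and "T > 0"
    and "open \<omega>" and "\<omega> \<noteq> {}" and "\<omega> \<subseteq> {1<..<pi}"
    and "0 < \<alpha>1" and "\<alpha>1 < \<alpha>2" and "\<alpha>2 < 1"
    and "weak_adjoint_solution c T \<alpha>1 \<zeta>1 \<xi>1"
    and "weak_adjoint_solution c T \<alpha>2 \<zeta>2 \<xi>2"
  shows "bounded_smooth_ae_on ({0<..<T} \<times> {1<..<pi}) (\<lambda>(t, x). \<xi>1 t x)
    \<and> bounded_smooth_ae_on ({0<..<T} \<times> {1<..<pi}) (\<lambda>(t, x). \<xi>2 t x)
    \<and> (\<forall>\<eta> \<rho>. \<eta> > 0 \<and> cutoff \<omega> \<eta> \<rho> \<longrightarrow>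
          bounded_smooth_ae_on ({0<..<T} \<times> {0<..<pi}) (\<lambda>(t, x). \<rho> x * \<xi>1 t x)
        \<and> bounded_smooth_ae_on ({0<..<T} \<times> {0<..<pi}) (\<lambda>(t, x). \<rho> x * \<xi>2 t x))
    \<and> L2_linearly_independent ({0<..<T} \<times> \<omega>) (\<lambda>(t, x). \<xi>1 t x) (\<lambda>(t, x). \<xi>2 t x)"
proof -
  have c: "c > 0" using assms(2,3) by simp
  have \<alpha>: "\<alpha>1 < 1" "0 < \<alpha>2" using assms(8-10) by auto
  show ?thesis
    using weak_adjoint_solution_bounded_smooth[OF c assms(4,8) \<alpha>(1) assms(11)]
      weak_adjoint_solution_bounded_smooth[OF c assms(4) \<alpha>(2) assms(10,12)]
      cutoff_bounded_smooth[OF c assms(4,8) \<alpha>(1) assms(11,7)]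
      cutoff_bounded_smooth[OF c assms(4) \<alpha>(2) assms(10,12,7)]
      weak_adjoint_solutions_independent[OF c assms(4-12)]
    by blast
qed

end
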